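(* Let $\Omega\subset\mathbb R^n$ be a bounded open set with $C^2$ boundary, let $L,F,G$ satisfy the assumptions below. Let $(u,m)$ be a mild solution of the constrained MFG problem in $\overline\Omega$ and let $(t,x)\in\partial Q_m$. Then $$-p_1+H^\tau(x,p_2)=F(x,m(t))\qquad\forall(p_1,p_2)\in D^+u(t,x).$$
   Context: $T>0$; $U\supset\overline\Omega$ open; $\nu(x)$ the outward unit normal at $x\in\partial\Omega$; $\mathcal P(\overline\Omega)$ with the Kantorovich–Rubinstein distance $d_1$. Assumptions: (D1) $|F(x,m_1)-F(x,m_2)|+|G(x,m_1)-G(x,m_2)|\le\kappa d_1(m_1,m_2)$; (D2) $F(\cdot,m),G(\cdot,m)\in C^1_b(U)$, $|D_xF|+|D_xG|\le\kappa$; (D3) $x\mapsto F(x,m)$ semiconcave with linear modulus uniformly in $m$; (L0) $L\in C^1(U\times\mathbb R^n)$, $|L(x,0)|+|D_xL(x,0)|+|D_vL(x,0)|\le M$; (L1) $D_vL$ differentiable, $I/\mu\le D^2_{vv}L\le\mu I$, $\|D^2_{vx}L(x,v)\|\le\mu(1+|v|)$; (L2) $|D_xL(x,v)-D_xL(x,w)|\le C(R)|v-w|$ for $v,w\in B_R$; (L3) $x\mapsto L(x,v)$ semiconcave with linear modulus uniformly in $v\in B_R$. $H(x,p)=\sup_v\{-\langle p,v\rangle-L(x,v)\}$. Tangential Hamiltonian: for $x\in\partial\Omega$, $H^\tau(x,p)=\sup\{-\langle p,v\rangle-L(x,v):v\in\mathbb R^n,\ \langle v,\nu(x)\rangle=0\}$.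 $\Gamma$: absolutely continuous curves $[0,T]\to\overline\Omega$; $\Gamma_t[x]=\{\gamma:\gamma(t)=x\}$; $e_t(\gamma)=\gamma(t)$; $m^\eta(t)=e_t\sharp\eta$; $J_\eta[\gamma]=\int_0^T[L(\gamma,\dot\gamma)+F(\gamma,m^\eta(t))]dt+G(\gamma(T),m^\eta(T))$; $\Gamma^\eta[x]$ minimizers of $J_\eta$ over $\Gamma_0[x]$. Constrained MFG equilibrium for $m_0$: Borel probability $\eta$ on $\Gamma$ with $e_0\sharp\eta=m_0$ and $\mathrm{supp}\,\eta\subset\bigcup_x\Gamma^\eta[x]$. Mild solution: $(u,m)\in C([0,T]\times\overline\Omega)\times C([0,T];\mathcal P(\overline\Omega))$ with, for some equilibrium $\eta$, $m(t)=e_t\sharp\eta$ and $u(t,x)=\inf_{\gamma\in\Gamma_t[x]}\{\int_t^T[L(\gamma,\dot\gamma)+F(\gamma(s),m(s))]ds+G(\gamma(T),m(T))\}$. $\partial Q_m=\{(t,x)\in(0,T)\times\partial\Omega:x\in\mathrm{supp}(m(t))\}$. $D^+u(t,x)$ is the set of $(p_1,p_2)\in\mathbb R\times\mathbb R^n$ with $\limsup_{(s,y)\to(t,x),(s,y)\in(0,T)\times\overline\Omega}\frac{u(s,y)-u(t,x)-p_1(s-t)-\langle p_2,y-x\rangle}{|s-t|+|y-x|}\le0$. *)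

theory Defs
  imports "HOL-Probability.Probability"
begin

definition C2_with_grad :: "'a::euclidean_space set \<Rightarrow> ('a \<Rightarrow> real) \<Rightarrow> ('a \<Rightarrow> 'a) \<Rightarrow> bool" where
  "C2_with_grad S f g \<longleftrightarrow>
     (\<exists>Dg. (\<forall>x\<in>S. (f has_derivative (\<lambda>h. g x \<bullet> h)) (at x)) \<and>
           (\<forall>x\<in>S. (g has_derivative Dg x) (at x)) \<and>
           (\<forall>h. continuous_on S (\<lambda>x. Dg x h)))"

definition local_defining_fn :: "'a::euclidean_space set \<Rightarrow> 'a \<Rightarrow> real \<Rightarrow> ('a \<Rightarrow> real) \<Rightarrow> ('a \<Rightarrow> 'a) \<Rightarrow> bool" where
  "local_defining_fn \<Omega> x0 r \<psi> g \<longleftrightarrow>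
     r > 0 \<and> C2_with_grad (ball x0 r) \<psi> g \<and> (\<forall>y\<in>ball x0 r. g y \<noteq> 0) \<and>
     \<Omega> \<inter> ball x0 r = {y \<in> ball x0 r. \<psi> y < 0}"

definition C2_boundary :: "'a::euclidean_space set \<Rightarrow> bool" where
  "C2_boundary \<Omega> \<longleftrightarrow> (\<forall>x0\<in>frontier \<Omega>. \<exists>r \<psi> g. local_defining_fn \<Omega> x0 r \<psi> g)"

definition outward_normal :: "'a::euclidean_space set \<Rightarrow> 'a \<Rightarrow> 'a" where
  "outward_normal \<Omega> x = (SOME \<nu>. \<exists>r \<psi> g. local_defining_fn \<Omega> x r \<psi> g \<and> \<nu> = g x /\<^sub>R norm (g x))"

definition Prob_on :: "'a::euclidean_space set \<Rightarrow> 'a measure set" where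
  "Prob_on K = {\<mu>. prob_space \<mu> \<and> sets \<mu> = sets borel \<and> emeasure \<mu> K = 1}"

definition KR_dist :: "'a::euclidean_space measure \<Rightarrow> 'a measure \<Rightarrow> real" where
  "KR_dist \<mu> \<nu> = (SUP f\<in>{f. 1-lipschitz_on UNIV f}. (\<integral>x. f x \<partial>\<mu>) - (\<integral>x. f x \<partial>\<nu>))"

definition msupport :: "'b::topological_space measure \<Rightarrow> 'b set" where
  "msupport M = {x. \<forall>S. open S \<and> x \<in> S \<longrightarrow> emeasure M S > 0}"

definition abs_cont_on :: "real set \<Rightarrow> (real \<Rightarrow> 'a::real_normed_vector) \<Rightarrow> bool" where
  "abs_cont_on S \<gamma> \<longleftrightarrow>
     (\<forall>\<epsilon>>0. \<exists>\<delta>>0. \<forall>(I::nat set) a b. finite I \<and> (\<forall>i\<in>I. a i \<le> b i \<and> a i \<in> S \<and> b i \<in> S) \<and>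
        pairwise (\<lambda>i j. {a i<..<b i} \<inter> {a j<..<b j} = {}) I \<and> (\<Sum>i\<in>I. b i - a i) < \<delta>
        \<longrightarrow> (\<Sum>i\<in>I. norm (\<gamma> (b i) - \<gamma> (a i))) < \<epsilon>)"

text \<open>Continuous curves [0,T] \<rightarrow> closure \<Omega>, represented as bounded continuous
  functions on the real line that are constant outside [0,T] (so the sup metric is
  the uniform metric on [0,T]).\<close>
definition Cpaths :: "'a::euclidean_space set \<Rightarrow> real \<Rightarrow> (real \<Rightarrow>\<^sub>C 'a) set" where
  "Cpaths \<Omega> T = {\<gamma>. (\<forall>s. apply_bcontfun \<gamma> s = apply_bcontfun \<gamma> (max 0 (min T s))) \<and>
                    (\<forall>s\<in>{0..T}. apply_bcontfun \<gamma> s \<in> closure \<Omega>)}"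

definition Gamma :: "'a::euclidean_space set \<Rightarrow> real \<Rightarrow> (real \<Rightarrow>\<^sub>C 'a) set" where
  "Gamma \<Omega> T = {\<gamma> \<in> Cpaths \<Omega> T. abs_cont_on {0..T} (apply_bcontfun \<gamma>)}"

definition Gamma_at :: "'a::euclidean_space set \<Rightarrow> real \<Rightarrow> real \<Rightarrow> 'a \<Rightarrow> (real \<Rightarrow>\<^sub>C 'a) set" where
  "Gamma_at \<Omega> T t x = {\<gamma> \<in> Gamma \<Omega> T. apply_bcontfun \<gamma> t = x}"

definition ext_integral :: "real set \<Rightarrow> (real \<Rightarrow> real) \<Rightarrow> ereal" where
  "ext_integral S f = enn2ereal (\<integral>\<^sup>+s\<in>S. ennreal (f s) \<partial>lebesgue)
                       - enn2ereal (\<integral>\<^sup>+s\<in>S. ennreal (- f s) \<partial>lebesgue)"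

definition cost :: "('a::euclidean_space \<Rightarrow> 'a \<Rightarrow> real) \<Rightarrow> ('a \<Rightarrow> 'a measure \<Rightarrow> real) \<Rightarrow>
    ('a \<Rightarrow> 'a measure \<Rightarrow> real) \<Rightarrow> real \<Rightarrow> (real \<Rightarrow> 'a measure) \<Rightarrow> real \<Rightarrow> (real \<Rightarrow>\<^sub>C 'a) \<Rightarrow> ereal" where
  "cost L F G T m t \<gamma> =
     ext_integral {t..T} (\<lambda>s. L (apply_bcontfun \<gamma> s) (vector_derivative (apply_bcontfun \<gamma>) (at s))
                              + F (apply_bcontfun \<gamma> s) (m s))
     + ereal (G (apply_bcontfun \<gamma> T) (m T))"

definition eval_flow :: "(real \<Rightarrow>\<^sub>C 'a::euclidean_space) measure \<Rightarrow> real \<Rightarrow> 'a measure" where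
  "eval_flow \<eta> t = distr \<eta> borel (\<lambda>\<gamma>. apply_bcontfun \<gamma> t)"

definition optimal_curves :: "'a::euclidean_space set \<Rightarrow> real \<Rightarrow> ('a \<Rightarrow> 'a \<Rightarrow> real) \<Rightarrow>
    ('a \<Rightarrow> 'a measure \<Rightarrow> real) \<Rightarrow> ('a \<Rightarrow> 'a measure \<Rightarrow> real) \<Rightarrow> (real \<Rightarrow>\<^sub>C 'a) measure \<Rightarrow> 'a \<Rightarrow> (real \<Rightarrow>\<^sub>C 'a) set" where
  "optimal_curves \<Omega> T L F G \<eta> x =
     {\<gamma> \<in> Gamma_at \<Omega> T 0 x. \<forall>\<gamma>'\<in>Gamma_at \<Omega> T 0 x.
        cost L F G T (eval_flow \<eta>) 0 \<gamma> \<le> cost L F G T (eval_flow \<eta>) 0 \<gamma>'}"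

definition constrained_equilibrium :: "'a::euclidean_space set \<Rightarrow> real \<Rightarrow> ('a \<Rightarrow> 'a \<Rightarrow> real) \<Rightarrow>
    ('a \<Rightarrow> 'a measure \<Rightarrow> real) \<Rightarrow> ('a \<Rightarrow> 'a measure \<Rightarrow> real) \<Rightarrow> 'a measure \<Rightarrow> (real \<Rightarrow>\<^sub>C 'a) measure \<Rightarrow> bool" where
  "constrained_equilibrium \<Omega> T L F G m0 \<eta> \<longleftrightarrow>
     prob_space \<eta> \<and> sets \<eta> = sets borel \<and> emeasure \<eta> (Cpaths \<Omega> T) = 1 \<and>
     eval_flow \<eta> 0 = m0 \<and>
     msupport \<eta> \<subseteq> (\<Union>x\<in>closure \<Omega>. optimal_curves \<Omega> T L F G \<eta> x)"

definition mild_solution :: "'a::euclidean_space set \<Rightarrow> real \<Rightarrow> ('a \<Rightarrow> 'a \<Rightarrow> real) \<Rightarrow>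
    ('a \<Rightarrow> 'a measure \<Rightarrow> real) \<Rightarrow> ('a \<Rightarrow> 'a measure \<Rightarrow> real) \<Rightarrow>
    (real \<Rightarrow> 'a \<Rightarrow> real) \<Rightarrow> (real \<Rightarrow> 'a measure) \<Rightarrow> bool" where
  "mild_solution \<Omega> T L F G u m \<longleftrightarrow>
     continuous_on ({0..T} \<times> closure \<Omega>) (\<lambda>(t, x). u t x) \<and>
     (\<forall>t\<in>{0..T}. m t \<in> Prob_on (closure \<Omega>)) \<and>
     (\<forall>t\<in>{0..T}. \<forall>\<epsilon>>0. \<exists>\<delta>>0. \<forall>s\<in>{0..T}. \<bar>s - t\<bar> < \<delta> \<longrightarrow> KR_dist (m s) (m t) < \<epsilon>) \<and>
     (\<exists>\<eta>. constrained_equilibrium \<Omega> T L F G (m 0) \<eta> \<and>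
          (\<forall>t\<in>{0..T}. m t = eval_flow \<eta> t) \<and>
          (\<forall>t\<in>{0..T}. \<forall>x\<in>closure \<Omega>.
             ereal (u t x) = (INF \<gamma>\<in>Gamma_at \<Omega> T t x. cost L F G T m t \<gamma>)))"

definition Hamiltonian :: "('a::euclidean_space \<Rightarrow> 'a \<Rightarrow> real) \<Rightarrow> 'a \<Rightarrow> 'a \<Rightarrow> real" where
  "Hamiltonian L x p = (SUP v\<in>UNIV. - (p \<bullet> v) - L x v)"

definition tangential_Hamiltonian :: "'a::euclidean_space set \<Rightarrow> ('a \<Rightarrow> 'a \<Rightarrow> real) \<Rightarrow> 'a \<Rightarrow> 'a \<Rightarrow> real" where
  "tangential_Hamiltonian \<Omega> L x p =
     (SUP v\<in>{v. v \<bullet> outward_normal \<Omega> x = 0}. - (p \<bullet> v) - L x v)"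

definition superdiff :: "'a::euclidean_space set \<Rightarrow> real \<Rightarrow> (real \<Rightarrow> 'a \<Rightarrow> real) \<Rightarrow> real \<Rightarrow> 'a \<Rightarrow> (real \<times> 'a) set" where
  "superdiff \<Omega> T u t x =
     {(p1, p2). \<forall>\<epsilon>>0. \<exists>\<delta>>0. \<forall>s y. s \<in> {0<..<T} \<and> y \<in> closure \<Omega> \<and> \<bar>s - t\<bar> + norm (y - x) < \<delta> \<longrightarrow>
        u s y - u t x - p1 * (s - t) - p2 \<bullet> (y - x) \<le> \<epsilon> * (\<bar>s - t\<bar> + norm (y - x))}"

definition boundary_Q :: "'a::euclidean_space set \<Rightarrow> real \<Rightarrow> (real \<Rightarrow> 'a measure) \<Rightarrow> (real \<times> 'a) set" where
  "boundary_Q \<Omega> T m = {(t, x). t \<in> {0<..<T} \<and> x \<in> frontier \<Omega> \<and> x \<in> msupport (m t)}"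

definition semiconcave_lin :: "'a::euclidean_space set \<Rightarrow> real \<Rightarrow> ('a \<Rightarrow> real) \<Rightarrow> bool" where
  "semiconcave_lin U C f \<longleftrightarrow>
     (\<forall>x h. closed_segment (x - h) (x + h) \<subseteq> U \<longrightarrow> f (x + h) + f (x - h) - 2 * f x \<le> C * (norm h)\<^sup>2)"

end

theory Submission
  imports Defs "HOL-Complex_Analysis.Great_Picard"
begin

text \<open>
  Fix \<open>(p\<^sub>1, p\<^sub>2)\<close> in the superdifferential at \<open>(t, x)\<close> and put
  \<open>\<phi>(v) = L(x,v) + F(x,m(t)) + p\<^sub>1 + \<langle>p\<^sub>2,v\<rangle>\<close>; the claim is that \<open>\<phi>\<close> has minimum 0 on the tangent
  hyperplane. Running along a straight line into the domain and using dynamic programming gives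
  \<open>\<phi> \<ge> 0\<close> on strictly inward velocities, hence on tangential ones by continuity.

  For the converse, optimal curves have uniformly bounded energy, so by compactness some optimal curve
  \<open>\<gamma>\<close> in the support of the equilibrium satisfies \<open>\<gamma>(t) = x\<close>. Testing the superdifferential along \<open>\<gamma>\<close>
  backwards in time bounds the mean velocities over \<open>[t - h, t]\<close> and shows that each of their limits \<open>v\<close>
  satisfies \<open>\<phi>(v) \<le> 0\<close>. No regularity theory for constrained minimisers is needed to see that \<open>v\<close> is
  tangential: replacing \<open>\<gamma>\<close> on \<open>[t - h, t + h]\<close> by its chord, pushed slightly into the domain, changes
  the cost by \<open>o(h)\<close> only, whereas strong convexity of \<open>L\<close> gains the squared deviation of the velocity
  from its mean. Thus the mean velocities before and after \<open>t\<close> have the same limit, the former pointing out of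
  the domain and the latter into it.

  Since curves are only absolutely continuous, this rests on the fundamental theorem of calculus for
  such curves, which is obtained from Radon-Nikodym applied to the variation measure and from
  Lebesgue's differentiation theorem.
\<close>

section \<open>Absolutely continuous curves\<close>

text \<open>Testing the superdifferential along an optimal curve is informative on one side only.
  Before t it bounds the running cost from above, which is what \<phi>(v) \<le> 0 needs; after t it
  would bound the running cost from below, an inequality of the kind \<phi> \<ge> 0. Past positions
  show only that the limit v does not point strictly inward, so the other sign has to come from the
  future, where no bound on the mean velocity is available beforehand. Hence the comparison on an
  interval symmetric about t: the chord velocity is the average of the past and the future mean
  velocity, so once it is close to the past one, the future one is close as well. The comparison
  estimate has the chord velocity and the deviation on its own right-hand side; they are absorbed
  because past velocities are bounded, quadratic growth of the cost being set against linear growth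
  of the test function. The chord of two points of the closure may leave the domain, and the push
  repairing this must be small relative to the length of the chord; this is possible near x because
  the gradient of the defining function oscillates little there.\<close>

definition fine_family :: "real set \<Rightarrow> real \<Rightarrow> 'i set \<Rightarrow> ('i \<Rightarrow> real) \<Rightarrow> ('i \<Rightarrow> real) \<Rightarrow> bool" where
  "fine_family S \<delta> I a b \<longleftrightarrow> finite I \<and> (\<forall>i\<in>I. a i \<le> b i \<and> a i \<in> S \<and> b i \<in> S) \<and>
     pairwise (\<lambda>i j. {a i<..<b i} \<inter> {a j<..<b j} = {}) I \<and> (\<Sum>i\<in>I. b i - a i) < \<delta>"

lemma fine_familyI:
  assumes "finite I" "\<And>i. i \<in> I \<Longrightarrow> a i \<le> b i" "\<And>i. i \<in> I \<Longrightarrow> a i \<in> S" "\<And>i. i \<in> I \<Longrightarrow> b i \<in> S"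
    and "\<And>i j. i \<in> I \<Longrightarrow> j \<in> I \<Longrightarrow> i \<noteq> j \<Longrightarrow> {a i<..<b i} \<inter> {a j<..<b j} = {}"
    and "(\<Sum>i\<in>I. b i - a i) < \<delta>"
  shows "fine_family S \<delta> I a b"
  unfolding fine_family_def pairwise_def using assms(1-4,6) by (intro conjI ballI impI assms(5)) simp_all

lemma fine_familyD:
  assumes "fine_family S \<delta> I a b"
  shows "finite I" "\<And>i. i \<in> I \<Longrightarrow> a i \<le> b i" "\<And>i. i \<in> I \<Longrightarrow> a i \<in> S" "\<And>i. i \<in> I \<Longrightarrow> b i \<in> S"
    and "\<And>i j. i \<in> I \<Longrightarrow> j \<in> I \<Longrightarrow> i \<noteq> j \<Longrightarrow> {a i<..<b i} \<inter> {a j<..<b j} = {}"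
    and "(\<Sum>i\<in>I. b i - a i) < \<delta>"
  using assms unfolding fine_family_def by (simp_all add: pairwise_def)

lemma fine_family_mono: "fine_family S \<delta> I a b \<Longrightarrow> \<delta> \<le> \<delta>' \<Longrightarrow> fine_family S \<delta>' I a b"
  unfolding fine_family_def by linarith

lemma abs_cont_on_fine_family:
  "abs_cont_on S f \<longleftrightarrow> (\<forall>\<epsilon>>0. \<exists>\<delta>>0. \<forall>(I::nat set) a b. fine_family S \<delta> I a b
      \<longrightarrow> (\<Sum>i\<in>I. norm (f (b i) - f (a i))) < \<epsilon>)"
  unfolding abs_cont_on_def fine_family_def ..

lemma abs_cont_onI:
  assumes "\<And>\<epsilon>. \<epsilon> > 0 \<Longrightarrow> \<exists>\<delta>>0. \<forall>(I::nat set) a b. fine_family S \<delta> I a b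
      \<longrightarrow> (\<Sum>i\<in>I. norm (f (b i) - f (a i))) < \<epsilon>"
  shows "abs_cont_on S f"
  using assms unfolding abs_cont_on_fine_family by simp

text \<open>The definition quantifies over families indexed by natural numbers. Enumerating a finite
  index set frees the index type, which is later \<open>unit\<close>, \<open>int\<close> or a
  product.\<close>

lemma abs_cont_onE:
  fixes f :: "real \<Rightarrow> 'b::real_normed_vector"
  assumes "abs_cont_on S f" "\<epsilon> > 0"
  obtains \<delta> where "\<delta> > 0" "\<And>(I::'i set) a b. fine_family S \<delta> I a b \<Longrightarrow> (\<Sum>i\<in>I. norm (f (b i) - f (a i))) < \<epsilon>"
proof -
  obtain \<delta> where "\<delta> > 0" and \<delta>: "\<forall>(I::nat set) a b. fine_family S \<delta> I a b \<longrightarrow> (\<Sum>i\<in>I. norm (f (b i) - f (a i))) < \<epsilon>"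
    using assms(1)[unfolded abs_cont_on_fine_family, rule_format, OF assms(2)] by (elim exE conjE)
  have *: "(\<Sum>i\<in>I. norm (f (b i) - f (a i))) < \<epsilon>" if fine: "fine_family S \<delta> I a b" for I :: "'i set" and a b
  proof -
    note I = fine_familyD[OF fine]
    obtain h where h: "bij_betw h {0..<card I} I"
      using ex_bij_betw_nat_finite[OF I(1)] by blast
    have mem: "h i \<in> I" if "i \<in> {0..<card I}" for i by (rule bij_betw_apply[OF h that])
    have "fine_family S \<delta> {0..<card I} (\<lambda>i. a (h i)) (\<lambda>i. b (h i))"
    proof (rule fine_familyI)
      fix i j assume ij: "i \<in> {0..<card I}" "j \<in> {0..<card I}" "i \<noteq> j"
      then have "h i \<noteq> h j"
        using inj_on_eq_iff[OF bij_betw_imp_inj_on[OF h]] by simp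
      then show "{a (h i)<..<b (h i)} \<inter> {a (h j)<..<b (h j)} = {}"
        by (rule I(5)[OF mem[OF ij(1)] mem[OF ij(2)]])
    next
      show "(\<Sum>i = 0..<card I. b (h i) - a (h i)) < \<delta>"
        using I(6) sum.reindex_bij_betw[OF h, of "\<lambda>i. b i - a i"] by simp
    qed (simp_all add: mem I)
    then show ?thesis
      using \<delta> sum.reindex_bij_betw[OF h, of "\<lambda>i. norm (f (b i) - f (a i))"] by fastforce
  qed
  show ?thesis by (rule that[OF \<open>\<delta> > 0\<close>]) (rule *)
qed

lemma abs_cont_on_imp_continuous_on:
  fixes f :: "real \<Rightarrow> 'b::real_normed_vector"
  assumes "abs_cont_on S f"
  shows "continuous_on S f"
  unfolding continuous_on_iff
proof (intro ballI allI impI)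
  fix x and e :: real assume "x \<in> S" "e > 0"
  obtain \<delta> where "\<delta> > 0" and \<delta>: "\<And>(I::unit set) a b. fine_family S \<delta> I a b \<Longrightarrow> (\<Sum>i\<in>I. norm (f (b i) - f (a i))) < e"
    by (rule abs_cont_onE[OF assms \<open>e > 0\<close>]) (rule that)
  have "dist (f y) (f x) < e" if "y \<in> S" "dist y x < \<delta>" for y
  proof -
    have "fine_family S \<delta> (UNIV :: unit set) (\<lambda>_. min x y) (\<lambda>_. max x y)"
      using \<open>x \<in> S\<close> that by (intro fine_familyI) (auto simp: UNIV_unit dist_real_def min_def max_def)
    from \<delta>[OF this] show ?thesis
      by (auto simp: UNIV_unit dist_norm min_def max_def norm_minus_commute split: if_splits)
  qed
  then show "\<exists>d>0. \<forall>x'\<in>S. dist x' x < d \<longrightarrow> dist (f x') (f x) < e"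
    using \<open>\<delta> > 0\<close> by blast
qed

text \<open>Reparametrising by a monotone 1-Lipschitz map keeps the intervals disjoint and does not
  lengthen them.\<close>
lemma abs_cont_on_transfer:
  fixes f :: "real \<Rightarrow> 'b::real_normed_vector" and g :: "real \<Rightarrow> 'c::real_normed_vector"
  assumes f: "abs_cont_on S f" and r: "mono r" "\<And>x y. x \<le> y \<Longrightarrow> r y - r x \<le> y - x" "r ` R \<subseteq> S"
    and g: "\<And>x y. x \<in> R \<Longrightarrow> y \<in> R \<Longrightarrow> norm (g x - g y) \<le> norm (f (r x) - f (r y))"
  shows "abs_cont_on R g"
proof (rule abs_cont_onI)
  fix \<epsilon> :: real assume "\<epsilon> > 0"
  obtain \<delta> where "\<delta> > 0" and \<delta>: "\<And>(I::nat set) a b. fine_family S \<delta> I a b \<Longrightarrow> (\<Sum>i\<in>I. norm (f (b i) - f (a i))) < \<epsilon>"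
    by (rule abs_cont_onE[OF f \<open>\<epsilon> > 0\<close>]) (rule that)
  have "(\<Sum>i\<in>I. norm (g (b i) - g (a i))) < \<epsilon>" if fine: "fine_family R \<delta> I a b" for I :: "nat set" and a b
  proof -
    note I = fine_familyD[OF fine]
    have "fine_family S \<delta> I (\<lambda>i. r (a i)) (\<lambda>i. r (b i))"
    proof (rule fine_familyI)
      fix i j assume ij: "i \<in> I" "j \<in> I" "i \<noteq> j"
      note e = I(5)[OF ij] I(2)[OF ij(1)] I(2)[OF ij(2)]
      \<comment> \<open>Disjoint open intervals are ordered unless one of them is empty; an empty
        one has equal endpoints, and so has its image under r.\<close>
      have "b i \<le> a j \<or> b j \<le> a i \<or> a i = b i \<or> a j = b j"
      proof (rule ccontr)
        assume "\<not> ?thesis"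
        then have "max (a i) (a j) < min (b i) (b j)" using e by auto
        then obtain z where "max (a i) (a j) < z" "z < min (b i) (b j)" using dense by blast
        then have "z \<in> {a i<..<b i} \<inter> {a j<..<b j}" by auto
        then show False using e by auto
      qed
      then show "{r (a i)<..<r (b i)} \<inter> {r (a j)<..<r (b j)} = {}"
        using monoD[OF r(1), of "b i" "a j"] monoD[OF r(1), of "b j" "a i"] by auto
    next
      have "(\<Sum>i\<in>I. r (b i) - r (a i)) \<le> (\<Sum>i\<in>I. b i - a i)" using I r(2) by (intro sum_mono) auto
      then show "(\<Sum>i\<in>I. r (b i) - r (a i)) < \<delta>" using I(6) by linarith
    qed (use I r in \<open>auto simp: mono_def\<close>)
    moreover have "(\<Sum>i\<in>I. norm (g (b i) - g (a i))) \<le> (\<Sum>i\<in>I. norm (f (r (b i)) - f (r (a i))))"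
      using I g by (intro sum_mono) auto
    ultimately show ?thesis using \<delta>[of I "\<lambda>i. r (a i)" "\<lambda>i. r (b i)"] by linarith
  qed
  then show "\<exists>\<delta>>0. \<forall>(I::nat set) a b. fine_family R \<delta> I a b \<longrightarrow> (\<Sum>i\<in>I. norm (g (b i) - g (a i))) < \<epsilon>"
    using \<open>\<delta> > 0\<close> by blast
qed

lemma abs_cont_on_norm_le:
  fixes f :: "real \<Rightarrow> 'b::real_normed_vector" and g :: "real \<Rightarrow> 'c::real_normed_vector"
  assumes "abs_cont_on S f" "\<And>x y. x \<in> S \<Longrightarrow> y \<in> S \<Longrightarrow> norm (g x - g y) \<le> norm (f x - f y)"
  shows "abs_cont_on S g"
  by (rule abs_cont_on_transfer[OF assms(1), where r = "\<lambda>x. x"]) (use assms(2) in \<open>auto simp: mono_def\<close>)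

lemma abs_cont_on_compose_mono:
  fixes f :: "real \<Rightarrow> 'b::real_normed_vector"
  assumes "abs_cont_on S f" "mono r" "\<And>x y. x \<le> y \<Longrightarrow> r y - r x \<le> y - x" "r ` R \<subseteq> S"
  shows "abs_cont_on R (\<lambda>x. f (r x))"
  by (rule abs_cont_on_transfer[OF assms]) simp_all

lemma abs_cont_on_add:
  fixes f g :: "real \<Rightarrow> 'b::real_normed_vector"
  assumes "abs_cont_on S f" "abs_cont_on S g"
  shows "abs_cont_on S (\<lambda>x. f x + g x)"
proof (rule abs_cont_onI)
  fix \<epsilon> :: real assume "\<epsilon> > 0"
  then have "\<epsilon> / 2 > 0" by simp
  obtain \<delta> where "\<delta> > 0" and \<delta>: "\<And>(I::nat set) a b. fine_family S \<delta> I a b \<Longrightarrow> (\<Sum>i\<in>I. norm (f (b i) - f (a i))) < \<epsilon> / 2"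
    by (rule abs_cont_onE[OF assms(1) \<open>\<epsilon> / 2 > 0\<close>]) (rule that)
  obtain \<delta>' where "\<delta>' > 0" and \<delta>': "\<And>(I::nat set) a b. fine_family S \<delta>' I a b \<Longrightarrow> (\<Sum>i\<in>I. norm (g (b i) - g (a i))) < \<epsilon> / 2"
    by (rule abs_cont_onE[OF assms(2) \<open>\<epsilon> / 2 > 0\<close>]) (rule that)
  have "(\<Sum>i\<in>I. norm (f (b i) + g (b i) - (f (a i) + g (a i)))) < \<epsilon>"
    if fine: "fine_family S (min \<delta> \<delta>') I a b" for I :: "nat set" and a b
  proof -
    have "(\<Sum>i\<in>I. norm (f (b i) + g (b i) - (f (a i) + g (a i))))
        \<le> (\<Sum>i\<in>I. norm (f (b i) - f (a i)) + norm (g (b i) - g (a i)))"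
      by (intro sum_mono) (metis add_diff_add norm_triangle_ineq)
    also have "\<dots> < \<epsilon>"
      using \<delta>[OF fine_family_mono[OF fine]] \<delta>'[OF fine_family_mono[OF fine]] by (simp add: sum.distrib)
    finally show ?thesis .
  qed
  then show "\<exists>\<delta>>0. \<forall>(I::nat set) a b. fine_family S \<delta> I a b \<longrightarrow>
      (\<Sum>i\<in>I. norm (f (b i) + g (b i) - (f (a i) + g (a i)))) < \<epsilon>"
    using \<open>\<delta> > 0\<close> \<open>\<delta>' > 0\<close> by (intro exI[of _ "min \<delta> \<delta>'"]) auto
qed

lemma abs_cont_on_lipschitz:
  fixes f :: "real \<Rightarrow> 'b::real_normed_vector"
  assumes "\<And>x y. x \<in> S \<Longrightarrow> y \<in> S \<Longrightarrow> norm (f x - f y) \<le> C * \<bar>x - y\<bar>"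
  shows "abs_cont_on S f"
proof (rule abs_cont_onI)
  fix \<epsilon> :: real assume "\<epsilon> > 0"
  define B where "B = \<bar>C\<bar> + 1"
  have "B > 0" by (simp add: B_def)
  have "(\<Sum>i\<in>I. norm (f (b i) - f (a i))) < \<epsilon>" if fine: "fine_family S (\<epsilon> / B) I a b" for I :: "nat set" and a b
  proof -
    note I = fine_familyD[OF fine]
    have "(\<Sum>i\<in>I. norm (f (b i) - f (a i))) \<le> (\<Sum>i\<in>I. B * (b i - a i))"
    proof (intro sum_mono)
      fix i assume i: "i \<in> I"
      have "norm (f (b i) - f (a i)) \<le> C * \<bar>b i - a i\<bar>" using I i assms by blast
      also have "\<dots> \<le> B * \<bar>b i - a i\<bar>" by (intro mult_right_mono) (auto simp: B_def)
      also have "\<dots> = B * (b i - a i)" using I(2)[OF i] by auto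
      finally show "norm (f (b i) - f (a i)) \<le> B * (b i - a i)" .
    qed
    also have "\<dots> = B * (\<Sum>i\<in>I. b i - a i)" by (simp add: sum_distrib_left)
    also have "\<dots> < \<epsilon>" using I(6) \<open>B > 0\<close> by (simp add: field_simps)
    finally show ?thesis .
  qed
  then show "\<exists>\<delta>>0. \<forall>(I::nat set) a b. fine_family S \<delta> I a b \<longrightarrow> (\<Sum>i\<in>I. norm (f (b i) - f (a i))) < \<epsilon>"
    using \<open>\<epsilon> > 0\<close> \<open>B > 0\<close> by (intro exI[of _ "\<epsilon> / B"]) auto
qed

text \<open>Up to the constant \<open>f \<tau>\<close>, the glued curve is the sum of f stopped at
  \<tau> and g started at \<tau>, both of which are reparametrisations by clamps.\<close>

lemma abs_cont_on_join:
  fixes f g :: "real \<Rightarrow> 'b::real_normed_vector"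
  assumes "abs_cont_on {a..b} f" "abs_cont_on {a..b} g" "\<tau> \<in> {a..b}" "f \<tau> = g \<tau>"
  shows "abs_cont_on {a..b} (\<lambda>s. if s \<le> \<tau> then f s else g s)"
proof -
  have "abs_cont_on {a..b} (\<lambda>s. f (min s \<tau>))"
    by (rule abs_cont_on_compose_mono[OF assms(1), where r = "\<lambda>s. min s \<tau>"]) (use assms(3) in \<open>auto simp: mono_def min_def\<close>)
  moreover have "abs_cont_on {a..b} (\<lambda>s. g (max s \<tau>))"
    by (rule abs_cont_on_compose_mono[OF assms(2), where r = "\<lambda>s. max s \<tau>"]) (use assms(3) in \<open>auto simp: mono_def max_def\<close>)
  ultimately have "abs_cont_on {a..b} (\<lambda>s. f (min s \<tau>) + g (max s \<tau>))"
    by (rule abs_cont_on_add)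
  then show ?thesis
    by (rule abs_cont_on_norm_le) (auto simp: min_def max_def assms(4))
qed

section \<open>Total variation of a curve\<close>

definition variation_sums :: "(real \<Rightarrow> 'b::real_normed_vector) \<Rightarrow> real \<Rightarrow> real \<Rightarrow> real set" where
  "variation_sums f a b =
     {(\<Sum>i<n. norm (f (p (Suc i)) - f (p i))) | p (n::nat). mono p \<and> p 0 = a \<and> p n = b}"

definition variation :: "(real \<Rightarrow> 'b::real_normed_vector) \<Rightarrow> real \<Rightarrow> real \<Rightarrow> real" where
  "variation f a b = Sup (variation_sums f a b)"

lemma variation_sumsI:
  "mono p \<Longrightarrow> p 0 = a \<Longrightarrow> p n = b \<Longrightarrow> (\<Sum>i<n. norm (f (p (Suc i)) - f (p i))) \<in> variation_sums f a b"
  unfolding variation_sums_def by blast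

lemma variation_sums_norm_diff:
  assumes "a \<le> b"
  shows "norm (f b - f a) \<in> variation_sums f a b"
  using variation_sumsI[of "\<lambda>i. if i = 0 then a else b" a 1 b f] assms
  by (auto simp: mono_def)

lemma variation_sums_concat:
  assumes "s \<in> variation_sums f a c" "s' \<in> variation_sums f c b"
  shows "s + s' \<in> variation_sums f a b"
proof -
  obtain p n where p: "mono p" "p 0 = a" "p n = c" "s = (\<Sum>i<n. norm (f (p (Suc i)) - f (p i)))"
    using assms(1) unfolding variation_sums_def by blast
  obtain q k where q: "mono q" "q 0 = c" "q k = b" "s' = (\<Sum>i<k. norm (f (q (Suc i)) - f (q i)))"
    using assms(2) unfolding variation_sums_def by blast
  define r where "r i = (if i \<le> n then p i else q (i - n))" for i
  have pc: "p i \<le> c" if "i \<le> n" for i using monoD[OF p(1) that] p(3) by simp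
  have qc: "c \<le> q i" for i using monoD[OF q(1), of 0 i] q(2) by simp
  have "mono r"
    unfolding mono_def r_def
    using monoD[OF p(1)] monoD[OF q(1)] order_trans[OF pc qc] by auto
  moreover have "r 0 = a" "r (n + k) = b"
    using p q by (auto simp: r_def)
  moreover have "(\<Sum>i<n+k. norm (f (r (Suc i)) - f (r i))) = s + s'"
  proof -
    have "(\<Sum>i<n. norm (f (r (Suc i)) - f (r i))) = s"
      unfolding p(4) by (rule sum.cong) (auto simp: r_def)
    moreover have rq: "r (n + i) = q i" for i using p(3) q(2) by (auto simp: r_def)
    have "(\<Sum>i<k. norm (f (r (Suc (n + i))) - f (r (n + i)))) = s'"
      unfolding q(4) using rq[of "Suc _"] rq by (intro sum.cong) auto
    moreover have "(\<Sum>i<n+k. norm (f (r (Suc i)) - f (r i))) =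
       (\<Sum>i<n. norm (f (r (Suc i)) - f (r i))) + (\<Sum>i<k. norm (f (r (Suc (n + i))) - f (r (n + i))))"
      by (induction k) (simp_all add: add.assoc)
    ultimately show ?thesis by simp
  qed
  ultimately show ?thesis
    using variation_sumsI[of r a "n + k" b f] by simp
qed

text \<open>Partitions are monotone sequences that may repeat points, so the cut at c needs no
  insertion of c: truncating with min and max splits every increment into its parts left and right
  of c, one of which is zero unless the cell contains c.\<close>

lemma variation_sums_split:
  assumes "s \<in> variation_sums f a b" "a \<le> c" "c \<le> b"
  obtains s1 s2 where "s1 \<in> variation_sums f a c" "s2 \<in> variation_sums f c b" "s \<le> s1 + s2"
proof -
  obtain p n where p: "mono p" "p 0 = a" "p n = b" "s = (\<Sum>i<n. norm (f (p (Suc i)) - f (p i)))"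
    using assms(1) unfolding variation_sums_def by blast
  let ?q = "\<lambda>i. min (p i) c" and ?r = "\<lambda>i. max (p i) c"
  have le: "p i \<le> p (Suc i)" for i using p(1) by (simp add: mono_def)
  have "mono ?q" "mono ?r"
    using monoD[OF p(1)] by (auto intro!: monoI min.mono max.mono)
  then have "(\<Sum>i<n. norm (f (?q (Suc i)) - f (?q i))) \<in> variation_sums f a c"
    "(\<Sum>i<n. norm (f (?r (Suc i)) - f (?r i))) \<in> variation_sums f c b"
    using p assms by (auto intro!: variation_sumsI)
  moreover have "s \<le> (\<Sum>i<n. norm (f (?q (Suc i)) - f (?q i))) + (\<Sum>i<n. norm (f (?r (Suc i)) - f (?r i)))"
    unfolding p(4) sum.distrib[symmetric]
  proof (rule sum_mono)
    fix i
    have "f (p (Suc i)) - f (p i) = (f (?q (Suc i)) - f (?q i)) + (f (?r (Suc i)) - f (?r i))"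
      using le[of i] by (auto simp: min_def max_def)
    then show "norm (f (p (Suc i)) - f (p i)) \<le> norm (f (?q (Suc i)) - f (?q i)) + norm (f (?r (Suc i)) - f (?r i))"
      by (metis norm_triangle_ineq)
  qed
  ultimately show ?thesis using that by blast
qed

text \<open>On an interval shorter than the \<delta> belonging to \<epsilon> = 1 every sum is at
  most 1. Splitting off pieces of length \<delta>/2 one at a time bounds any sum by the number of
  pieces plus one.\<close>

lemma variation_sums_bdd_above:
  fixes f :: "real \<Rightarrow> 'b::real_normed_vector"
  assumes "abs_cont_on UNIV f"
  shows "bdd_above (variation_sums f a b)"
proof -
  obtain \<delta> where "\<delta> > 0" and \<delta>: "\<And>(I::nat set) a b. fine_family UNIV \<delta> I a b \<Longrightarrow>
      (\<Sum>i\<in>I. norm (f (b i) - f (a i))) < 1"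
    by (rule abs_cont_onE[OF assms zero_less_one]) (rule that)
  have short: "s \<le> 1" if s: "s \<in> variation_sums f a b" and ab: "b < a + \<delta>" for s a b
  proof -
    obtain p n where p: "mono p" "p 0 = a" "p n = b" "s = (\<Sum>i<n. norm (f (p (Suc i)) - f (p i)))"
      using s unfolding variation_sums_def by blast
    have "fine_family UNIV \<delta> {..<n} p (\<lambda>i. p (Suc i))"
    proof (rule fine_familyI)
      fix i j :: nat assume "i \<noteq> j"
      then have "Suc i \<le> j \<or> Suc j \<le> i" by auto
      then show "{p i<..<p (Suc i)} \<inter> {p j<..<p (Suc j)} = {}"
        using monoD[OF p(1), of "Suc i" j] monoD[OF p(1), of "Suc j" i] by auto
    qed (use p ab in \<open>auto simp: mono_def sum_lessThan_telescope\<close>)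
    from \<delta>[OF this]
    show ?thesis using p by simp
  qed
  have "s \<le> real (Suc k)" if "s \<in> variation_sums f a b" "b \<le> a + real k * (\<delta> / 2)" for s a b and k :: nat
    using that
  proof (induction k arbitrary: s b)
    case 0
    then show ?case using short[OF 0(1)] \<open>\<delta> > 0\<close> by simp
  next
    case (Suc k)
    show ?case
    proof (cases "b \<le> a + k * (\<delta> / 2)")
      case True
      then show ?thesis using Suc.IH[OF Suc.prems(1)] by simp
    next
      case False
      let ?c = "a + k * (\<delta> / 2)"
      have "a \<le> ?c" using \<open>\<delta> > 0\<close> by simp
      moreover have "?c \<le> b" using False by simp
      ultimately obtain s1 s2 :: real where "s1 \<in> variation_sums f a ?c" "s2 \<in> variation_sums f ?c b" "s \<le> s1 + s2"
        by (rule variation_sums_split[OF Suc.prems(1)])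
      moreover have "s2 \<le> 1"
        using calculation(2) Suc.prems(2) \<open>\<delta> > 0\<close> by (intro short) (auto simp: algebra_simps add_divide_distrib)
      ultimately show ?thesis using Suc.IH[of s1 ?c] by simp
    qed
  qed
  moreover obtain k :: nat where "(b - a) / (\<delta> / 2) \<le> k" using real_arch_simple by blast
  then have "b \<le> a + k * (\<delta> / 2)" using \<open>\<delta> > 0\<close> by (simp add: field_simps)
  ultimately show ?thesis by (intro bdd_aboveI) blast
qed

lemma variation_additive:
  fixes f :: "real \<Rightarrow> 'b::real_normed_vector"
  assumes "abs_cont_on UNIV f" "a \<le> c" "c \<le> b"
  shows "variation f a b = variation f a c + variation f c b"
proof (rule antisym)
  note bdd = variation_sums_bdd_above[OF assms(1)]
  have ne: "variation_sums f x y \<noteq> {}" if "x \<le> y" for x y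
    using variation_sums_norm_diff[OF that] by blast
  show "variation f a b \<le> variation f a c + variation f c b"
    unfolding variation_def
  proof (rule cSup_least)
    fix s assume "s \<in> variation_sums f a b"
    then obtain s1 s2 where "s1 \<in> variation_sums f a c" "s2 \<in> variation_sums f c b" "s \<le> s1 + s2"
      using variation_sums_split assms by blast
    then show "s \<le> Sup (variation_sums f a c) + Sup (variation_sums f c b)"
      using cSup_upper[OF _ bdd] by (meson add_mono order_trans)
  qed (use ne assms in auto)
  have "variation f a c \<le> variation f a b - s" if s: "s \<in> variation_sums f c b" for s
    unfolding variation_def
  proof (rule cSup_least)
    fix s' assume "s' \<in> variation_sums f a c"
    then have "s' + s \<le> Sup (variation_sums f a b)"
      using s by (intro cSup_upper bdd variation_sums_concat)
    then show "s' \<le> Sup (variation_sums f a b) - s" by simp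
  qed (use ne assms in auto)
  then have "variation f c b \<le> variation f a b - variation f a c"
    unfolding variation_def[of f c b]
    by (intro cSup_least) (use ne assms in \<open>auto simp: algebra_simps\<close>)
  then show "variation f a c + variation f c b \<le> variation f a b" by simp
qed

lemma norm_diff_le_variation:
  fixes f :: "real \<Rightarrow> 'b::real_normed_vector"
  assumes "abs_cont_on UNIV f" "a \<le> b"
  shows "norm (f b - f a) \<le> variation f a b"
  unfolding variation_def
  by (intro cSup_upper variation_sums_norm_diff variation_sums_bdd_above assms)

text \<open>The variation over each interval is almost attained by some partition. The cells of all
  these partitions form another fine family of the same total length, so the \<delta> of f also
  serves its variation.\<close>

lemma variation_abs_cont:
  fixes f :: "real \<Rightarrow> 'b::real_normed_vector"
  assumes "abs_cont_on UNIV f" "\<epsilon> > 0"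
  obtains \<delta> where "\<delta> > 0"
    "\<And>(I::'i set) a b. fine_family UNIV \<delta> I a b \<Longrightarrow> (\<Sum>i\<in>I. variation f (a i) (b i)) \<le> \<epsilon>"
proof -
  obtain \<delta> where "\<delta> > 0" and \<delta>: "\<And>(I::('i \<times> nat) set) a b. fine_family UNIV \<delta> I a b \<Longrightarrow>
      (\<Sum>i\<in>I. norm (f (b i) - f (a i))) < \<epsilon>"
    by (rule abs_cont_onE[OF assms]) (rule that)
  have "(\<Sum>i\<in>I. variation f (a i) (b i)) \<le> \<epsilon>" if fine: "fine_family UNIV \<delta> I a b" for I :: "'i set" and a b
  proof (rule field_le_epsilon)
    note I = fine_familyD[OF fine]
    fix e :: real assume "e > 0"
    \<comment> \<open>The slack allowed per interval, adding up to at most e; the summand 1 covers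
      the empty family.\<close>
    define e' where "e' = e / (card I + 1)"
    have "e' > 0" using \<open>e > 0\<close> by (simp add: e'_def)
    have "\<forall>i\<in>I. \<exists>q. mono (fst q) \<and> fst q 0 = a i \<and> fst q (snd q) = b i \<and>
        variation f (a i) (b i) - e' < (\<Sum>j<snd q. norm (f (fst q (Suc j)) - f (fst q j)))"
    proof
      fix i assume i: "i \<in> I"
      have "variation_sums f (a i) (b i) \<noteq> {}"
        using variation_sums_norm_diff[of "a i" "b i" f] I(2) i by auto
      then obtain s where "s \<in> variation_sums f (a i) (b i)" "variation f (a i) (b i) - e' < s"
        using \<open>e' > 0\<close> less_cSupD[of "variation_sums f (a i) (b i)" "variation f (a i) (b i) - e'"]
        unfolding variation_def by auto
      then obtain p n where "mono p" "p 0 = a i" "p n = b i"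
          "variation f (a i) (b i) - e' < (\<Sum>j<n. norm (f (p (Suc j)) - f (p j)))"
        unfolding variation_sums_def by blast
      then show "\<exists>q. mono (fst q) \<and> fst q 0 = a i \<and> fst q (snd q) = b i \<and>
          variation f (a i) (b i) - e' < (\<Sum>j<snd q. norm (f (fst q (Suc j)) - f (fst q j)))"
        by (intro exI[of _ "(p, n)"]) simp
    qed
    from bchoice[OF this] obtain q where q: "\<forall>i\<in>I. mono (fst (q i)) \<and> fst (q i) 0 = a i \<and> fst (q i) (snd (q i)) = b i \<and>
        variation f (a i) (b i) - e' < (\<Sum>j<snd (q i). norm (f (fst (q i) (Suc j)) - f (fst (q i) j)))" ..
    define p where "p i = fst (q i)" for i
    define n where "n i = snd (q i)" for i
    have pn: "mono (p i) \<and> p i 0 = a i \<and> p i (n i) = b i \<and>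
        variation f (a i) (b i) - e' < (\<Sum>j<n i. norm (f (p i (Suc j)) - f (p i j)))" if "i \<in> I" for i
      using q that unfolding p_def n_def by blast
    \<comment> \<open>All partition cells at once, indexed by the interval and the position in its
      partition.\<close>
    define J where "J = Sigma I (\<lambda>i. {..<n i})"
    have "fine_family UNIV \<delta> J (\<lambda>ij. p (fst ij) (snd ij)) (\<lambda>ij. p (fst ij) (Suc (snd ij)))"
    proof (rule fine_familyI)
      show "finite J" using I(1) by (auto simp: J_def)
      show "p (fst i) (snd i) \<le> p (fst i) (Suc (snd i))" if "i \<in> J" for i
        using pn that by (auto simp: J_def mono_def)
      have "(\<Sum>ij\<in>J. p (fst ij) (Suc (snd ij)) - p (fst ij) (snd ij)) =
          (\<Sum>i\<in>I. \<Sum>j<n i. p i (Suc j) - p i j)"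
        unfolding J_def using I(1) by (subst sum.Sigma) (auto simp: case_prod_beta)
      also have "\<dots> = (\<Sum>i\<in>I. b i - a i)"
        using pn by (intro sum.cong) (auto simp: sum_lessThan_telescope)
      finally show "(\<Sum>ij\<in>J. p (fst ij) (Suc (snd ij)) - p (fst ij) (snd ij)) < \<delta>" using I(6) by simp
      show "{p (fst x) (snd x)<..<p (fst x) (Suc (snd x))} \<inter> {p (fst y) (snd y)<..<p (fst y) (Suc (snd y))} = {}"
        if xy: "x \<in> J" "y \<in> J" "x \<noteq> y" for x y
      proof -
        obtain i j i' j' where eq: "x = (i, j)" "y = (i', j')" by fastforce
        have mem: "i \<in> I" "i' \<in> I" "j < n i" "j' < n i'" using xy eq by (auto simp: J_def)
        show ?thesis
        proof (cases "i = i'")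
          case True
          then have "Suc j \<le> j' \<or> Suc j' \<le> j" using xy eq by auto
          then have "p i (Suc j) \<le> p i j' \<or> p i (Suc j') \<le> p i j"
            using pn[OF mem(1)] by (auto simp: mono_def)
          then show ?thesis using eq True by auto
        next
          case False
          have "{a i<..<b i} \<inter> {a i'<..<b i'} = {}"
            by (rule I(5)[OF mem(1,2) False])
          moreover have "{p k l<..<p k (Suc l)} \<subseteq> {a k<..<b k}" if "k \<in> I" "l < n k" for k l
          proof -
            have "mono (p k)" using pn[OF that(1)] by blast
            then have "p k 0 \<le> p k l" "p k (Suc l) \<le> p k (n k)"
              by (rule monoD, use that in simp)+
            then show ?thesis using pn[OF that(1)] by auto
          qed
          ultimately show ?thesis
            unfolding eq fst_conv snd_conv using mem by blast
        qed
      qed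
    qed simp_all
    note \<delta>[OF this]
    moreover have "(\<Sum>ij\<in>J. norm (f (p (fst ij) (Suc (snd ij))) - f (p (fst ij) (snd ij)))) =
        (\<Sum>i\<in>I. \<Sum>j<n i. norm (f (p i (Suc j)) - f (p i j)))"
      unfolding J_def using I(1) by (subst sum.Sigma) (auto simp: case_prod_beta)
    moreover have "(\<Sum>i\<in>I. variation f (a i) (b i) - e') \<le> (\<Sum>i\<in>I. \<Sum>j<n i. norm (f (p i (Suc j)) - f (p i j)))"
      using pn by (intro sum_mono) (auto intro: less_imp_le)
    moreover have "real (card I) * e' \<le> e"
      using \<open>e > 0\<close> by (simp add: e'_def field_simps)
    ultimately show "(\<Sum>i\<in>I. variation f (a i) (b i)) \<le> \<epsilon> + e"
      by (simp add: sum_subtractf)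
  qed
  then show ?thesis by (rule that[OF \<open>\<delta> > 0\<close>])
qed

text \<open>A compact null set lies in an open set of Lebesgue measure below \<delta>. Cells of a
  fine enough grid that meet it stay inside the open set, so their total length is below \<delta>,
  and the increments of h over them, which are their Stieltjes measures, add up to less than
  \<epsilon>. Compactness supplies both the mesh and the finiteness of the family.\<close>

lemma emeasure_interval_measure_compact_le:
  fixes h :: "real \<Rightarrow> real"
  assumes h: "mono h" "abs_cont_on UNIV h" and K: "compact K" "emeasure lborel K = 0" and "\<epsilon> > 0"
  shows "emeasure (interval_measure h) K \<le> ennreal \<epsilon>"
proof -
  have cont: "continuous_on UNIV h" by (rule abs_cont_on_imp_continuous_on[OF h(2)])
  obtain \<delta> where "\<delta> > 0" and \<delta>: "\<And>(I::int set) a b. fine_family UNIV \<delta> I a b \<Longrightarrow>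
      (\<Sum>i\<in>I. norm (h (b i) - h (a i))) < \<epsilon>"
    by (rule abs_cont_onE[OF h(2) \<open>\<epsilon> > 0\<close>]) (rule that)
  have Kb: "K \<in> sets borel" using K(1) by (simp add: borel_compact)
  obtain V where V: "open V" "K \<subseteq> V" "emeasure lebesgue (V - K) < ennreal \<delta>"
  proof (rule sets_lebesgue_outer_open[of K \<delta>])
    show "K \<in> sets lebesgue" using Kb by simp
  qed (use \<open>\<delta> > 0\<close> in auto)
  have V\<delta>: "emeasure lborel V < ennreal \<delta>"
  proof -
    have "emeasure lborel V = emeasure lborel (V - K)"
      using emeasure_Diff_null_set[of K lborel V] K(2) Kb V(1) by (auto simp: null_sets_def)
    then show ?thesis using V(1,3) Kb by simp
  qed
  obtain e where "e > 0" and e: "(\<Union>x\<in>K. ball x e) \<subseteq> V"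
    using compact_subset_open_imp_ball_epsilon_subset[OF K(1) V(1,2)] by blast
  \<comment> \<open>Cells of this length that meet K lie in the e-neighbourhood of K, hence in V.
    They are half-open so that they tile the line and have the increment of h as their
    measure.\<close>
  define r where "r = e / 2"
  have "r > 0" "r < e" using \<open>e > 0\<close> by (auto simp: r_def)
  define C where "C j = {real_of_int j * r <.. (real_of_int j + 1) * r}" for j :: int
  have CS: "C j \<in> sets borel" for j by (simp add: C_def)
  define J where "J = {j. C j \<inter> K \<noteq> {}}"
  obtain B where B: "\<And>x. x \<in> K \<Longrightarrow> \<bar>x\<bar> \<le> B"
    using compact_imp_bounded[OF K(1)] unfolding bounded_iff by auto
  have "J \<subseteq> {\<lfloor>- B / r\<rfloor> - 1 .. \<lceil>B / r\<rceil>}"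
  proof
    fix j assume "j \<in> J"
    then obtain y where y: "y \<in> K" "real_of_int j * r < y" "y \<le> (real_of_int j + 1) * r"
      by (auto simp: J_def C_def)
    then have "real_of_int j * r < B" "- B \<le> (real_of_int j + 1) * r" using B[OF y(1)] by auto
    then have "real_of_int j < B / r" "- B / r \<le> real_of_int j + 1"
      using \<open>r > 0\<close> by (auto simp: field_simps)
    then show "j \<in> {\<lfloor>- B / r\<rfloor> - 1 .. \<lceil>B / r\<rceil>}" by (auto; linarith)
  qed
  then have "finite J" by (rule finite_subset) simp
  have KJ: "K \<subseteq> (\<Union>j\<in>J. C j)"
  proof
    fix y assume "y \<in> K"
    let ?j = "\<lceil>y / r\<rceil> - 1"
    have "real_of_int ?j < y / r" "y / r \<le> real_of_int ?j + 1" by linarith+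
    then have "real_of_int ?j * r < y" "y \<le> (real_of_int ?j + 1) * r"
      using \<open>r > 0\<close> by (simp_all only: pos_less_divide_eq pos_divide_le_eq)
    then have "y \<in> C ?j" unfolding C_def by simp
    then show "y \<in> (\<Union>j\<in>J. C j)" using \<open>y \<in> K\<close> by (auto simp: J_def)
  qed
  have JV: "(\<Union>j\<in>J. C j) \<subseteq> V"
  proof
    fix z assume "z \<in> (\<Union>j\<in>J. C j)"
    then obtain j y where j: "z \<in> C j" "y \<in> C j" "y \<in> K" by (auto simp: J_def)
    then have "dist y z < e" using \<open>r < e\<close> by (auto simp: C_def dist_real_def algebra_simps)
    then show "z \<in> V" using e j(3) by (auto simp: subset_iff)
  qed
  have disj: "disjoint_family_on C J"
    unfolding disjoint_family_on_def
  proof (intro ballI impI)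
    fix i j :: int assume "i \<noteq> j"
    then have "i + 1 \<le> j \<or> j + 1 \<le> i" by linarith
    then have "(real_of_int i + 1) * r \<le> real_of_int j * r \<or> (real_of_int j + 1) * r \<le> real_of_int i * r"
      using \<open>r > 0\<close> by (auto intro!: mult_right_mono)
    then show "C i \<inter> C j = {}" by (auto simp: C_def)
  qed
  have "(\<Sum>j\<in>J. (real_of_int j + 1) * r - real_of_int j * r) < \<delta>"
  proof -
    have "(\<Sum>j\<in>J. emeasure lborel (C j)) = emeasure lborel (\<Union>j\<in>J. C j)"
      using disj \<open>finite J\<close> by (intro sum_emeasure) (auto simp: CS)
    also have "\<dots> \<le> emeasure lborel V" using JV V(1) by (intro emeasure_mono) auto
    also have "\<dots> < ennreal \<delta>" by fact
    finally have "(\<Sum>j\<in>J. ennreal r) < ennreal \<delta>"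
      using \<open>r > 0\<close> by (simp add: C_def algebra_simps)
    then have "real (card J) * r < \<delta>"
      using \<open>r > 0\<close> by (simp add: ennreal_of_nat_eq_real_of_nat ennreal_mult'[symmetric] ennreal_less_iff)
    then show ?thesis by (simp add: algebra_simps)
  qed
  moreover have "{real_of_int i * r<..<(real_of_int i + 1) * r} \<inter> {real_of_int j * r<..<(real_of_int j + 1) * r} = {}"
    if "i \<in> J" "j \<in> J" "i \<noteq> j" for i j
    using disj that unfolding disjoint_family_on_def C_def
    by (meson disjoint_iff greaterThanAtMost_iff greaterThanLessThan_iff less_imp_le)
  ultimately have "fine_family UNIV \<delta> J (\<lambda>j. real_of_int j * r) (\<lambda>j. (real_of_int j + 1) * r)"
    using \<open>finite J\<close> \<open>r > 0\<close> by (intro fine_familyI) auto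
  note \<delta>[OF this]
  moreover have le: "h (real_of_int j * r) \<le> h ((real_of_int j + 1) * r)" for j
    using \<open>r > 0\<close> by (intro monoD[OF h(1)]) auto
  ultimately have sum: "(\<Sum>j\<in>J. h ((real_of_int j + 1) * r) - h (real_of_int j * r)) < \<epsilon>" by simp
  have "emeasure (interval_measure h) K \<le> emeasure (interval_measure h) (\<Union>j\<in>J. C j)"
    using KJ \<open>finite J\<close> by (intro emeasure_mono) (auto simp: C_def)
  also have "\<dots> \<le> (\<Sum>j\<in>J. emeasure (interval_measure h) (C j))"
    using \<open>finite J\<close> by (intro emeasure_subadditive_finite) (auto simp: C_def)
  also have "\<dots> = (\<Sum>j\<in>J. ennreal (h ((real_of_int j + 1) * r) - h (real_of_int j * r)))"
    unfolding C_def using \<open>r > 0\<close> cont monoD[OF h(1)]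
    by (intro sum.cong refl emeasure_interval_measure_Ioc)
       (auto simp: continuous_on_eq_continuous_within intro: continuous_within_subset)
  also have "\<dots> = ennreal (\<Sum>j\<in>J. h ((real_of_int j + 1) * r) - h (real_of_int j * r))"
    using le by (intro sum_ennreal) auto
  also have "\<dots> \<le> ennreal \<epsilon>" using sum by (intro ennreal_leI) simp
  finally show ?thesis .
qed

text \<open>h is, up to a constant, the distribution function of a finite measure. Inner regularity
  reduces its absolute continuity to compact null sets, and Radon-Nikodym yields the
  density.\<close>

lemma abs_cont_mono_density:
  fixes h :: "real \<Rightarrow> real"
  assumes h: "mono h" "abs_cont_on UNIV h" and bd: "\<And>s. h s \<le> B" "\<And>s. A \<le> h s"
  obtains g where "g \<in> borel_measurable borel" "integrable lborel g"
    "\<And>x y. x \<le> y \<Longrightarrow> h y - h x = (LINT s:{x..y}|lborel. g s)"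
proof -
  define M where "M = interval_measure h"
  have cont: "continuous_on UNIV h" by (rule abs_cont_on_imp_continuous_on[OF h(2)])
  have Icc: "emeasure M {x..y} = ennreal (h y - h x)" if "x \<le> y" for x y
    unfolding M_def using that cont monoD[OF h(1)] by (intro emeasure_interval_measure_Icc) auto
  have [simp]: "sets M = sets borel" "space M = UNIV" by (simp_all add: M_def)
  have fin: "emeasure M UNIV \<le> ennreal (B - A)"
  proof -
    have "emeasure M UNIV = emeasure M (\<Union>n. {- real n..real n})"
    proof (rule arg_cong[where f = "emeasure M"])
      have "x \<in> (\<Union>n. {- real n..real n})" for x
      proof -
        obtain n :: nat where "\<bar>x\<bar> \<le> n" using real_arch_simple by blast
        then show ?thesis by (auto intro!: exI[of _ n])
      qed
      then show "UNIV = (\<Union>n. {- real n..real n})" by blast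
    qed
    also have "\<dots> = (SUP n. emeasure M {- real n..real n})"
      by (rule SUP_emeasure_incseq[symmetric]) (auto simp: incseq_def)
    also have "\<dots> \<le> ennreal (B - A)"
    proof (rule SUP_least)
      fix n :: nat
      show "emeasure M {- real n..real n} \<le> ennreal (B - A)"
        using Icc[of "- real n" "real n"] bd(1)[of "real n"] bd(2)[of "- real n"] by (simp add: ennreal_leI)
    qed
    finally show ?thesis .
  qed
  then have fin': "emeasure M UNIV < \<infinity>" by (simp add: le_less_trans)
  have "absolutely_continuous lborel M"
    unfolding absolutely_continuous_def
  proof
    fix N :: "real set" assume N: "N \<in> null_sets lborel"
    have "emeasure M N = (SUP K \<in> {K. K \<subseteq> N \<and> compact K}. emeasure M K)"
      using fin' N by (intro inner_regular) (auto simp: null_sets_def)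
    also have "\<dots> \<le> 0"
    proof (rule SUP_least)
      fix K assume K: "K \<in> {K. K \<subseteq> N \<and> compact K}"
      then have "emeasure lborel K \<le> emeasure lborel N"
        using N by (intro emeasure_mono) (auto simp: null_sets_def)
      then have "emeasure lborel K = 0" using N by (auto simp: null_sets_def)
      then have "emeasure M K \<le> 0 + ennreal e" if "e > 0" for e
        using emeasure_interval_measure_compact_le[OF h, of K e] K that by (simp add: M_def)
      then show "emeasure M K \<le> 0" by (rule ennreal_le_epsilon)
    qed
    finally show "N \<in> null_sets M" using N by (auto simp: null_sets_def)
  qed
  then obtain f where f: "f \<in> borel_measurable lborel" "density lborel f = M"
    using sigma_finite_measure.Radon_Nikodym[OF sigma_finite_lborel, of M] by auto
  have f_int: "(\<integral>\<^sup>+s. f s * indicator S s \<partial>lborel) = emeasure M S" if "S \<in> sets borel" for S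
    using f that emeasure_density[of f lborel S] by simp
  have "(\<integral>\<^sup>+s. f s \<partial>lborel) < \<infinity>" using f_int[of UNIV] fin' by simp
  then have f_fin: "AE s in lborel. f s \<noteq> \<infinity>"
    using f(1) by (intro nn_integral_PInf_AE) auto
  \<comment> \<open>\<open>enn2real\<close> turns the value infinity into 0; since f has finite
    integral, this affects a null set only.\<close>
  define g where "g s = enn2real (f s)" for s
  have g_ge: "0 \<le> g s" for s by (simp add: g_def)
  have gm: "g \<in> borel_measurable borel" using f(1) unfolding g_def by simp
  have g_nn: "(\<integral>\<^sup>+s. ennreal (g s * indicator S s) \<partial>lborel) = emeasure M S" if "S \<in> sets borel" for S
  proof -
    have "(\<integral>\<^sup>+s. ennreal (g s * indicator S s) \<partial>lborel) = (\<integral>\<^sup>+s. f s * indicator S s \<partial>lborel)"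
      using f_fin by (intro nn_integral_cong_AE) (auto simp: g_def indicator_def less_top elim!: eventually_mono)
    then show ?thesis using f_int that by simp
  qed
  show ?thesis
  proof
    show "integrable lborel g"
      using g_nn[of UNIV] fin' gm by (intro integrableI_nonneg) (auto simp: g_def)
    fix x y :: real assume "x \<le> y"
    have "(LINT s:{x..y}|lborel. g s) = enn2real (\<integral>\<^sup>+s. ennreal (indicator {x..y} s *\<^sub>R g s) \<partial>lborel)"
      unfolding set_lebesgue_integral_def using gm g_ge by (intro integral_eq_nn_integral) auto
    also have "\<dots> = h y - h x"
      using g_nn[of "{x..y}"] Icc[OF \<open>x \<le> y\<close>] monoD[OF h(1) \<open>x \<le> y\<close>] by (simp add: mult.commute)
    finally show "h y - h x = (LINT s:{x..y}|lborel. g s)" by simp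
  qed (fact gm)
qed

text \<open>Jordan decomposition: the variation V dominates the increments of f, so V and V + f are
  both monotone, and f is the difference of two functions that have densities.\<close>

lemma abs_cont_real_density:
  fixes f :: "real \<Rightarrow> real"
  assumes f: "abs_cont_on UNIV f" and ab: "a \<le> b" and const: "\<And>s. f s = f (max a (min b s))"
  obtains g where "g \<in> borel_measurable borel" "integrable lborel g"
    "\<And>x y. x \<le> y \<Longrightarrow> f y - f x = (LINT s:{x..y}|lborel. g s)"
proof -
  define c where "c s = max a (min b s)" for s
  have c: "mono c" "\<And>x. a \<le> c x" "\<And>x. c x \<le> b" "\<And>x y. x \<le> y \<Longrightarrow> c y - c x \<le> y - x"
    using ab by (auto simp: c_def mono_def)
  \<comment> \<open>The clamp freezes V outside [a, b]. This makes it monotone and bounded on the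
    whole line, as the finite Stieltjes measure requires.\<close>
  define V where "V s = variation f a (c s)" for s
  have Vdiff: "V y - V x = variation f (c x) (c y)" if "x \<le> y" for x y
    using variation_additive[OF f c(2)[of x] monoD[OF c(1) that]] by (simp add: V_def)
  have fV: "\<bar>f y - f x\<bar> \<le> V y - V x" if "x \<le> y" for x y
    using norm_diff_le_variation[OF f monoD[OF c(1) that]] Vdiff[OF that] const[of x] const[of y]
    by (simp add: c_def)
  have V_ac: "abs_cont_on UNIV V"
  proof -
    have "abs_cont_on UNIV (\<lambda>s. variation f a (max a s))"
    proof (rule abs_cont_onI)
      fix \<epsilon> :: real assume "\<epsilon> > 0"
      obtain \<delta> where "\<delta> > 0" and \<delta>: "\<And>(I::nat set) a b. fine_family UNIV \<delta> I a b \<Longrightarrow>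
          (\<Sum>i\<in>I. variation f (a i) (b i)) \<le> \<epsilon> / 2"
        by (rule variation_abs_cont[OF f half_gt_zero[OF \<open>\<epsilon> > 0\<close>]]) (rule that)
      have "(\<Sum>i\<in>I. norm (variation f a (max a (q i)) - variation f a (max a (p i)))) < \<epsilon>"
        if fine: "fine_family UNIV \<delta> I p q" for I :: "nat set" and p q
      proof -
        have "(\<Sum>i\<in>I. norm (variation f a (max a (q i)) - variation f a (max a (p i)))) \<le>
            (\<Sum>i\<in>I. variation f (p i) (q i))"
        proof (rule sum_mono)
          fix i assume "i \<in> I"
          then have pq: "p i \<le> q i" by (rule fine_familyD(2)[OF fine])
          have nn: "0 \<le> variation f x y" if "x \<le> y" for x y
            using norm_diff_le_variation[OF f that] norm_ge_zero order_trans by blast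
          have "variation f a (max a (q i)) = variation f a (max a (p i)) + variation f (max a (p i)) (max a (q i))"
            using pq by (intro variation_additive[OF f]) auto
          moreover have "variation f (max a (p i)) (max a (q i)) \<le> variation f (p i) (q i)"
          proof (cases "a \<le> q i")
            case True
            then show ?thesis
              using variation_additive[OF f, of "p i" "max a (p i)" "q i"] nn[of "p i" "max a (p i)"] pq
              by (simp add: max_def split: if_splits)
          next
            case False
            then have eq: "max a (p i) = a" "max a (q i) = a" using pq by auto
            \<comment> \<open>Both ends are clamped to a, and additivity with a = c = b forces
              \<open>variation f a a\<close> to be 0.\<close>
            show ?thesis
              unfolding eq using variation_additive[OF f, of a a a] nn[OF pq] by simp
          qed
          ultimately show "norm (variation f a (max a (q i)) - variation f a (max a (p i))) \<le> variation f (p i) (q i)"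
            using nn[of "max a (p i)" "max a (q i)"] pq by auto
        qed
        also have "\<dots> \<le> \<epsilon> / 2" by (rule \<delta>[OF fine])
        finally show ?thesis using \<open>\<epsilon> > 0\<close> by simp
      qed
      then show "\<exists>\<delta>>0. \<forall>(I::nat set) p q. fine_family UNIV \<delta> I p q \<longrightarrow>
          (\<Sum>i\<in>I. norm (variation f a (max a (q i)) - variation f a (max a (p i)))) < \<epsilon>"
        using \<open>\<delta> > 0\<close> by blast
    qed
    from abs_cont_on_compose_mono[OF this c(1,4), of UNIV] show ?thesis
      using c(2) by (simp add: V_def[abs_def] max.absorb2)
  qed
  have Vc: "V s = V (c s)" for s using ab by (simp add: V_def c_def max_def min_def)
  have mV: "mono V" unfolding mono_def using fV by (smt (verit))
  have mVf: "mono (\<lambda>s. V s + f s)" unfolding mono_def using fV by (smt (verit))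
  have fc: "f s = f (c s)" for s using const by (simp add: c_def)
  obtain g1 where g1: "g1 \<in> borel_measurable borel" "integrable lborel g1"
    "\<And>x y. x \<le> y \<Longrightarrow> V y - V x = (LINT s:{x..y}|lborel. g1 s)"
  proof (rule abs_cont_mono_density[OF mV V_ac])
    show "V s \<le> V b" "V a \<le> V s" for s
      using monoD[OF mV c(3)[of s]] monoD[OF mV c(2)[of s]] Vc by auto
  qed (rule that)
  obtain g2 where g2: "g2 \<in> borel_measurable borel" "integrable lborel g2"
    "\<And>x y. x \<le> y \<Longrightarrow> (V y + f y) - (V x + f x) = (LINT s:{x..y}|lborel. g2 s)"
  proof (rule abs_cont_mono_density[OF mVf abs_cont_on_add[OF V_ac f]])
    show "V s + f s \<le> V b + f b" "V a + f a \<le> V s + f s" for s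
      using monoD[OF mVf c(3)[of s]] monoD[OF mVf c(2)[of s]] Vc[of s] fc[of s] by auto
  qed (rule that)
  show ?thesis
  proof
    show "(\<lambda>s. g2 s - g1 s) \<in> borel_measurable borel" using g1(1) g2(1) by simp
    show "integrable lborel (\<lambda>s. g2 s - g1 s)" using g1(2) g2(2) by simp
    fix x y :: real assume "x \<le> y"
    have i: "set_integrable lborel {x..y} g" if "integrable lborel g" for g :: "real \<Rightarrow> real"
      unfolding set_integrable_def using that by (intro integrable_mult_indicator) auto
    have "(LINT s:{x..y}|lborel. g2 s - g1 s) = (LINT s:{x..y}|lborel. g2 s) - (LINT s:{x..y}|lborel. g1 s)"
      using i[OF g1(2)] i[OF g2(2)] by (rule set_integral_diff(2)[rotated])
    then show "f y - f x = (LINT s:{x..y}|lborel. g2 s - g1 s)"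
      using g1(3)[OF \<open>x \<le> y\<close>] g2(3)[OF \<open>x \<le> y\<close>] by linarith
  qed
qed

text \<open>Lebesgue's differentiation theorem in its cube form looks at intervals to the right of a
  point. Applied to g it gives the right derivative, applied to the reflection
  \<open>g (- s)\<close> the left one; the second exceptional set is reflected back by a Lipschitz
  map and stays negligible.\<close>

lemma density_has_vector_derivative_AE:
  fixes \<gamma> g :: "real \<Rightarrow> 'a::euclidean_space"
  assumes int: "integrable lborel g"
    and eq: "\<And>x y. x \<le> y \<Longrightarrow> \<gamma> y - \<gamma> x = (LINT s:{x..y}|lborel. g s)"
  shows "AE s in lebesgue. (\<gamma> has_vector_derivative g s) (at s)"
proof -
  have si: "set_integrable lborel {x..y} g" for x y
    unfolding set_integrable_def using int by (intro integrable_mult_indicator) auto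
  have eq': "\<gamma> y - \<gamma> x = integral {x..y} g" if "x \<le> y" for x y
    using eq[OF that] set_borel_integral_eq_integral(2)[OF si] by simp
  have i1: "g integrable_on cbox x y" for x y
    using set_borel_integral_eq_integral(1)[OF si[of x y]] by simp
  have i2: "(\<lambda>s. g (- s)) integrable_on cbox x y" for x y
    using i1[of "-y" "-x"] Henstock_Kurzweil_Integration.integrable_reflect_real[where f = g and a = "-y" and b = "-x"] by simp
  obtain N1 where N1: "negligible N1" "\<And>x e. \<lbrakk>x \<notin> N1; 0 < e\<rbrakk> \<Longrightarrow>
     \<exists>d>0. \<forall>h. 0 < h \<and> h < d \<longrightarrow> norm (integral (cbox x (x + h *\<^sub>R One)) g /\<^sub>R h ^ DIM(real) - g x) < e"
    using integrable_ccontinuous_explicit[OF i1] by blast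
  obtain N2 where N2: "negligible N2" "\<And>x e. \<lbrakk>x \<notin> N2; 0 < e\<rbrakk> \<Longrightarrow>
     \<exists>d>0. \<forall>h. 0 < h \<and> h < d \<longrightarrow> norm (integral (cbox x (x + h *\<^sub>R One)) (\<lambda>s. g (- s)) /\<^sub>R h ^ DIM(real) - g (- x)) < e"
    using integrable_ccontinuous_explicit[OF i2] by blast
  have scale: "norm (a - h *\<^sub>R b) \<le> e * h" if "norm (a /\<^sub>R h - b) < e" "h > 0" for a b :: 'a and e h :: real
  proof -
    have "a - h *\<^sub>R b = h *\<^sub>R (a /\<^sub>R h - b)" using that(2) by (simp add: scaleR_diff_right)
    then show ?thesis using that by (simp add: mult.commute mult_left_mono less_imp_le)
  qed
  have deriv: "(\<gamma> has_vector_derivative g s) (at s)" if s: "s \<notin> N1 \<union> uminus ` N2" for s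
    unfolding has_vector_derivative_def has_derivative_within_alt
  proof (intro conjI allI impI)
    fix e :: real assume "e > 0"
    have s2: "- s \<notin> N2" using s by force
    obtain d1 where d1: "d1 > 0" "\<And>h. 0 < h \<Longrightarrow> h < d1 \<Longrightarrow> norm (integral {s..s + h} g /\<^sub>R h - g s) < e"
      using N1(2)[of s e] s \<open>e > 0\<close> by auto
    obtain d2 where d2: "d2 > 0" "\<And>h. 0 < h \<Longrightarrow> h < d2 \<Longrightarrow>
        norm (integral {-s..-s + h} (\<lambda>r. g (- r)) /\<^sub>R h - g s) < e"
      using N2(2)[of "-s" e] s2 \<open>e > 0\<close> by auto
    show "\<exists>d>0. \<forall>y\<in>UNIV. norm (y - s) < d \<longrightarrow> norm (\<gamma> y - \<gamma> s - (y - s) *\<^sub>R g s) \<le> e * norm (y - s)"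
    proof (intro exI[of _ "min d1 d2"] conjI ballI impI)
      fix y assume y: "norm (y - s) < min d1 d2"
      consider "y = s" | "y > s" | "y < s" by linarith
      then show "norm (\<gamma> y - \<gamma> s - (y - s) *\<^sub>R g s) \<le> e * norm (y - s)"
      proof cases
        case 2
        have "norm (integral {s..s + (y - s)} g /\<^sub>R (y - s) - g s) < e"
          using d1(2)[of "y - s"] 2 y by simp
        from scale[OF this] show ?thesis using eq'[of s y] 2 by simp
      next
        case 3
        have "norm (integral {-s..-s + (s - y)} (\<lambda>r. g (- r)) /\<^sub>R (s - y) - g s) < e"
          using d2(2)[of "s - y"] 3 y by simp
        from scale[OF this] have "norm (integral {-s..-y} (\<lambda>r. g (- r)) - (s - y) *\<^sub>R g s) \<le> e * (s - y)"
          using 3 by simp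
        moreover have "integral {-s..-y} (\<lambda>r. g (- r)) = \<gamma> s - \<gamma> y"
          using eq'[of y s] 3 Henstock_Kurzweil_Integration.integral_reflect_real[where f = g and a = y and b = s] by simp
        moreover have "\<gamma> y - \<gamma> s - (y - s) *\<^sub>R g s = - (\<gamma> s - \<gamma> y - (s - y) *\<^sub>R g s)"
          by (simp add: algebra_simps)
        ultimately show ?thesis using 3 by (simp only: norm_minus_cancel) simp
      qed simp
    qed (use d1 d2 in auto)
  qed (rule bounded_linear_scaleR_left)
  have "negligible (N1 \<union> uminus ` N2)"
  proof (intro negligible_Un negligible_locally_Lipschitz_image N1(1) N2(1))
    show "\<exists>V B. open V \<and> x \<in> V \<and> (\<forall>y\<in>N2 \<inter> V. norm (- y - - x) \<le> B * norm (y - x))" for x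
      by (intro exI[of _ UNIV] exI[of _ 1]) auto
  qed simp
  then have "N1 \<union> uminus ` N2 \<in> null_sets lebesgue" by (simp add: negligible_iff_null_sets)
  then show ?thesis
    by (rule AE_I') (use deriv in blast)
qed

text \<open>Being constant outside [a, b] makes the curve absolutely continuous on the whole line,
  and the coordinates reduce it to the real case.\<close>

lemma abs_cont_density:
  fixes \<gamma> :: "real \<Rightarrow> 'a::euclidean_space"
  assumes ac: "abs_cont_on {a..b} \<gamma>" and ab: "a \<le> b" and const: "\<And>s. \<gamma> s = \<gamma> (max a (min b s))"
  obtains g where "g \<in> borel_measurable borel" "integrable lborel g"
    "\<And>x y. x \<le> y \<Longrightarrow> \<gamma> y - \<gamma> x = (LINT s:{x..y}|lborel. g s)"
    "AE s in lebesgue. (\<gamma> has_vector_derivative g s) (at s)"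
proof -
  have "abs_cont_on UNIV (\<lambda>s. \<gamma> (max a (min b s)))"
    by (rule abs_cont_on_compose_mono[OF ac]) (use ab in \<open>auto simp: mono_def\<close>)
  then have acU: "abs_cont_on UNIV \<gamma>" using const by (simp add: const[symmetric])
  have "\<exists>g. g \<in> borel_measurable borel \<and> integrable lborel g \<and>
      (\<forall>x y. x \<le> y \<longrightarrow> \<gamma> y \<bullet> e - \<gamma> x \<bullet> e = (LINT s:{x..y}|lborel. g s))" if e: "e \<in> Basis" for e
  proof -
    have "abs_cont_on UNIV (\<lambda>s. \<gamma> s \<bullet> e)"
      by (rule abs_cont_on_norm_le[OF acU]) (use e in \<open>auto simp: inner_diff_left[symmetric] intro: Basis_le_norm\<close>)
    then show ?thesis
    proof (rule abs_cont_real_density[OF _ ab])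
      show "\<gamma> s \<bullet> e = \<gamma> (max a (min b s)) \<bullet> e" for s by (subst const) simp
    qed blast
  qed
  then obtain g where g: "\<And>e. e \<in> Basis \<Longrightarrow> g e \<in> borel_measurable borel"
     "\<And>e. e \<in> Basis \<Longrightarrow> integrable lborel (g e)"
     "\<And>e x y. e \<in> Basis \<Longrightarrow> x \<le> y \<Longrightarrow> \<gamma> y \<bullet> e - \<gamma> x \<bullet> e = (LINT s:{x..y}|lborel. g e s)"
    by metis
  define D where "D s = (\<Sum>e\<in>Basis. g e s *\<^sub>R e)" for s
  have Dm: "D \<in> borel_measurable borel" unfolding D_def using g(1) by measurable
  have Di: "integrable lborel D" unfolding D_def using g(2) by (intro Bochner_Integration.integrable_sum integrable_scaleR_left) auto
  have De: "D s \<bullet> e = g e s" if "e \<in> Basis" for s e using that by (simp add: D_def)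
  have eq: "\<gamma> y - \<gamma> x = (LINT s:{x..y}|lborel. D s)" if "x \<le> y" for x y
  proof (rule euclidean_eqI)
    fix e :: 'a assume e: "e \<in> Basis"
    have "integrable lborel (\<lambda>s. indicator {x..y} s *\<^sub>R D s)"
      using Di by (intro integrable_mult_indicator) auto
    then have "(LINT s:{x..y}|lborel. D s) \<bullet> e = (LINT s:{x..y}|lborel. D s \<bullet> e)"
      unfolding set_lebesgue_integral_def by (subst integral_inner_left[symmetric]) auto
    then show "(\<gamma> y - \<gamma> x) \<bullet> e = (LINT s:{x..y}|lborel. D s) \<bullet> e"
      using g(3)[OF e that] De[OF e] by (simp add: inner_diff_left)
  qed
  from that[OF Dm Di eq density_has_vector_derivative_AE[OF Di eq]] show ?thesis .
qed

section \<open>The cost functional\<close>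

lemma ext_integral_cong_AE:
  assumes "AE s in lebesgue. s \<in> S \<longrightarrow> f s = g s"
  shows "ext_integral S f = ext_integral S g"
proof -
  have "(\<integral>\<^sup>+s\<in>S. ennreal (f s) \<partial>lebesgue) = (\<integral>\<^sup>+s\<in>S. ennreal (g s) \<partial>lebesgue)"
    "(\<integral>\<^sup>+s\<in>S. ennreal (- f s) \<partial>lebesgue) = (\<integral>\<^sup>+s\<in>S. ennreal (- g s) \<partial>lebesgue)"
    by (rule nn_integral_cong_AE, use assms in \<open>auto simp: indicator_def elim!: eventually_mono\<close>)+
  then show ?thesis by (simp add: ext_integral_def)
qed

text \<open>The lower bound makes the negative part integrable over a compact interval, which rules
  out infinity minus infinity: if f is not integrable, its positive part must be responsible. In
  comparisons, curves that fail to be integrable can thus be dismissed as infinitely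
  expensive.\<close>

lemma ext_integral_bounded_below:
  fixes f :: "real \<Rightarrow> real"
  assumes meas: "set_borel_measurable lebesgue {a..b} f" and lb: "\<And>s. s \<in> {a..b} \<Longrightarrow> - C \<le> f s"
  shows "f absolutely_integrable_on {a..b} \<Longrightarrow> ext_integral {a..b} f = ereal (integral {a..b} f)"
    and "\<not> f absolutely_integrable_on {a..b} \<Longrightarrow> ext_integral {a..b} f = \<infinity>"
proof -
  let ?k = "\<lambda>s. indicator {a..b} s *\<^sub>R f s"
  have km: "?k \<in> borel_measurable lebesgue" using meas by (simp add: set_borel_measurable_def)
  have pos: "(\<integral>\<^sup>+s\<in>{a..b}. ennreal (f s) \<partial>lebesgue) = (\<integral>\<^sup>+s. ennreal (?k s) \<partial>lebesgue)"
    by (rule nn_integral_cong) (auto simp: indicator_def)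
  have neg: "(\<integral>\<^sup>+s\<in>{a..b}. ennreal (- f s) \<partial>lebesgue) = (\<integral>\<^sup>+s. ennreal (- ?k s) \<partial>lebesgue)"
    by (rule nn_integral_cong) (auto simp: indicator_def)
  have "(\<integral>\<^sup>+s. ennreal (- ?k s) \<partial>lebesgue) \<le> (\<integral>\<^sup>+s. ennreal \<bar>C\<bar> * indicator {a..b} s \<partial>lebesgue)"
  proof (rule nn_integral_mono)
    fix s
    show "ennreal (- ?k s) \<le> ennreal \<bar>C\<bar> * indicator {a..b} s"
      using lb[of s] by (auto simp: indicator_def intro!: ennreal_leI)
  qed
  also have "\<dots> = ennreal \<bar>C\<bar> * emeasure lebesgue {a..b}" by (rule nn_integral_cmult_indicator) simp
  also have "\<dots> < \<infinity>" by (simp add: ennreal_mult_less_top emeasure_lborel_Icc_eq)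
  finally have neg_fin: "(\<integral>\<^sup>+s. ennreal (- ?k s) \<partial>lebesgue) < \<infinity>" .
  show "ext_integral {a..b} f = ereal (integral {a..b} f)" if int: "f absolutely_integrable_on {a..b}"
  proof -
    have ik: "integrable lebesgue ?k" using int by (simp add: set_integrable_def)
    obtain r q where rq: "0 \<le> r" "0 \<le> q" "(\<integral>\<^sup>+s. ennreal (?k s) \<partial>lebesgue) = ennreal r"
       "(\<integral>\<^sup>+s. ennreal (- ?k s) \<partial>lebesgue) = ennreal q" "integral\<^sup>L lebesgue ?k = r - q"
      by (rule integrableE[OF ik]) (rule that)
    have "integral {a..b} f = r - q"
      using set_lebesgue_integral_eq_integral(2)[OF int] rq(5) by (simp add: set_lebesgue_integral_def)
    then show ?thesis unfolding ext_integral_def pos neg rq(3,4) using rq(1,2) by (simp add: enn2ereal_ennreal)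
  qed
  show "ext_integral {a..b} f = \<infinity>" if "\<not> f absolutely_integrable_on {a..b}"
  proof -
    have "(\<integral>\<^sup>+s. ennreal (?k s) \<partial>lebesgue) = \<infinity>"
      using that neg_fin km unfolding set_integrable_def real_integrable_def by auto
    moreover have "enn2ereal (\<integral>\<^sup>+s. ennreal (- ?k s) \<partial>lebesgue) \<noteq> \<infinity>"
      using neg_fin by (auto simp: less_top_ennreal enn2ereal_ennreal)
    ultimately show ?thesis
      unfolding ext_integral_def pos neg by (simp add: enn2ereal_top top_ereal_def)
  qed
qed

lemma vector_derivative_eq_on_interval:
  fixes f g :: "real \<Rightarrow> 'a::real_normed_vector"
  assumes "\<And>s. s \<in> {a..b} \<Longrightarrow> f s = g s" "s \<in> {a<..<b}"
  shows "vector_derivative f (at s) = vector_derivative g (at s)"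
proof (rule vector_derivative_cong_eq)
  have "eventually (\<lambda>x. x \<in> {a<..<b}) (nhds s)"
    using assms(2) by (intro eventually_nhds_in_open) auto
  then show "eventually (\<lambda>x. x \<in> UNIV \<longrightarrow> f x = g x) (nhds s)"
    by eventually_elim (use assms(1) in auto)
qed auto

text \<open>Clamping the time argument produces the representation demanded by
  \<open>Cpaths\<close>, constant outside [0, T].\<close>

lemma Gamma_from_curve:
  fixes p :: "real \<Rightarrow> 'a::euclidean_space"
  assumes "0 \<le> T" and ac: "abs_cont_on {0..T} p" and cl: "\<And>s. s \<in> {0..T} \<Longrightarrow> p s \<in> closure \<Omega>"
  obtains c where "c \<in> Gamma \<Omega> T" "\<And>s. s \<in> {0..T} \<Longrightarrow> apply_bcontfun c s = p s"
proof -
  have "continuous_on (cbox 0 T) p" using abs_cont_on_imp_continuous_on[OF ac] by simp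
  then obtain c :: "real \<Rightarrow>\<^sub>C 'a" where c: "\<And>s. s \<in> cbox 0 T \<Longrightarrow> c s = p s" "\<And>s. c s = p (clamp 0 T s)"
    by (rule continuous_on_cbox_bcontfunE) (rule that)
  have cl_eq: "clamp 0 T s = max 0 (min T s)" for s :: real
    using \<open>0 \<le> T\<close> unfolding clamp_def Basis_real_def by (simp add: max_def min_def)
  have "c s = c (max 0 (min T s))" for s
    using c(2)[of s] c(1)[of "max 0 (min T s)"] \<open>0 \<le> T\<close> by (simp add: cl_eq)
  moreover have "abs_cont_on {0..T} (apply_bcontfun c)"
    by (rule abs_cont_on_norm_le[OF ac]) (use c(1) in auto)
  ultimately have "c \<in> Gamma \<Omega> T"
    using c(1) cl by (auto simp: Gamma_def Cpaths_def)
  then show ?thesis using that c(1) by auto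
qed

lemma Gamma_join:
  assumes "\<alpha> \<in> Gamma \<Omega> T" "\<beta> \<in> Gamma \<Omega> T" "\<tau> \<in> {0..T}" "apply_bcontfun \<alpha> \<tau> = apply_bcontfun \<beta> \<tau>"
  obtains d where "d \<in> Gamma \<Omega> T" "\<And>s. s \<in> {0..\<tau>} \<Longrightarrow> apply_bcontfun d s = apply_bcontfun \<alpha> s"
    "\<And>s. s \<in> {\<tau>..T} \<Longrightarrow> apply_bcontfun d s = apply_bcontfun \<beta> s"
proof -
  have ac: "abs_cont_on {0..T} (\<lambda>s. if s \<le> \<tau> then apply_bcontfun \<alpha> s else apply_bcontfun \<beta> s)"
    using assms by (intro abs_cont_on_join) (auto simp: Gamma_def)
  have "0 \<le> T" using assms(3) by simp
  then obtain d where d: "d \<in> Gamma \<Omega> T" "\<And>s. s \<in> {0..T} \<Longrightarrow> apply_bcontfun d s = (if s \<le> \<tau> then apply_bcontfun \<alpha> s else apply_bcontfun \<beta> s)"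
  proof (rule Gamma_from_curve[OF _ ac])
    show "(if s \<le> \<tau> then apply_bcontfun \<alpha> s else apply_bcontfun \<beta> s) \<in> closure \<Omega>" if "s \<in> {0..T}" for s
      using assms(1,2) that by (auto simp: Gamma_def Cpaths_def)
  qed (rule that)
  show ?thesis
  proof (rule that[OF d(1)])
    show "apply_bcontfun d s = apply_bcontfun \<alpha> s" if "s \<in> {0..\<tau>}" for s
      using d(2)[of s] that assms(3) by auto
    show "apply_bcontfun d s = apply_bcontfun \<beta> s" if "s \<in> {\<tau>..T}" for s
      using d(2)[of s] that assms(3,4) by (cases "s = \<tau>") auto
  qed
qed

text \<open>Everything here is relative to one fixed flow \<open>m\<close>. The value function
  enters in \<open>mfg_value\<close>, the equilibrium as a premise where an optimal curve has to be
  found.\<close>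

locale mfg_data =
  fixes \<Omega> U :: "'a::euclidean_space set"
    and T kappa M c_mu :: real
    and L :: "'a \<Rightarrow> 'a \<Rightarrow> real"
    and Lx Lv :: "'a \<Rightarrow> 'a \<Rightarrow> 'a"
    and Lvx Lvv :: "'a \<Rightarrow> 'a \<Rightarrow> 'a \<Rightarrow> 'a"
    and F G :: "'a \<Rightarrow> 'a measure \<Rightarrow> real"
    and m :: "real \<Rightarrow> 'a measure"
  assumes T_pos: "T > 0"
    and bounded_Omega: "bounded \<Omega>"
    and U: "open U" "closure \<Omega> \<subseteq> U"
    and D1: "\<forall>y\<in>U. \<forall>m1\<in>Prob_on (closure \<Omega>). \<forall>m2\<in>Prob_on (closure \<Omega>).
               \<bar>F y m1 - F y m2\<bar> + \<bar>G y m1 - G y m2\<bar> \<le> kappa * KR_dist m1 m2"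
    and D2: "\<forall>\<mu>\<in>Prob_on (closure \<Omega>). \<exists>DF DG.
               (\<forall>y\<in>U. ((\<lambda>z. F z \<mu>) has_derivative (\<lambda>h. DF y \<bullet> h)) (at y)) \<and>
               (\<forall>y\<in>U. ((\<lambda>z. G z \<mu>) has_derivative (\<lambda>h. DG y \<bullet> h)) (at y)) \<and>
               continuous_on U DF \<and> continuous_on U DG \<and>
               bounded ((\<lambda>z. F z \<mu>) ` U) \<and> bounded ((\<lambda>z. G z \<mu>) ` U) \<and>
               (\<forall>y\<in>U. norm (DF y) + norm (DG y) \<le> kappa)"
    and L0_C1: "\<forall>y\<in>U. \<forall>v. ((\<lambda>(z, w). L z w) has_derivative
                   (\<lambda>(h, k). Lx y v \<bullet> h + Lv y v \<bullet> k)) (at (y, v))"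
    and L0_bound: "\<forall>y\<in>U. \<bar>L y 0\<bar> + norm (Lx y 0) + norm (Lv y 0) \<le> M"
    and L1_diff: "\<forall>y\<in>U. \<forall>v. ((\<lambda>(z, w). Lv z w) has_derivative
                   (\<lambda>(h, k). Lvx y v h + Lvv y v k)) (at (y, v))"
    and L1_mu: "c_mu > 0"
    and L1_vv: "\<forall>y\<in>U. \<forall>v k. (norm k)\<^sup>2 / c_mu \<le> Lvv y v k \<bullet> k \<and> Lvv y v k \<bullet> k \<le> c_mu * (norm k)\<^sup>2"
    and L1_vx: "\<forall>y\<in>U. \<forall>v h. norm (Lvx y v h) \<le> c_mu * (1 + norm v) * norm h"
    and m_prob: "\<forall>t\<in>{0..T}. m t \<in> Prob_on (closure \<Omega>)"
    and m_cont: "\<forall>t\<in>{0..T}. \<forall>\<epsilon>>0. \<exists>\<delta>>0. \<forall>s\<in>{0..T}. \<bar>s - t\<bar> < \<delta> \<longrightarrow> KR_dist (m s) (m t) < \<epsilon>"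
begin

lemma kappa_nonneg:
  assumes "y \<in> U"
  shows "0 \<le> kappa"
proof -
  obtain DF DG where "norm (DF y :: 'a) + norm (DG y :: 'a) \<le> kappa"
    using D2[rule_format, OF m_prob[rule_format, of 0]] T_pos assms by auto
  then show ?thesis by (smt (verit) norm_ge_zero)
qed

text \<open>Joint continuity splits into two halves: changing the measure is controlled uniformly in
  the point by (D1), changing the point at the fixed time s by differentiability. The
  \<open>kappa + 1\<close> in the tolerance allows for \<open>kappa\<close> being 0.\<close>

lemma continuous_F: "continuous_on ({0..T} \<times> closure \<Omega>) (\<lambda>(s, y). F y (m s))"
  unfolding continuous_on_iff
proof (intro ballI allI impI)
  fix x and e :: real assume "x \<in> {0..T} \<times> closure \<Omega>" "e > 0"
  then obtain s y where x: "x = (s, y)" "s \<in> {0..T}" "y \<in> closure \<Omega>" by auto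
  then have yU: "y \<in> U" using U by auto
  have k: "0 \<le> kappa" by (rule kappa_nonneg[OF yU])
  have ms: "m s \<in> Prob_on (closure \<Omega>)" using m_prob x by blast
  obtain DF where "((\<lambda>z. F z (m s)) has_derivative (\<lambda>h. DF y \<bullet> h)) (at y)"
    using D2[rule_format, OF ms] yU by blast
  then have "isCont (\<lambda>z. F z (m s)) y" by (rule has_derivative_continuous)
  then obtain d1 where d1: "d1 > 0" "\<And>z. dist z y < d1 \<Longrightarrow> dist (F z (m s)) (F y (m s)) < e / 2"
    unfolding continuous_at_eps_delta using \<open>e > 0\<close> half_gt_zero by blast
  have "e / (2 * (kappa + 1)) > 0" using \<open>e > 0\<close> k by simp
  then obtain d2 where d2: "d2 > 0" "\<And>s'. s' \<in> {0..T} \<Longrightarrow> \<bar>s' - s\<bar> < d2 \<Longrightarrow> KR_dist (m s') (m s) < e / (2 * (kappa + 1))"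
    using m_cont x(2) by blast
  show "\<exists>d>0. \<forall>x'\<in>{0..T} \<times> closure \<Omega>. dist x' x < d \<longrightarrow>
      dist (case x' of (s, y) \<Rightarrow> F y (m s)) (case x of (s, y) \<Rightarrow> F y (m s)) < e"
  proof (intro exI[of _ "min d1 d2"] conjI ballI impI)
    fix x' assume x': "x' \<in> {0..T} \<times> closure \<Omega>" "dist x' x < min d1 d2"
    then obtain s' z where z: "x' = (s', z)" "s' \<in> {0..T}" "z \<in> closure \<Omega>" by auto
    have "dist s' s \<le> dist x' x" "dist z y \<le> dist x' x"
      unfolding z x by (auto simp: dist_Pair_Pair intro: real_sqrt_sum_squares_ge1 real_sqrt_sum_squares_ge2)
    then have near: "\<bar>s' - s\<bar> < d2" "dist z y < d1" using x'(2) by (auto simp: dist_real_def)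
    have "m s' \<in> Prob_on (closure \<Omega>)" using m_prob z(2) by blast
    then have "\<bar>F z (m s') - F z (m s)\<bar> \<le> kappa * KR_dist (m s') (m s)"
      using D1 ms U(2) z(3) by (smt (verit) in_mono)
    also have "\<dots> \<le> kappa * (e / (2 * (kappa + 1)))"
      using d2(2)[OF z(2) near(1)] k by (intro mult_left_mono) auto
    also have "\<dots> \<le> e / 2" using k \<open>e > 0\<close> by (simp add: field_simps)
    finally show "dist (case x' of (s, y) \<Rightarrow> F y (m s)) (case x of (s, y) \<Rightarrow> F y (m s)) < e"
      using d1(2)[OF near(2)] unfolding z x by (simp add: dist_real_def) (smt (verit, best) field_sum_of_halves)
  qed (use d1 d2 in auto)
qed

lemma compact_closure_Omega: "compact (closure \<Omega>)"
  using bounded_Omega by (simp add: compact_eq_bounded_closed bounded_closure)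

lemma F_bounded_ex: "\<exists>B\<ge>0. \<forall>s\<in>{0..T}. \<forall>y\<in>closure \<Omega>. \<bar>F y (m s)\<bar> \<le> B"
proof -
  have "bounded ((\<lambda>(s, y). F y (m s)) ` ({0..T} \<times> closure \<Omega>))"
    by (intro compact_imp_bounded compact_continuous_image continuous_F compact_Times compact_closure_Omega) auto
  then obtain B where "\<forall>s\<in>{0..T}. \<forall>y\<in>closure \<Omega>. \<bar>F y (m s)\<bar> \<le> B"
    unfolding bounded_iff by (auto simp: image_iff)
  then show ?thesis by (intro exI[of _ "max 0 B"]) (auto simp: le_max_iff_disj)
qed

definition F_bd :: real where
  "F_bd = (SOME B. B \<ge> 0 \<and> (\<forall>s\<in>{0..T}. \<forall>y\<in>closure \<Omega>. \<bar>F y (m s)\<bar> \<le> B))"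

lemma F_bd: "0 \<le> F_bd" "s \<in> {0..T} \<Longrightarrow> y \<in> closure \<Omega> \<Longrightarrow> \<bar>F y (m s)\<bar> \<le> F_bd"
  using someI_ex[OF F_bounded_ex] unfolding F_bd_def by blast+

section \<open>Growth, convexity and Lipschitz estimates for the Lagrangian\<close>

lemma continuous_L: "continuous_on (U \<times> UNIV) (\<lambda>(y, v). L y v)"
  unfolding continuous_on_eq_continuous_within
proof
  fix x :: "'a \<times> 'a" assume "x \<in> U \<times> UNIV"
  then have "((\<lambda>(z, w). L z w) has_derivative (\<lambda>(h, k). Lx (fst x) (snd x) \<bullet> h + Lv (fst x) (snd x) \<bullet> k)) (at x)"
    using L0_C1 by (cases x) auto
  then show "continuous (at x within U \<times> UNIV) (\<lambda>(y, v). L y v)"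
    by (rule continuous_at_imp_continuous_within[OF has_derivative_continuous])
qed

lemma has_derivative_L_v:
  assumes "y \<in> U"
  shows "((\<lambda>w. L y w) has_derivative (\<lambda>k. Lv y v \<bullet> k)) (at v)"
proof -
  have "((\<lambda>w. (y, w)) has_derivative (\<lambda>k. (0, k))) (at v)"
    by (auto intro!: derivative_eq_intros)
  from has_derivative_compose[OF this, of "\<lambda>(z, w). L z w"] L0_C1 assms
  show ?thesis by fastforce
qed

lemma has_derivative_Lv_v:
  assumes "y \<in> U"
  shows "((\<lambda>w. Lv y w) has_derivative (\<lambda>k. Lvx y v 0 + Lvv y v k)) (at v)"
proof -
  have "((\<lambda>w. (y, w)) has_derivative (\<lambda>k. (0, k))) (at v)"
    by (auto intro!: derivative_eq_intros)
  from has_derivative_compose[OF this, of "\<lambda>(z, w). Lv z w"] L1_diff assms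
  show ?thesis by fastforce
qed

lemma has_derivative_L_x:
  assumes "y \<in> U"
  shows "((\<lambda>z. L z v) has_derivative (\<lambda>h. Lx y v \<bullet> h)) (at y)"
proof -
  have "((\<lambda>z. (z, v)) has_derivative (\<lambda>h. (h, 0))) (at y)"
    by (auto intro!: derivative_eq_intros)
  from has_derivative_compose[OF this, of "\<lambda>(z, w). L z w"] L0_C1 assms
  show ?thesis by fastforce
qed

lemma has_derivative_Lv_x:
  assumes "y \<in> U"
  shows "((\<lambda>z. Lv z v) has_derivative (\<lambda>h. Lvx y v h + Lvv y v 0)) (at y)"
proof -
  have "((\<lambda>z. (z, v)) has_derivative (\<lambda>h. (h, 0))) (at y)"
    by (auto intro!: derivative_eq_intros)
  from has_derivative_compose[OF this, of "\<lambda>(z, w). Lv z w"] L1_diff assms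
  show ?thesis by fastforce
qed

text \<open>Only the sum \<open>Lvx y v h + Lvv y v k\<close> is given as a derivative, hence as
  linear. That its summands vanish at 0 individually follows for the first from the growth bound and
  then for the second from linearity of the sum.\<close>

lemma Lvx_0: "y \<in> U \<Longrightarrow> Lvx y v 0 = 0"
  using L1_vx[rule_format, of y v 0] by simp

lemma Lvv_0: assumes "y \<in> U" shows "Lvv y v 0 = 0"
proof -
  have "linear (\<lambda>k. Lvx y v 0 + Lvv y v k)"
    using has_derivative_bounded_linear[OF has_derivative_Lv_v[OF assms, of v]] by (rule bounded_linear.linear)
  from linear_0[OF this] show ?thesis using Lvx_0[OF assms] by simp
qed

lemma Lv_monotone:
  assumes y: "y \<in> U"
  shows "(norm d)\<^sup>2 / c_mu \<le> (Lv y (w + d) - Lv y w) \<bullet> d"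
    and "(Lv y (w + d) - Lv y w) \<bullet> d \<le> c_mu * (norm d)\<^sup>2"
proof -
  have der: "((\<lambda>s. Lv y (w + s *\<^sub>R d) \<bullet> d) has_real_derivative Lvv y (w + s *\<^sub>R d) d \<bullet> d) (at s)" for s
  proof -
    have 1: "((\<lambda>s. w + s *\<^sub>R d) has_derivative (\<lambda>h. h *\<^sub>R d)) (at s)"
      by (auto intro!: derivative_eq_intros)
    have lin: "linear (\<lambda>k. Lvx y (w + s *\<^sub>R d) 0 + Lvv y (w + s *\<^sub>R d) k)"
      using has_derivative_bounded_linear[OF has_derivative_Lv_v[OF y]] by (rule bounded_linear.linear)
    have "((\<lambda>s. Lv y (w + s *\<^sub>R d)) has_derivative (\<lambda>h. Lvx y (w + s *\<^sub>R d) 0 + Lvv y (w + s *\<^sub>R d) (h *\<^sub>R d))) (at s)"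
      by (rule has_derivative_compose[OF 1 has_derivative_Lv_v[OF y]])
    then have "((\<lambda>s. Lv y (w + s *\<^sub>R d) \<bullet> d) has_derivative (\<lambda>h. (Lvx y (w + s *\<^sub>R d) 0 + Lvv y (w + s *\<^sub>R d) (h *\<^sub>R d)) \<bullet> d)) (at s)"
      by (rule has_derivative_inner_left)
    moreover have "(Lvx y (w + s *\<^sub>R d) 0 + Lvv y (w + s *\<^sub>R d) (h *\<^sub>R d)) \<bullet> d = Lvv y (w + s *\<^sub>R d) d \<bullet> d * h" for h
      using linear_scale[OF lin, of h d] Lvx_0[OF y] by simp
    ultimately show ?thesis unfolding has_field_derivative_def by simp
  qed
  obtain z where "z > 0" "z < 1" and z: "Lv y (w + 1 *\<^sub>R d) \<bullet> d - Lv y (w + 0 *\<^sub>R d) \<bullet> d = (1 - 0) * (Lvv y (w + z *\<^sub>R d) d \<bullet> d)"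
    using MVT2[of 0 1 "\<lambda>s. Lv y (w + s *\<^sub>R d) \<bullet> d" "\<lambda>s. Lvv y (w + s *\<^sub>R d) d \<bullet> d"] der by auto
  then show "(norm d)\<^sup>2 / c_mu \<le> (Lv y (w + d) - Lv y w) \<bullet> d"
    "(Lv y (w + d) - Lv y w) \<bullet> d \<le> c_mu * (norm d)\<^sup>2"
    using L1_vv y by (auto simp: inner_diff_left)
qed

text \<open>Second-order Taylor bounds along the segment from w to w + d. After subtracting the
  affine and the quadratic comparison term, the function of s has a derivative of fixed sign by
  \<open>Lv_monotone\<close> applied to \<open>s *\<^sub>R d\<close>.\<close>

lemma L_quadratic_bounds:
  assumes y: "y \<in> U"
  shows "L y w + Lv y w \<bullet> d + (norm d)\<^sup>2 / (2 * c_mu) \<le> L y (w + d)"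
    and "L y (w + d) \<le> L y w + Lv y w \<bullet> d + c_mu / 2 * (norm d)\<^sup>2"
proof -
  have der: "((\<lambda>s. L y (w + s *\<^sub>R d)) has_real_derivative Lv y (w + s *\<^sub>R d) \<bullet> d) (at s)" for s
  proof -
    have 1: "((\<lambda>s. w + s *\<^sub>R d) has_derivative (\<lambda>h. h *\<^sub>R d)) (at s)"
      by (auto intro!: derivative_eq_intros)
    have "((\<lambda>s. L y (w + s *\<^sub>R d)) has_derivative (\<lambda>h. Lv y (w + s *\<^sub>R d) \<bullet> (h *\<^sub>R d))) (at s)"
      by (rule has_derivative_compose[OF 1 has_derivative_L_v[OF y]])
    then show ?thesis unfolding has_field_derivative_def
      by (rule has_derivative_eq_rhs) (auto simp: fun_eq_iff)
  qed
  have dLv: "s * ((norm d)\<^sup>2 / c_mu) \<le> Lv y (w + s *\<^sub>R d) \<bullet> d - Lv y w \<bullet> d \<and>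
      Lv y (w + s *\<^sub>R d) \<bullet> d - Lv y w \<bullet> d \<le> s * (c_mu * (norm d)\<^sup>2)" if s: "0 \<le> s" for s
  proof (cases "s = 0")
    case False
    then have "s > 0" using s by simp
    have "s * (s * ((norm d)\<^sup>2 / c_mu)) \<le> s * (Lv y (w + s *\<^sub>R d) \<bullet> d - Lv y w \<bullet> d)"
      "s * (Lv y (w + s *\<^sub>R d) \<bullet> d - Lv y w \<bullet> d) \<le> s * (s * (c_mu * (norm d)\<^sup>2))"
      using Lv_monotone[OF y, where d = "s *\<^sub>R d" and w = w] s
      by (auto simp: inner_diff_left power_mult_distrib power2_eq_square[of s] algebra_simps)
    then show ?thesis using \<open>s > 0\<close> by (simp only: mult_le_cancel_left_pos)
  qed simp
  have "L y (w + 0 *\<^sub>R d) - 0 * (Lv y w \<bullet> d) - 0\<^sup>2 * ((norm d)\<^sup>2 / (2 * c_mu)) \<le>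
      L y (w + 1 *\<^sub>R d) - 1 * (Lv y w \<bullet> d) - 1\<^sup>2 * ((norm d)\<^sup>2 / (2 * c_mu))"
  proof (rule DERIV_nonneg_imp_nondecreasing[of 0 1])
    fix s :: real assume "0 \<le> s" "s \<le> 1"
    show "\<exists>r. ((\<lambda>s. L y (w + s *\<^sub>R d) - s * (Lv y w \<bullet> d) - s\<^sup>2 * ((norm d)\<^sup>2 / (2 * c_mu))) has_real_derivative r) (at s) \<and> 0 \<le> r"
      using dLv[OF \<open>0 \<le> s\<close>] L1_mu
      by (intro exI[of _ "Lv y (w + s *\<^sub>R d) \<bullet> d - Lv y w \<bullet> d - 2 * s * ((norm d)\<^sup>2 / (2 * c_mu))"] conjI)
         (auto intro!: derivative_eq_intros der)
  qed simp
  then show "L y w + Lv y w \<bullet> d + (norm d)\<^sup>2 / (2 * c_mu) \<le> L y (w + d)" by simp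
  have "0 * (Lv y w \<bullet> d) + 0\<^sup>2 * (c_mu / 2 * (norm d)\<^sup>2) - L y (w + 0 *\<^sub>R d) \<le>
      1 * (Lv y w \<bullet> d) + 1\<^sup>2 * (c_mu / 2 * (norm d)\<^sup>2) - L y (w + 1 *\<^sub>R d)"
  proof (rule DERIV_nonneg_imp_nondecreasing[of 0 1])
    fix s :: real assume "0 \<le> s" "s \<le> 1"
    show "\<exists>r. ((\<lambda>s. s * (Lv y w \<bullet> d) + s\<^sup>2 * (c_mu / 2 * (norm d)\<^sup>2) - L y (w + s *\<^sub>R d)) has_real_derivative r) (at s) \<and> 0 \<le> r"
      using dLv[OF \<open>0 \<le> s\<close>] L1_mu
      by (intro exI[of _ "Lv y w \<bullet> d + 2 * s * (c_mu / 2 * (norm d)\<^sup>2) - Lv y (w + s *\<^sub>R d) \<bullet> d"] conjI)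
         (auto intro!: derivative_eq_intros der)
  qed simp
  then show "L y (w + d) \<le> L y w + Lv y w \<bullet> d + c_mu / 2 * (norm d)\<^sup>2" by simp
qed

lemma M_nonneg: "y \<in> U \<Longrightarrow> 0 \<le> M"
  using L0_bound by (smt (verit) norm_ge_zero abs_ge_zero)

definition C0 :: real where "C0 = \<bar>M\<bar> + c_mu * M\<^sup>2"

text \<open>Lower Taylor bound at velocity 0, where the value and the slope of L are controlled by
  M. Half of the quadratic term absorbs the linear one by Young's inequality, which turns 2 into 4
  in the denominator; \<open>C0\<close> collects what remains.\<close>

lemma L_coercive:
  assumes y: "y \<in> U"
  shows "(norm v)\<^sup>2 / (4 * c_mu) - C0 \<le> L y v"
proof -
  have b: "\<bar>L y 0\<bar> + norm (Lx y 0) + norm (Lv y 0) \<le> M" using L0_bound y by blast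
  then have Lvb: "norm (Lv y 0) \<le> M" "- M \<le> L y 0" using norm_ge_zero[of "Lx y 0"] norm_ge_zero[of "Lv y 0"] by linarith+
  have "- (M * norm v) \<le> Lv y 0 \<bullet> v"
    using Cauchy_Schwarz_ineq2[of "Lv y 0" v] mult_right_mono[OF Lvb(1), of "norm v"] by simp
  moreover have "L y 0 + Lv y 0 \<bullet> v + (norm v)\<^sup>2 / (2 * c_mu) \<le> L y v"
    using L_quadratic_bounds(1)[OF y, of 0 v] by simp
  moreover have "M * norm v \<le> (norm v)\<^sup>2 / (4 * c_mu) + c_mu * M\<^sup>2"
  proof -
    have "0 \<le> (norm v / (2 * c_mu) - M)\<^sup>2 * c_mu" using L1_mu by simp
    also have "\<dots> = (norm v)\<^sup>2 / (4 * c_mu) + c_mu * M\<^sup>2 - M * norm v"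
      using L1_mu by (simp add: power2_eq_square field_simps)
    finally show ?thesis by simp
  qed
  moreover have "(norm v)\<^sup>2 / (2 * c_mu) = (norm v)\<^sup>2 / (4 * c_mu) + (norm v)\<^sup>2 / (4 * c_mu)"
    using L1_mu by (simp add: field_simps)
  ultimately show ?thesis using Lvb(2) M_nonneg[OF y] unfolding C0_def by linarith
qed

text \<open>The difference in position at velocity v is the one at velocity 0 plus its growth along
  the ray \<open>s *\<^sub>R v\<close>. The derivative of that growth is a difference of
  \<open>Lv\<close>, bounded through the mixed derivative in (L1), so the constant grows
  quadratically in v, just as the energy does.\<close>

lemma L_lipschitz_x:
  assumes S: "convex S" "S \<subseteq> U" and yz: "y \<in> S" "z \<in> S"
  shows "\<bar>L y v - L z v\<bar> \<le> (M + 2 * c_mu) * (1 + (norm v)\<^sup>2) * norm (y - z)"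
proof -
  have M0: "0 \<le> M" using M_nonneg S yz by blast
  have 0: "\<bar>L y 0 - L z 0\<bar> \<le> M * norm (y - z)"
  proof -
    have "norm (L y 0 - L z 0) \<le> M * norm (y - z)"
    proof (rule differentiable_bound[OF S(1)])
      fix x assume x: "x \<in> S"
      show "((\<lambda>z. L z 0) has_derivative (\<lambda>h. Lx x 0 \<bullet> h)) (at x within S)"
        using has_derivative_L_x x S has_derivative_at_withinI by blast
      show "onorm (\<lambda>h. Lx x 0 \<bullet> h) \<le> M"
      proof (rule onorm_bound[OF M0])
        fix h
        have "norm (Lx x 0) \<le> M" using L0_bound x S norm_ge_zero[of "Lv x 0"] by (smt (verit) in_mono)
        then show "norm (Lx x 0 \<bullet> h) \<le> M * norm h"
          using Cauchy_Schwarz_ineq2[of "Lx x 0" h] mult_right_mono[of "norm (Lx x 0)" M "norm h"] by simp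
      qed
    qed (use yz in auto)
    then show ?thesis by simp
  qed
  have Lvd: "norm (Lv y w - Lv z w) \<le> c_mu * (1 + norm w) * norm (y - z)" for w
  proof (rule differentiable_bound[OF S(1)])
    fix x assume x: "x \<in> S"
    show "((\<lambda>z. Lv z w) has_derivative (\<lambda>h. Lvx x w h + Lvv x w 0)) (at x within S)"
      using has_derivative_Lv_x x S has_derivative_at_withinI by blast
    have xU: "x \<in> U" using x S by blast
    show "onorm (\<lambda>h. Lvx x w h + Lvv x w 0) \<le> c_mu * (1 + norm w)"
      using L1_vx xU Lvv_0[OF xU] L1_mu by (intro onorm_bound) auto
  qed (use yz in auto)
  have yU: "y \<in> U" "z \<in> U" using yz S by auto
  have "norm ((L y (1 *\<^sub>R v) - L z (1 *\<^sub>R v)) - (L y (0 *\<^sub>R v) - L z (0 *\<^sub>R v))) \<le>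
     c_mu * (1 + norm v) * norm (y - z) * norm v * norm (1 - 0 :: real)"
  proof (rule field_differentiable_bound[where S = "{0..1}" and f' = "\<lambda>s. (Lv y (s *\<^sub>R v) - Lv z (s *\<^sub>R v)) \<bullet> v"])
    fix s :: real assume s: "s \<in> {0..1}"
    have 1: "((\<lambda>s. s *\<^sub>R v) has_derivative (\<lambda>h. h *\<^sub>R v)) (at s within {0..1})"
      by (auto intro!: derivative_eq_intros)
    have "((\<lambda>s. L y (s *\<^sub>R v)) has_derivative (\<lambda>h. Lv y (s *\<^sub>R v) \<bullet> (h *\<^sub>R v))) (at s within {0..1})"
      "((\<lambda>s. L z (s *\<^sub>R v)) has_derivative (\<lambda>h. Lv z (s *\<^sub>R v) \<bullet> (h *\<^sub>R v))) (at s within {0..1})"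
      by (rule has_derivative_compose[OF 1 has_derivative_L_v], fact)+
    from has_derivative_diff[OF this]
    show "((\<lambda>s. L y (s *\<^sub>R v) - L z (s *\<^sub>R v)) has_field_derivative (Lv y (s *\<^sub>R v) - Lv z (s *\<^sub>R v)) \<bullet> v) (at s within {0..1})"
      unfolding has_field_derivative_def
      by (rule has_derivative_eq_rhs) (auto simp: fun_eq_iff inner_diff_left algebra_simps)
    have "norm (s *\<^sub>R v) \<le> norm v" using s by (simp add: mult_left_le_one_le)
    then have "c_mu * (1 + norm (s *\<^sub>R v)) * norm (y - z) \<le> c_mu * (1 + norm v) * norm (y - z)"
      using L1_mu by (intro mult_right_mono mult_left_mono) auto
    then have "norm (Lv y (s *\<^sub>R v) - Lv z (s *\<^sub>R v)) \<le> c_mu * (1 + norm v) * norm (y - z)"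
      using Lvd[of "s *\<^sub>R v"] by linarith
    then show "norm ((Lv y (s *\<^sub>R v) - Lv z (s *\<^sub>R v)) \<bullet> v) \<le> c_mu * (1 + norm v) * norm (y - z) * norm v"
      using Cauchy_Schwarz_ineq2[of "Lv y (s *\<^sub>R v) - Lv z (s *\<^sub>R v)" v] mult_right_mono[OF _ norm_ge_zero]
      by (smt (verit) real_norm_def)
  qed auto
  then have "\<bar>L y v - L z v\<bar> \<le> c_mu * (1 + norm v) * norm (y - z) * norm v + M * norm (y - z)"
    using 0 by simp
  also have "\<dots> = (M + c_mu * ((1 + norm v) * norm v)) * norm (y - z)" by (simp add: algebra_simps)
  also have "\<dots> \<le> ((M + 2 * c_mu) * (1 + (norm v)\<^sup>2)) * norm (y - z)"
  proof (rule mult_right_mono)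
    have "0 \<le> (norm v - 1)\<^sup>2" by simp
    then have "(1 + norm v) * norm v \<le> 2 * (1 + (norm v)\<^sup>2)"
      by (simp add: power2_eq_square algebra_simps) (smt (verit) mult_nonneg_nonneg norm_ge_zero)
    then have "c_mu * ((1 + norm v) * norm v) \<le> c_mu * (2 * (1 + (norm v)\<^sup>2))" using L1_mu by simp
    moreover have "M \<le> M * (1 + (norm v)\<^sup>2)" using M0 by (simp add: algebra_simps)
    ultimately show "M + c_mu * ((1 + norm v) * norm v) \<le> (M + 2 * c_mu) * (1 + (norm v)\<^sup>2)"
      by (simp add: algebra_simps)
  qed simp
  finally show ?thesis .
qed

end

section \<open>Running cost, competitors and optimality\<close>

lemma absolutely_integrable_combine:
  fixes f :: "real \<Rightarrow> real"
  assumes "a \<le> c" "c \<le> b" "f absolutely_integrable_on {a..c}" "f absolutely_integrable_on {c..b}"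
  shows "f absolutely_integrable_on {a..b}"
    and "integral {a..b} f = integral {a..c} f + integral {c..b} f"
proof -
  have "f absolutely_integrable_on ({a..c} \<union> {c..b})" using assms by (intro absolutely_integrable_Un) auto
  moreover have "{a..c} \<union> {c..b} = {a..b}" using assms by auto
  ultimately show i: "f absolutely_integrable_on {a..b}" by simp
  show "integral {a..b} f = integral {a..c} f + integral {c..b} f"
    by (rule Henstock_Kurzweil_Integration.integral_combine[OF assms(1,2), symmetric])
       (use i in \<open>simp add: absolutely_integrable_on_def\<close>)
qed

context mfg_data
begin

definition lag :: "(real \<Rightarrow>\<^sub>C 'a) \<Rightarrow> real \<Rightarrow> real" where
  "lag \<gamma> s = L (\<gamma> s) (vector_derivative (apply_bcontfun \<gamma>) (at s)) + F (\<gamma> s) (m s)"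

lemma cost_lag:
  "cost L F G T m t \<gamma> = ext_integral {t..T} (lag \<gamma>) + ereal (G (\<gamma> T) (m T))"
  unfolding cost_def lag_def ..

lemma Gamma_closure: "\<gamma> \<in> Gamma \<Omega> T \<Longrightarrow> s \<in> {0..T} \<Longrightarrow> apply_bcontfun \<gamma> s \<in> closure \<Omega>"
  by (simp add: Gamma_def Cpaths_def)

lemma Gamma_U: "\<gamma> \<in> Gamma \<Omega> T \<Longrightarrow> s \<in> {0..T} \<Longrightarrow> apply_bcontfun \<gamma> s \<in> U"
  using Gamma_closure U(2) by blast

lemma lag_lower:
  assumes "\<gamma> \<in> Gamma \<Omega> T" "s \<in> {0..T}"
  shows "- (C0 + F_bd) \<le> lag \<gamma> s"
proof -
  have "0 \<le> (norm (vector_derivative (apply_bcontfun \<gamma>) (at s)))\<^sup>2 / (4 * c_mu)" using L1_mu by simp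
  then show ?thesis
    using L_coercive[OF Gamma_U[OF assms], of "vector_derivative (apply_bcontfun \<gamma>) (at s)"]
      F_bd(2)[OF assms(2) Gamma_closure[OF assms]]
    unfolding lag_def by linarith
qed

lemma continuous_on_F_curve:
  assumes "continuous_on {a..b} p" "0 \<le> a" "b \<le> T" "\<And>s. s \<in> {a..b} \<Longrightarrow> p s \<in> closure \<Omega>"
  shows "continuous_on {a..b} (\<lambda>s. F (p s) (m s))"
proof -
  have "continuous_on {a..b} ((\<lambda>(s, y). F y (m s)) \<circ> (\<lambda>s. (s, p s)))"
    using assms
    by (intro continuous_on_compose continuous_on_subset[OF continuous_F] continuous_intros) auto
  then show ?thesis by (simp add: o_def)
qed

lemma lag_density_measurable:
  assumes \<gamma>: "\<gamma> \<in> Gamma \<Omega> T" and g: "g \<in> borel_measurable borel" and ab: "0 \<le> a" "b \<le> T"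
  shows "set_borel_measurable lebesgue {a..b} (\<lambda>s. L (\<gamma> s) (g s) + F (\<gamma> s) (m s))"
proof -
  \<comment> \<open>L is continuous over U only. Cutting it off outside this closed set gives a
    Borel function on the whole product, and on [a, b] the curve never leaves the closure.\<close>
  let ?K = "closure \<Omega> \<times> (UNIV :: 'a set)"
  have "continuous_on ?K (\<lambda>(y, v). L y v)"
    by (rule continuous_on_subset[OF continuous_L]) (use U in auto)
  then have Lm: "(\<lambda>p. indicator ?K p *\<^sub>R (case p of (y, v) \<Rightarrow> L y v)) \<in> borel_measurable borel"
    by (intro borel_measurable_continuous_on_indicator) (auto intro!: borel_closed closed_Times)
  have gm: "apply_bcontfun \<gamma> \<in> borel_measurable borel"
    by (intro borel_measurable_continuous_onI) simp
  have "(\<lambda>s. (\<gamma> s, g s)) \<in> borel_measurable borel" using gm g by simp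
  from measurable_compose[OF this Lm]
  have m1: "(\<lambda>s. indicator ?K (\<gamma> s, g s) *\<^sub>R L (\<gamma> s) (g s)) \<in> borel_measurable borel" by simp
  have m2: "(\<lambda>s. indicator {a..b} s *\<^sub>R F (\<gamma> s) (m s)) \<in> borel_measurable borel"
    using continuous_on_F_curve[of a b "apply_bcontfun \<gamma>"] ab Gamma_closure[OF \<gamma>]
    by (intro borel_measurable_continuous_on_indicator) auto
  have "(\<lambda>s. indicator {a..b} s *\<^sub>R (indicator ?K (\<gamma> s, g s) *\<^sub>R L (\<gamma> s) (g s)) + indicator {a..b} s *\<^sub>R F (\<gamma> s) (m s)) \<in> borel_measurable borel"
    by (rule borel_measurable_add[OF borel_measurable_scaleR[OF _ m1] m2]) simp
  also have "(\<lambda>s. indicator {a..b} s *\<^sub>R (indicator ?K (\<gamma> s, g s) *\<^sub>R L (\<gamma> s) (g s)) + indicator {a..b} s *\<^sub>R F (\<gamma> s) (m s)) =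
     (\<lambda>s. indicator {a..b} s *\<^sub>R (L (\<gamma> s) (g s) + F (\<gamma> s) (m s)))"
    using Gamma_closure[OF \<gamma>] ab by (auto simp: fun_eq_iff indicator_def)
  finally show ?thesis
    unfolding set_borel_measurable_def by (intro measurable_completion) simp
qed

text \<open>\<open>vector_derivative\<close> is an arbitrary value where the curve is not
  differentiable, and its measurability is unclear. A Borel density of the curve replaces it at the
  price of a null set.\<close>

lemma Gamma_density:
  assumes "\<gamma> \<in> Gamma \<Omega> T"
  obtains g where "g \<in> borel_measurable borel" "integrable lborel g"
    "\<And>x y. x \<le> y \<Longrightarrow> apply_bcontfun \<gamma> y - apply_bcontfun \<gamma> x = (LINT s:{x..y}|lborel. g s)"
    "AE s in lebesgue. lag \<gamma> s = L (\<gamma> s) (g s) + F (\<gamma> s) (m s)"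
proof -
  have ac: "abs_cont_on {0..T} (apply_bcontfun \<gamma>)" and const: "\<gamma> s = \<gamma> (max 0 (min T s))" for s
    using assms by (auto simp: Gamma_def Cpaths_def)
  obtain g where g: "g \<in> borel_measurable borel" "integrable lborel g"
    "\<And>x y. x \<le> y \<Longrightarrow> \<gamma> y - \<gamma> x = (LINT s:{x..y}|lborel. g s)"
    "AE s in lebesgue. (apply_bcontfun \<gamma> has_vector_derivative g s) (at s)"
    by (rule abs_cont_density[OF ac less_imp_le[OF T_pos] const]) (rule that)
  have "AE s in lebesgue. lag \<gamma> s = L (\<gamma> s) (g s) + F (\<gamma> s) (m s)"
    using g(4) by eventually_elim (simp add: lag_def vector_derivative_at)
  from that[OF g(1-3) this] show ?thesis .
qed

lemma lag_measurable:
  assumes \<gamma>: "\<gamma> \<in> Gamma \<Omega> T" and ab: "0 \<le> a" "b \<le> T"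
  shows "set_borel_measurable lebesgue {a..b} (lag \<gamma>)"
proof -
  obtain g where g: "g \<in> borel_measurable borel"
    "AE s in lebesgue. lag \<gamma> s = L (\<gamma> s) (g s) + F (\<gamma> s) (m s)"
    by (rule Gamma_density[OF \<gamma>]) (rule that)
  have "(\<lambda>s. indicator {a..b} s *\<^sub>R (L (\<gamma> s) (g s) + F (\<gamma> s) (m s))) \<in> borel_measurable lebesgue"
    using lag_density_measurable[OF \<gamma> g(1) ab] by (simp add: set_borel_measurable_def)
  then show ?thesis unfolding set_borel_measurable_def
    by (rule borel_measurable_AE) (use g(2) in \<open>auto elim: eventually_mono\<close>)
qed

lemma cost_cases:
  assumes \<gamma>: "\<gamma> \<in> Gamma \<Omega> T" and t: "t \<in> {0..T}"
  shows "lag \<gamma> absolutely_integrable_on {t..T} \<Longrightarrow>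
      cost L F G T m t \<gamma> = ereal (integral {t..T} (lag \<gamma>) + G (\<gamma> T) (m T))"
    and "\<not> lag \<gamma> absolutely_integrable_on {t..T} \<Longrightarrow> cost L F G T m t \<gamma> = \<infinity>"
  using ext_integral_bounded_below[OF lag_measurable[OF \<gamma>, of t T], of "C0 + F_bd"] lag_lower[OF \<gamma>] t
  unfolding cost_lag by auto

text \<open>At a and b the two-sided derivatives may differ, since the curves may part outside the
  interval; these two points form a null set.\<close>

lemma lag_eq_on_interval:
  assumes "\<And>s. s \<in> {a..b} \<Longrightarrow> apply_bcontfun \<alpha> s = apply_bcontfun \<beta> s"
  shows "lag \<alpha> absolutely_integrable_on {a..b} \<longleftrightarrow> lag \<beta> absolutely_integrable_on {a..b}"
    and "integral {a..b} (lag \<alpha>) = integral {a..b} (lag \<beta>)"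
proof -
  have eq: "lag \<alpha> s = lag \<beta> s" if "s \<in> {a..b} - {a, b}" for s
    using vector_derivative_eq_on_interval[of a b "apply_bcontfun \<alpha>" "apply_bcontfun \<beta>" s] assms that
    unfolding lag_def by auto
  show "lag \<alpha> absolutely_integrable_on {a..b} \<longleftrightarrow> lag \<beta> absolutely_integrable_on {a..b}"
    by (rule absolutely_integrable_spike_eq[of "{a, b}"]) (use eq in auto)
  show "integral {a..b} (lag \<alpha>) = integral {a..b} (lag \<beta>)"
    by (rule integral_spike[of "{a, b}"]) (use eq in auto)
qed

text \<open>Source of all explicit competitors: a continuously differentiable arc, frozen outside
  [a, b], is Lipschitz and hence an element of \<open>Gamma\<close>, and its running cost on [a, b]
  is the integral of a continuous function.\<close>

lemma smooth_curve:
  fixes p p' :: "real \<Rightarrow> 'a"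
  assumes ab: "0 \<le> a" "a < b" "b \<le> T" and d: "\<And>s. (p has_vector_derivative p' s) (at s)"
    and c': "continuous_on UNIV p'" and cl: "\<And>s. s \<in> {a..b} \<Longrightarrow> p s \<in> closure \<Omega>"
  obtains c where "c \<in> Gamma \<Omega> T" "\<And>s. s \<in> {a..b} \<Longrightarrow> apply_bcontfun c s = p s"
    "lag c absolutely_integrable_on {a..b}"
    "integral {a..b} (lag c) = integral {a..b} (\<lambda>s. L (p s) (p' s) + F (p s) (m s))"
    "(\<lambda>s. L (p s) (p' s) + F (p s) (m s)) integrable_on {a..b}"
proof -
  have contp: "continuous_on S p" for S
    using d by (auto intro!: continuous_at_imp_continuous_on has_vector_derivative_continuous)
  have "bounded (p' ` {a..b})"
    by (intro compact_imp_bounded compact_continuous_image continuous_on_subset[OF c']) auto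
  then obtain B where B: "\<forall>s\<in>{a..b}. norm (p' s) \<le> B" unfolding bounded_iff by auto
  have lip: "norm (p x - p y) \<le> B * \<bar>x - y\<bar>" if "x \<in> {a..b}" "y \<in> {a..b}" for x y
  proof -
    have "norm (p x - p y) \<le> B * norm (x - y)"
    proof (rule differentiable_bound[of "{a..b}"])
      fix s assume s: "s \<in> {a..b}"
      show "(p has_derivative (\<lambda>h. h *\<^sub>R p' s)) (at s within {a..b})"
        using d[of s] has_derivative_at_withinI unfolding has_vector_derivative_def by blast
      have "norm (p' s) \<le> B" using B s by blast
      then show "onorm (\<lambda>h. h *\<^sub>R p' s) \<le> B"
        by (intro onorm_bound) (auto intro: order_trans[OF norm_ge_zero] simp: mult.commute[of B] mult_left_mono)
    qed (use that in auto)
    then show ?thesis by simp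
  qed
  have "abs_cont_on {a..b} p" by (rule abs_cont_on_lipschitz) (rule lip)
  then have "abs_cont_on {0..T} (\<lambda>s. p (max a (min b s)))"
    by (rule abs_cont_on_compose_mono) (use ab in \<open>auto simp: mono_def\<close>)
  then obtain c where c: "c \<in> Gamma \<Omega> T" "\<And>s. s \<in> {0..T} \<Longrightarrow> apply_bcontfun c s = p (max a (min b s))"
    by (rule Gamma_from_curve[rotated]) (use T_pos ab cl that in auto)
  have cp: "apply_bcontfun c s = p s" if "s \<in> {a..b}" for s using c(2)[of s] that ab by auto
  let ?f = "\<lambda>s. L (p s) (p' s) + F (p s) (m s)"
  have eq: "lag c s = ?f s" if "s \<in> {a..b} - {a, b}" for s
    using vector_derivative_eq_on_interval[of a b "apply_bcontfun c" p s] cp that vector_derivative_at[OF d[of s]]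
    unfolding lag_def by auto
  have "continuous_on {a..b} ((\<lambda>(y, v). L y v) \<circ> (\<lambda>s. (p s, p' s)))"
    using cl U(2)
    by (intro continuous_on_compose continuous_on_subset[OF continuous_L] continuous_intros contp continuous_on_subset[OF c']) auto
  then have "continuous_on {a..b} (\<lambda>s. L (p s) (p' s))" by (simp add: o_def)
  then have "continuous_on {a..b} ?f"
    using ab cl by (intro continuous_intros continuous_on_F_curve contp) auto
  then have i: "?f absolutely_integrable_on {a..b}"
    using absolutely_integrable_continuous[of a b ?f] by simp
  show ?thesis
  proof (rule that[OF c(1) cp])
    show "lag c absolutely_integrable_on {a..b}"
      by (rule absolutely_integrable_spike[OF i, of "{a, b}"]) (use eq in auto)
    show "integral {a..b} (lag c) = integral {a..b} ?f"
      by (rule integral_spike[of "{a, b}"]) (use eq in auto)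
    show "?f integrable_on {a..b}" using i by (simp add: absolutely_integrable_on_def)
  qed
qed

text \<open>Optimality relative to the flow m, which agrees with the evaluation flow on [0, T] only.\<close>
definition optimal :: "(real \<Rightarrow>\<^sub>C 'a) \<Rightarrow> bool" where
  "optimal \<gamma> \<longleftrightarrow> \<gamma> \<in> Gamma \<Omega> T \<and>
     (\<forall>\<gamma>'\<in>Gamma_at \<Omega> T 0 (\<gamma> 0). cost L F G T m 0 \<gamma> \<le> cost L F G T m 0 \<gamma>')"

text \<open>Comparison with the curve that rests at the starting point, whose cost is finite and
  explicitly bounded.\<close>

lemma optimal_integrable:
  assumes "optimal \<gamma>"
  shows "lag \<gamma> absolutely_integrable_on {0..T}"
    and "integral {0..T} (lag \<gamma>) + G (\<gamma> T) (m T) \<le> T * (M + F_bd) + G (\<gamma> 0) (m T)"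
proof -
  have \<gamma>: "\<gamma> \<in> Gamma \<Omega> T" using assms by (simp add: optimal_def)
  have x0: "\<gamma> 0 \<in> closure \<Omega>" "\<gamma> 0 \<in> U" using Gamma_closure[OF \<gamma>, of 0] Gamma_U[OF \<gamma>, of 0] T_pos by auto
  obtain c where c: "c \<in> Gamma \<Omega> T" "\<And>s. s \<in> {0..T} \<Longrightarrow> apply_bcontfun c s = \<gamma> 0"
    "lag c absolutely_integrable_on {0..T}"
    "integral {0..T} (lag c) = integral {0..T} (\<lambda>s. L (\<gamma> 0) 0 + F (\<gamma> 0) (m s))"
    "(\<lambda>s. L (\<gamma> 0) 0 + F (\<gamma> 0) (m s)) integrable_on {0..T}"
    by (rule smooth_curve[of 0 T "\<lambda>_. \<gamma> 0" "\<lambda>_. 0"]) (use T_pos x0 that in auto)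
  have "integral {0..T} (\<lambda>s. L (\<gamma> 0) 0 + F (\<gamma> 0) (m s)) \<le> integral {0..T} (\<lambda>s. M + F_bd)"
  proof (rule integral_le[OF c(5)])
    fix s assume "s \<in> {0..T}"
    have "L (\<gamma> 0) 0 \<le> M" using L0_bound x0(2) by (smt (verit) norm_ge_zero)
    then show "L (\<gamma> 0) 0 + F (\<gamma> 0) (m s) \<le> M + F_bd"
      using F_bd(2)[OF \<open>s \<in> {0..T}\<close> x0(1)] by linarith
  qed (rule integrable_const_ivl)
  then have bound: "integral {0..T} (lag c) \<le> T * (M + F_bd)" using c(4) T_pos by simp
  have "c \<in> Gamma_at \<Omega> T 0 (\<gamma> 0)" using c T_pos by (simp add: Gamma_at_def)
  then have "cost L F G T m 0 \<gamma> \<le> cost L F G T m 0 c" using assms by (simp add: optimal_def)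
  also have "\<dots> = ereal (integral {0..T} (lag c) + G (\<gamma> 0) (m T))"
    using cost_cases(1)[OF c(1) _ c(3)] c(2)[of T] T_pos by simp
  also have "\<dots> \<le> ereal (T * (M + F_bd) + G (\<gamma> 0) (m T))" using bound by simp
  finally have le: "cost L F G T m 0 \<gamma> \<le> ereal (T * (M + F_bd) + G (\<gamma> 0) (m T))" .
  then show i: "lag \<gamma> absolutely_integrable_on {0..T}"
    using cost_cases(2)[OF \<gamma>, of 0] T_pos by fastforce
  show "integral {0..T} (lag \<gamma>) + G (\<gamma> T) (m T) \<le> T * (M + F_bd) + G (\<gamma> 0) (m T)"
    using le cost_cases(1)[OF \<gamma> _ i] T_pos by simp
qed

text \<open>Following \<gamma> up to time a and the competitor afterwards is admissible from the
  start, and the common cost on [0, a] cancels. A competitor whose running cost is not integrable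
  costs infinity.\<close>

lemma optimal_tail:
  assumes opt: "optimal \<gamma>" and a: "a \<in> {0..T}" and \<sigma>: "\<sigma> \<in> Gamma_at \<Omega> T a (\<gamma> a)"
  shows "cost L F G T m a \<gamma> \<le> cost L F G T m a \<sigma>"
proof (cases "lag \<sigma> absolutely_integrable_on {a..T}")
  case True
  have \<gamma>: "\<gamma> \<in> Gamma \<Omega> T" using opt by (simp add: optimal_def)
  have \<sigma>': "\<sigma> \<in> Gamma \<Omega> T" "\<sigma> a = \<gamma> a" using \<sigma> by (auto simp: Gamma_at_def)
  obtain d where d: "d \<in> Gamma \<Omega> T" "\<And>s. s \<in> {0..a} \<Longrightarrow> apply_bcontfun d s = \<gamma> s"
    "\<And>s. s \<in> {a..T} \<Longrightarrow> apply_bcontfun d s = \<sigma> s"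
    by (rule Gamma_join[OF \<gamma> \<sigma>'(1) a \<sigma>'(2)[symmetric]]) (rule that)
  have i\<gamma>: "lag \<gamma> absolutely_integrable_on {0..T}" by (rule optimal_integrable(1)[OF opt])
  have i\<gamma>1: "lag \<gamma> absolutely_integrable_on {0..a}" and i\<gamma>2: "lag \<gamma> absolutely_integrable_on {a..T}"
    using absolutely_integrable_on_subinterval[OF i\<gamma>] a by auto
  have id1: "lag d absolutely_integrable_on {0..a}" "integral {0..a} (lag d) = integral {0..a} (lag \<gamma>)"
    using lag_eq_on_interval[of 0 a d \<gamma>] d(2) i\<gamma>1 by auto
  have id2: "lag d absolutely_integrable_on {a..T}" "integral {a..T} (lag d) = integral {a..T} (lag \<sigma>)"
    using lag_eq_on_interval[of a T d \<sigma>] d(3) True by auto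
  have a': "0 \<le> a" "a \<le> T" using a by auto
  have "d \<in> Gamma_at \<Omega> T 0 (\<gamma> 0)" using d a' by (auto simp: Gamma_at_def)
  then have "cost L F G T m 0 \<gamma> \<le> cost L F G T m 0 d" using opt by (simp add: optimal_def)
  then have "integral {0..T} (lag \<gamma>) + G (\<gamma> T) (m T) \<le> integral {0..T} (lag d) + G (d T) (m T)"
    using cost_cases(1)[OF \<gamma> _ i\<gamma>] cost_cases(1)[OF d(1) _ absolutely_integrable_combine(1)[OF a' id1(1) id2(1)]] T_pos by simp
  then have "integral {a..T} (lag \<gamma>) + G (\<gamma> T) (m T) \<le> integral {a..T} (lag \<sigma>) + G (\<sigma> T) (m T)"
    using absolutely_integrable_combine(2)[OF a' i\<gamma>1 i\<gamma>2] absolutely_integrable_combine(2)[OF a' id1(1) id2(1)]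
      id1 id2 d(3)[of T] a' by simp
  then show ?thesis
    using cost_cases(1)[OF \<gamma> a i\<gamma>2] cost_cases(1)[OF \<sigma>'(1) a True] by simp
next
  case False
  then show ?thesis using cost_cases(2)[OF _ a False] \<sigma> by (simp add: Gamma_at_def)
qed

text \<open>The arc p, continued by \<gamma> from b on, competes with the tail of \<gamma> from a,
  and the common cost on [b, T] cancels.\<close>

lemma optimal_segment:
  assumes opt: "optimal \<gamma>" and ab: "0 \<le> a" "a < b" "b \<le> T" and d: "\<And>s. (p has_vector_derivative p' s) (at s)"
    and c': "continuous_on UNIV p'" and cl: "\<And>s. s \<in> {a..b} \<Longrightarrow> p s \<in> closure \<Omega>"
    and ends: "p a = \<gamma> a" "p b = \<gamma> b"
  shows "integral {a..b} (lag \<gamma>) \<le> integral {a..b} (\<lambda>s. L (p s) (p' s) + F (p s) (m s))"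
proof -
  have \<gamma>: "\<gamma> \<in> Gamma \<Omega> T" using opt by (simp add: optimal_def)
  obtain c where c: "c \<in> Gamma \<Omega> T" "\<And>s. s \<in> {a..b} \<Longrightarrow> apply_bcontfun c s = p s"
    "lag c absolutely_integrable_on {a..b}"
    "integral {a..b} (lag c) = integral {a..b} (\<lambda>s. L (p s) (p' s) + F (p s) (m s))"
    by (rule smooth_curve[OF ab d c' cl]) (use that in auto)
  have cb: "apply_bcontfun c b = \<gamma> b" and ca: "apply_bcontfun c a = \<gamma> a" using c(2) ends ab by auto
  have b: "b \<in> {0..T}" and a: "a \<in> {0..T}" using ab by auto
  obtain \<sigma> where \<sigma>: "\<sigma> \<in> Gamma \<Omega> T" "\<And>s. s \<in> {0..b} \<Longrightarrow> apply_bcontfun \<sigma> s = c s"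
    "\<And>s. s \<in> {b..T} \<Longrightarrow> apply_bcontfun \<sigma> s = \<gamma> s"
    by (rule Gamma_join[OF c(1) \<gamma> b cb]) (rule that)
  have i\<gamma>: "lag \<gamma> absolutely_integrable_on {0..T}" by (rule optimal_integrable(1)[OF opt])
  have i1: "lag \<gamma> absolutely_integrable_on {a..b}" and i2: "lag \<gamma> absolutely_integrable_on {b..T}"
    and i3: "lag \<gamma> absolutely_integrable_on {a..T}"
    using absolutely_integrable_on_subinterval[OF i\<gamma>] ab by auto
  have s1: "lag \<sigma> absolutely_integrable_on {a..b}" "integral {a..b} (lag \<sigma>) = integral {a..b} (lag c)"
    using lag_eq_on_interval[of a b \<sigma> c] \<sigma>(2) c(3) ab by auto
  have s2: "lag \<sigma> absolutely_integrable_on {b..T}" "integral {b..T} (lag \<sigma>) = integral {b..T} (lag \<gamma>)"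
    using lag_eq_on_interval[of b T \<sigma> \<gamma>] \<sigma>(3) i2 ab by auto
  have abl: "a \<le> b" "b \<le> T" using ab by auto
  have "\<sigma> \<in> Gamma_at \<Omega> T a (\<gamma> a)" using \<sigma>(1) \<sigma>(2)[of a] ca ab by (auto simp: Gamma_at_def)
  from optimal_tail[OF opt a this]
  have "integral {a..T} (lag \<gamma>) + G (\<gamma> T) (m T) \<le> integral {a..T} (lag \<sigma>) + G (\<sigma> T) (m T)"
    using cost_cases(1)[OF \<gamma> a i3] cost_cases(1)[OF \<sigma>(1) a absolutely_integrable_combine(1)[OF abl s1(1) s2(1)]] by simp
  then show ?thesis
    using absolutely_integrable_combine(2)[OF abl i1 i2] absolutely_integrable_combine(2)[OF abl s1(1) s2(1)]
      s1 s2 c(4) \<sigma>(3)[of T] ab by simp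
qed

end

section \<open>Dynamic programming inequalities\<close>

locale mfg_value = mfg_data +
  fixes u :: "real \<Rightarrow> 'a \<Rightarrow> real"
  assumes u_value: "\<And>t x. t \<in> {0..T} \<Longrightarrow> x \<in> closure \<Omega> \<Longrightarrow>
      ereal (u t x) = (INF \<gamma>\<in>Gamma_at \<Omega> T t x. cost L F G T m t \<gamma>)"
begin

text \<open>The tail of \<gamma> from a realises the infimum defining \<open>u a\<close>, whereas
  the tail from b is merely one candidate for \<open>u b\<close>; the difference of the two costs is
  the integral over [a, b].\<close>

lemma value_along_optimal:
  assumes opt: "optimal \<gamma>" and ab: "0 \<le> a" "a \<le> b" "b \<le> T"
  shows "integral {a..b} (lag \<gamma>) + u b (\<gamma> b) \<le> u a (\<gamma> a)"
proof -
  have \<gamma>: "\<gamma> \<in> Gamma \<Omega> T" using opt by (simp add: optimal_def)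
  have a: "a \<in> {0..T}" and b: "b \<in> {0..T}" using ab by auto
  have i\<gamma>: "lag \<gamma> absolutely_integrable_on {0..T}" by (rule optimal_integrable(1)[OF opt])
  have i1: "lag \<gamma> absolutely_integrable_on {a..b}" and i2: "lag \<gamma> absolutely_integrable_on {b..T}"
    and i3: "lag \<gamma> absolutely_integrable_on {a..T}"
    using absolutely_integrable_on_subinterval[OF i\<gamma>] ab by auto
  have "cost L F G T m a \<gamma> \<le> ereal (u a (\<gamma> a))"
    unfolding u_value[OF a Gamma_closure[OF \<gamma> a]]
    by (rule INF_greatest) (rule optimal_tail[OF opt a])
  moreover have "ereal (u b (\<gamma> b)) \<le> cost L F G T m b \<gamma>"
    unfolding u_value[OF b Gamma_closure[OF \<gamma> b]]
    by (rule INF_lower) (use \<gamma> in \<open>simp add: Gamma_at_def\<close>)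
  ultimately show ?thesis
    using cost_cases(1)[OF \<gamma> a i3] cost_cases(1)[OF \<gamma> b i2]
      absolutely_integrable_combine(2)[OF ab(2,3) i1 i2] by simp
qed

lemma value_le_curve:
  assumes ab: "0 \<le> a" "a < b" "b \<le> T" and d: "\<And>s. (p has_vector_derivative p' s) (at s)"
    and c': "continuous_on UNIV p'" and cl: "\<And>s. s \<in> {a..b} \<Longrightarrow> p s \<in> closure \<Omega>"
  shows "u a (p a) \<le> integral {a..b} (\<lambda>s. L (p s) (p' s) + F (p s) (m s)) + u b (p b)"
proof -
  let ?I = "integral {a..b} (\<lambda>s. L (p s) (p' s) + F (p s) (m s))"
  obtain c where c: "c \<in> Gamma \<Omega> T" "\<And>s. s \<in> {a..b} \<Longrightarrow> apply_bcontfun c s = p s"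
    "lag c absolutely_integrable_on {a..b}" "integral {a..b} (lag c) = ?I"
    by (rule smooth_curve[OF ab d c' cl]) (use that in auto)
  have b: "b \<in> {0..T}" and a: "a \<in> {0..T}" and abl: "a \<le> b" "b \<le> T" using ab by auto
  have pcl: "p a \<in> closure \<Omega>" "p b \<in> closure \<Omega>" using cl ab by auto
  \<comment> \<open>Moving the cost of the arc to the left leaves a bare infimum on the right, so
    one competitor from b can be treated at a time.\<close>
  have "ereal (u a (p a) - ?I) \<le> ereal (u b (p b))"
    unfolding u_value[OF b pcl(2)]
  proof (rule INF_greatest)
    fix \<sigma> assume \<sigma>: "\<sigma> \<in> Gamma_at \<Omega> T b (p b)"
    then have \<sigma>': "\<sigma> \<in> Gamma \<Omega> T" "\<sigma> b = p b" by (auto simp: Gamma_at_def)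
    show "ereal (u a (p a) - ?I) \<le> cost L F G T m b \<sigma>"
    proof (cases "lag \<sigma> absolutely_integrable_on {b..T}")
      case True
      have "apply_bcontfun c b = \<sigma> b" using c(2)[of b] ab \<sigma>' by simp
      then obtain d where d: "d \<in> Gamma \<Omega> T" "\<And>s. s \<in> {0..b} \<Longrightarrow> apply_bcontfun d s = c s"
        "\<And>s. s \<in> {b..T} \<Longrightarrow> apply_bcontfun d s = \<sigma> s"
        by (rule Gamma_join[OF c(1) \<sigma>'(1) b]) (rule that)
      have d1: "lag d absolutely_integrable_on {a..b}" "integral {a..b} (lag d) = ?I"
        using lag_eq_on_interval[of a b d c] d(2) c(3,4) ab by auto
      have d2: "lag d absolutely_integrable_on {b..T}" "integral {b..T} (lag d) = integral {b..T} (lag \<sigma>)"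
        using lag_eq_on_interval[of b T d \<sigma>] d(3) True ab by auto
      have "d \<in> Gamma_at \<Omega> T a (p a)" using d(1) d(2)[of a] c(2)[of a] ab by (simp add: Gamma_at_def)
      then have "ereal (u a (p a)) \<le> cost L F G T m a d"
        unfolding u_value[OF a pcl(1)] by (rule INF_lower)
      then show ?thesis
        using cost_cases(1)[OF d(1) a absolutely_integrable_combine(1)[OF abl d1(1) d2(1)]]
          absolutely_integrable_combine(2)[OF abl d1(1) d2(1)] d1(2) d2(2) d(3)[of T] ab
          cost_cases(1)[OF \<sigma>'(1) b True] by simp
    next
      case False
      then show ?thesis using cost_cases(2)[OF \<sigma>'(1) b False] by simp
    qed
  qed
  then show ?thesis by simp
qed

end

section \<open>Optimal curves through points of the support\<close>

text \<open>A countable partition of the carrier into sets of small diameter, at every scale, replaces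
  separability: the points of the carrier outside the support lie in countably many null balls.\<close>
lemma msupport_meets_open:
  fixes \<eta> :: "'b::metric_space measure" and code :: "nat \<Rightarrow> 'b \<Rightarrow> nat"
  assumes sets: "sets \<eta> = sets borel" and full: "emeasure \<eta> (- C) = 0" "C \<in> sets borel"
    and code: "\<And>n x y. x \<in> C \<Longrightarrow> y \<in> C \<Longrightarrow> code n x = code n y \<Longrightarrow> dist x y < 1 / real (Suc n)"
    and A: "open A" "emeasure \<eta> A > 0"
  shows "msupport \<eta> \<inter> A \<noteq> {}"
proof
  assume empty: "msupport \<eta> \<inter> A = {}"
  define I where "I = {(n, c). \<exists>x\<in>C. code n x = c \<and> emeasure \<eta> (ball x (1 / real (Suc n))) = 0}"
  \<comment> \<open>One centre of a null ball for each scale and code. Every other point of C with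
    that code lies within the radius of the centre, so these countably many balls suffice.\<close>
  define pick where "pick = (\<lambda>(n, c). SOME x. x \<in> C \<and> code n x = c \<and> emeasure \<eta> (ball x (1 / real (Suc n))) = 0)"
  define B where "B = (\<lambda>(n, c). ball (pick (n, c)) (1 / real (Suc n)))"
  have pick: "pick (n, c) \<in> C \<and> code n (pick (n, c)) = c \<and> emeasure \<eta> (ball (pick (n, c)) (1 / real (Suc n))) = 0"
    if "(n, c) \<in> I" for n c
    using that someI_ex[of "\<lambda>x. x \<in> C \<and> code n x = c \<and> emeasure \<eta> (ball x (1 / real (Suc n))) = 0"]
    unfolding I_def pick_def by auto
  have n1: "(\<Union>i\<in>I. B i) \<in> null_sets \<eta>"
  proof (rule null_sets_UN')
    show "B i \<in> null_sets \<eta>" if "i \<in> I" for i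
      using pick[of "fst i" "snd i"] that sets by (cases i) (auto simp: B_def null_sets_def)
  qed (rule countableI_type)
  have n2: "- C \<in> null_sets \<eta>" using full sets by (auto simp: null_sets_def)
  have sub: "A \<subseteq> (\<Union>i\<in>I. B i) \<union> - C"
  proof
    fix x assume x: "x \<in> A"
    show "x \<in> (\<Union>i\<in>I. B i) \<union> - C"
    proof (cases "x \<in> C")
      case True
      have "x \<notin> msupport \<eta>" using x empty by blast
      then obtain S where S: "open S" "x \<in> S" "emeasure \<eta> S = 0"
        unfolding msupport_def by (auto simp: zero_less_iff_neq_zero)
      then obtain e where "e > 0" "ball x e \<subseteq> S" using openE by blast
      moreover obtain n where "1 / real (Suc n) < e"
        using \<open>e > 0\<close> reals_Archimedean by (metis inverse_eq_divide)
      ultimately have "ball x (1 / real (Suc n)) \<subseteq> S" by (meson order_trans subset_ball less_imp_le)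
      then have "emeasure \<eta> (ball x (1 / real (Suc n))) \<le> emeasure \<eta> S"
        using S sets by (intro emeasure_mono) auto
      then have I: "(n, code n x) \<in> I" using S True by (auto simp: I_def)
      have "dist (pick (n, code n x)) x < 1 / real (Suc n)"
        using pick[OF I] True by (intro code) auto
      then have "x \<in> B (n, code n x)" by (simp add: B_def)
      then show ?thesis using I by blast
    qed simp
  qed
  have "A \<in> null_sets \<eta>"
    by (rule null_sets_subset[OF null_sets.Un[OF n1 n2] _ sub]) (use A(1) sets in simp)
  then show False using A(2) by (auto simp: null_sets_def)
qed

text \<open>Separability of the path space in combinatorial form. Uniform continuity determines a
  mesh, and the values at the mesh points are rounded to a countable dense set; mesh size and the
  list of rounded values are packed into one number. The mesh depends on the path, so it has to be
  part of the code.\<close>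

lemma Cpaths_code:
  assumes "T > 0"
  obtains code :: "nat \<Rightarrow> (real \<Rightarrow>\<^sub>C 'a::euclidean_space) \<Rightarrow> nat"
  where "\<And>n x y. x \<in> Cpaths \<Omega> T \<Longrightarrow> y \<in> Cpaths \<Omega> T \<Longrightarrow> code n x = code n y \<Longrightarrow> dist x y < 1 / real (Suc n)"
proof -
  obtain D :: "'a set" where D: "countable D" "\<And>X. open X \<Longrightarrow> X \<noteq> {} \<Longrightarrow> \<exists>d\<in>D. d \<in> X"
    using countable_dense_exists by blast
  \<comment> \<open>Two oscillations between mesh points and two roundings cost up to
    \<open>4 * e n\<close>, half the permitted distance; the factor left over keeps the inequality
    strict after passing to the supremum.\<close>
  define e :: "nat \<Rightarrow> real" where "e n = 1 / (8 * Suc n)" for n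
  have e: "e n > 0" for n by (simp add: e_def)
  define good where "good n x k \<longleftrightarrow> k > 0 \<and>
      (\<forall>s\<in>{0..T}. \<forall>s'\<in>{0..T}. \<bar>s - s'\<bar> \<le> T / k \<longrightarrow> dist (apply_bcontfun x s) (apply_bcontfun x s') < e n)"
    for n and x :: "real \<Rightarrow>\<^sub>C 'a" and k :: nat
  define K where "K n x = (SOME k. good n x k)" for n x
  have good: "good n x (K n x)" for n x
  proof -
    have "uniformly_continuous_on {0..T} (apply_bcontfun x)"
      by (intro compact_uniformly_continuous) auto
    then obtain d where d: "d > 0" "\<And>s s'. s \<in> {0..T} \<Longrightarrow> s' \<in> {0..T} \<Longrightarrow> dist s' s < d \<Longrightarrow> dist (x s') (x s) < e n"
      using e[of n] unfolding uniformly_continuous_on_def by blast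
    obtain k :: nat where k: "T / d < k" using reals_Archimedean2 by blast
    moreover have "0 < T / d" using assms d(1) by simp
    ultimately have "real k > 0" by linarith
    then have "k > 0" by simp
    then have "T / k < d" using k d(1) by (simp add: field_simps)
    then have "good n x k" using d(2) \<open>k > 0\<close> by (auto simp: good_def dist_real_def abs_minus_commute)
    then show ?thesis unfolding K_def by (rule someI)
  qed
  define rnd where "rnd n y = (SOME i. dist (from_nat_into D i) y < e n)" for n and y :: 'a
  have rnd: "dist (from_nat_into D (rnd n y)) y < e n" for n y
  proof -
    obtain d where "d \<in> D" "d \<in> ball y (e n)" using D(2)[of "ball y (e n)"] e[of n] by (auto simp: not_le)
    moreover then obtain i where "from_nat_into D i = d"
      using from_nat_into_surj[OF D(1)] by metis
    ultimately have "dist (from_nat_into D i) y < e n" by (simp add: dist_commute)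
    then show ?thesis unfolding rnd_def by (rule someI)
  qed
  define code where "code n x = to_nat (K n x, map (\<lambda>i. rnd n (apply_bcontfun x (real i * T / real (K n x)))) [0..<Suc (K n x)])" for n x
  show ?thesis
  proof (rule that[of code])
    fix n and x y :: "real \<Rightarrow>\<^sub>C 'a"
    assume x: "x \<in> Cpaths \<Omega> T" and y: "y \<in> Cpaths \<Omega> T" and eq: "code n x = code n y"
    define k where "k = K n x"
    have k: "K n y = k" and r: "\<And>i. i \<le> k \<Longrightarrow> rnd n (x (real i * T / k)) = rnd n (y (real i * T / k))"
      using eq by (auto simp: code_def k_def simp del: upt_Suc)
    have gx: "good n x k" and gy: "good n y k" using good[of n x] good[of n y] k by (auto simp: k_def)
    then have "k > 0" by (simp add: good_def)
    have close: "dist (x s) (y s) \<le> 4 * e n" if s: "s \<in> {0..T}" for s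
    proof -
      define i where "i = nat \<lfloor>s * k / T\<rfloor>"
      have "0 \<le> s * k / T" using s assms by simp
      then have "real i \<le> s * k / T" "s * k / T < real i + 1" unfolding i_def by linarith+
      then have i: "real i * T / k \<le> s" "s \<le> real i * T / k + T / k"
        using \<open>k > 0\<close> assms by (auto simp: field_simps)
      have "s * k / T \<le> k" using s assms \<open>k > 0\<close> by (simp add: field_simps)
      then have "i \<le> k" unfolding i_def by linarith
      let ?s = "real i * T / k"
      have s': "?s \<in> {0..T}" using i(1) s assms by auto
      have "\<bar>s - ?s\<bar> \<le> T / k" using i by auto
      then have "dist (x s) (x ?s) < e n" "dist (y s) (y ?s) < e n"
        using gx gy s s' unfolding good_def by blast+
      moreover have "dist (x ?s) (y ?s) < 2 * e n"
        using rnd[of n "x ?s"] rnd[of n "y ?s", folded r[OF \<open>i \<le> k\<close>]]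
          dist_triangle3[of "x ?s" "y ?s" "from_nat_into D (rnd n (x ?s))"] by linarith
      ultimately show ?thesis
        using dist_triangle[of "x s" "y s" "x ?s"] dist_triangle[of "x ?s" "y s" "y ?s"] dist_commute[of "y s" "y ?s"] by linarith
    qed
    have "dist (x s) (y s) \<le> 4 * e n" for s
    proof -
      have "x s = x (max 0 (min T s))" "y s = y (max 0 (min T s))" using x y by (auto simp: Cpaths_def)
      moreover have "max 0 (min T s) \<in> {0..T}" using assms by auto
      ultimately show ?thesis using close by metis
    qed
    then have "dist x y \<le> 4 * e n" by (rule dist_bound)
    also have "\<dots> < 1 / real (Suc n)" by (simp add: e_def field_simps)
    finally show "dist x y < 1 / real (Suc n)" .
  qed
qed

lemma closed_msupport:
  assumes "f \<longlonglongrightarrow> l" "\<And>n. f n \<in> msupport \<eta>"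
  shows "l \<in> msupport \<eta>"
  unfolding msupport_def
proof (intro CollectI allI impI)
  fix S assume S: "open S \<and> l \<in> S"
  then have "eventually (\<lambda>n. f n \<in> S) sequentially" using assms(1) topological_tendstoD by blast
  then obtain n where "f n \<in> S" using eventually_happens'[OF sequentially_bot] by blast
  then show "emeasure \<eta> S > 0" using assms(2)[of n] S by (auto simp: msupport_def)
qed

text \<open>Arzela-Ascoli on [0, T]; since paths are constant outside, uniform convergence there is
  convergence in the sup metric on the line.\<close>

lemma Cpaths_uniform_limit:
  fixes f :: "nat \<Rightarrow> real \<Rightarrow>\<^sub>C 'a::euclidean_space"
  assumes T: "T > 0" and f: "\<And>n. f n \<in> Cpaths \<Omega> T" and bdd: "bounded \<Omega>"
    and equi: "\<And>e. e > 0 \<Longrightarrow> \<exists>d>0. \<forall>n a b. a \<in> {0..T} \<and> b \<in> {0..T} \<and> \<bar>b - a\<bar> < d \<longrightarrow> norm (f n b - f n a) < e"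
  obtains l k where "strict_mono (k :: nat \<Rightarrow> nat)" "(\<lambda>n. f (k n)) \<longlonglongrightarrow> l"
proof -
  obtain B where B: "\<And>y. y \<in> closure \<Omega> \<Longrightarrow> norm y \<le> B"
    using bounded_closure[OF bdd] unfolding bounded_iff by blast
  obtain g k where gk: "continuous_on {0..T} g" "strict_mono (k :: nat \<Rightarrow> nat)"
    "\<And>e. 0 < e \<Longrightarrow> \<exists>N. \<forall>n x. n \<ge> N \<and> x \<in> {0..T} \<longrightarrow> norm (f (k n) x - g x) < e"
  proof (rule Arzela_Ascoli[of "{0..T}" "\<lambda>n. apply_bcontfun (f n)" B])
    show "norm (f n x) \<le> B" if "x \<in> {0..T}" for n x
      using f[of n] that by (intro B) (auto simp: Cpaths_def)
    show "\<exists>d>0. \<forall>n y. y \<in> {0..T} \<and> norm (x - y) < d \<longrightarrow> norm (f n x - f n y) < e"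
      if x: "x \<in> {0..T}" and e: "0 < e" for x e
    proof -
      obtain d where "d > 0" "\<And>n a b. a \<in> {0..T} \<Longrightarrow> b \<in> {0..T} \<Longrightarrow> \<bar>b - a\<bar> < d \<Longrightarrow> norm (f n b - f n a) < e"
        using equi[OF e] by blast
      then show ?thesis using x by (intro exI[of _ d]) auto
    qed
  qed (use that in auto)
  have "uniform_limit UNIV (\<lambda>n. apply_bcontfun (f (k n))) (\<lambda>s. g (max 0 (min T s))) sequentially"
  proof (rule uniform_limitI)
    fix e :: real assume "e > 0"
    then obtain N where N: "\<And>n x. n \<ge> N \<Longrightarrow> x \<in> {0..T} \<Longrightarrow> norm (f (k n) x - g x) < e"
      using gk(3) by blast
    have "dist (f (k n) s) (g (max 0 (min T s))) < e" if "n \<ge> N" for n s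
    proof -
      have "f (k n) s = f (k n) (max 0 (min T s))" using f[of "k n"] by (auto simp: Cpaths_def)
      moreover have "max 0 (min T s) \<in> {0..T}" using T by auto
      ultimately show ?thesis using N[OF that] by (metis dist_norm)
    qed
    then show "\<forall>\<^sub>F n in sequentially. \<forall>x\<in>UNIV. dist (f (k n) x) (g (max 0 (min T x))) < e"
      unfolding eventually_sequentially by blast
  qed
  then obtain l where "(\<lambda>n. f (k n)) \<longlonglongrightarrow> l"
    by (rule uniform_limit_bcontfunE) auto
  then show ?thesis using that gk(2) by blast
qed

section \<open>Energy bound and compactness of optimal curves\<close>

context mfg_data
begin

lemma G_bounded_ex: "\<exists>B. \<forall>y\<in>U. \<bar>G y (m T)\<bar> \<le> B"
proof -
  have "m T \<in> Prob_on (closure \<Omega>)" using m_prob T_pos by auto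
  from D2[rule_format, OF this] have "bounded ((\<lambda>z. G z (m T)) ` U)" by blast
  then show ?thesis unfolding bounded_iff by auto
qed

definition G_bd :: real where "G_bd = (SOME B. \<forall>y\<in>U. \<bar>G y (m T)\<bar> \<le> B)"

lemma G_bd: "y \<in> U \<Longrightarrow> \<bar>G y (m T)\<bar> \<le> G_bd"
  using someI_ex[OF G_bounded_ex] unfolding G_bd_def by blast

text \<open>\<open>L_coercive\<close> solved for the squared velocity and integrated, with the cost
  of the resting curve inserted as upper bound. The two \<open>G_bd\<close> account for the terminal
  costs of the curve and of its resting competitor.\<close>

definition energy_bd :: real where
  "energy_bd = 4 * c_mu * (T * (M + F_bd) + 2 * G_bd + T * (C0 + F_bd))"

text \<open>From here on velocities are represented by a density and integrals are gauge integrals.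
  Coercivity dominates the squared density by the integrable running cost, which gives an energy
  bound independent of the curve.\<close>

lemma optimal_density:
  assumes opt: "optimal \<gamma>"
  obtains g where
    "\<And>a b. a \<le> b \<Longrightarrow> (g has_integral (apply_bcontfun \<gamma> b - apply_bcontfun \<gamma> a)) {a..b}"
    "(\<lambda>s. (norm (g s))\<^sup>2) integrable_on {0..T}"
    "integral {0..T} (\<lambda>s. (norm (g s))\<^sup>2) \<le> energy_bd"
    "(\<lambda>s. L (apply_bcontfun \<gamma> s) (g s) + F (apply_bcontfun \<gamma> s) (m s)) integrable_on {0..T}"
    "\<And>a b. integral {a..b} (lag \<gamma>) =
       integral {a..b} (\<lambda>s. L (apply_bcontfun \<gamma> s) (g s) + F (apply_bcontfun \<gamma> s) (m s))"
proof -
  have \<gamma>: "\<gamma> \<in> Gamma \<Omega> T" using opt by (simp add: optimal_def)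
  obtain g where g: "g \<in> borel_measurable borel" "integrable lborel g"
    "\<And>x y. x \<le> y \<Longrightarrow> \<gamma> y - \<gamma> x = (LINT s:{x..y}|lborel. g s)"
    "AE s in lebesgue. lag \<gamma> s = L (\<gamma> s) (g s) + F (\<gamma> s) (m s)"
    by (rule Gamma_density[OF \<gamma>]) (rule that)
  let ?f = "\<lambda>s. L (\<gamma> s) (g s) + F (\<gamma> s) (m s)"
  have 1: "(g has_integral (\<gamma> b - \<gamma> a)) {a..b}" if "a \<le> b" for a b
  proof -
    have "set_integrable lborel {a..b} g"
      unfolding set_integrable_def using g(2) by (intro integrable_mult_indicator) auto
    from set_borel_integral_eq_integral[OF this] show ?thesis
      using g(3)[OF that] integrable_integral by fastforce
  qed
  obtain N where N: "negligible N" "\<And>s. s \<notin> N \<Longrightarrow> lag \<gamma> s = ?f s"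
    using g(4) unfolding completion.AE_iff_null_sets by (auto simp: negligible_iff_null_sets)
  have i: "?f absolutely_integrable_on {0..T}"
    by (rule absolutely_integrable_spike[OF optimal_integrable(1)[OF opt] N(1)]) (use N(2) in auto)
  then have i': "?f integrable_on {0..T}" by (simp add: absolutely_integrable_on_def)
  have eq: "integral {a..b} (lag \<gamma>) = integral {a..b} ?f" for a b
    by (rule integral_spike[OF N(1)]) (use N(2) in auto)
  have le: "(norm (g s))\<^sup>2 \<le> 4 * c_mu * (?f s + (C0 + F_bd))" if s: "s \<in> {0..T}" for s
  proof -
    have "(norm (g s))\<^sup>2 / (4 * c_mu) \<le> ?f s + (C0 + F_bd)"
      using L_coercive[OF Gamma_U[OF \<gamma> s], of "g s"] F_bd(2)[OF s Gamma_closure[OF \<gamma> s]] by linarith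
    then show ?thesis using L1_mu by (simp add: field_simps)
  qed
  have bi: "(\<lambda>s. 4 * c_mu * (?f s + (C0 + F_bd))) integrable_on {0..T}"
    using integrable_add[OF i' integrable_const_ivl[of "C0 + F_bd" 0 T]] by (intro integrable_on_mult_right) simp
  have 2: "(\<lambda>s. (norm (g s))\<^sup>2) integrable_on {0..T}"
  proof (rule measurable_bounded_by_integrable_imp_integrable[OF _ bi])
    have "(\<lambda>s. (norm (g s))\<^sup>2) \<in> borel_measurable lebesgue"
      by (intro measurable_completion) (use g(1) in measurable)
    then show "(\<lambda>s. (norm (g s))\<^sup>2) \<in> borel_measurable (lebesgue_on {0..T})"
      by (rule measurable_restrict_space1)
  qed (use le in auto)
  have "integral {0..T} (\<lambda>s. (norm (g s))\<^sup>2) \<le> integral {0..T} (\<lambda>s. 4 * c_mu * (?f s + (C0 + F_bd)))"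
    by (rule integral_le[OF 2 bi]) (use le in auto)
  also have "\<dots> = 4 * c_mu * (integral {0..T} ?f + T * (C0 + F_bd))"
    using Henstock_Kurzweil_Integration.integral_add[OF i' integrable_const_ivl[of "C0 + F_bd" 0 T]] T_pos by simp
  also have "\<dots> \<le> energy_bd"
    unfolding energy_bd_def
  proof (rule mult_left_mono)
    have "\<bar>G (\<gamma> T) (m T)\<bar> \<le> G_bd" "\<bar>G (\<gamma> 0) (m T)\<bar> \<le> G_bd"
      using G_bd Gamma_U[OF \<gamma>] T_pos by auto
    then show "integral {0..T} ?f + T * (C0 + F_bd) \<le> T * (M + F_bd) + 2 * G_bd + T * (C0 + F_bd)"
      using optimal_integrable(2)[OF opt] eq[of 0 T] by linarith
  qed (use L1_mu in simp)
  finally have 3: "integral {0..T} (\<lambda>s. (norm (g s))\<^sup>2) \<le> energy_bd" .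
  show ?thesis by (rule that[OF 1 2 3 i' eq])
qed

text \<open>The role of Cauchy-Schwarz is played by a pointwise Young inequality, which bounds the
  speed by a small multiple of its square plus a constant.\<close>

lemma optimal_equicontinuous:
  assumes "e > 0"
  obtains d where "d > 0"
    "\<And>\<gamma> a b. optimal \<gamma> \<Longrightarrow> a \<in> {0..T} \<Longrightarrow> b \<in> {0..T} \<Longrightarrow> \<bar>b - a\<bar> < d \<Longrightarrow>
       norm (apply_bcontfun \<gamma> b - apply_bcontfun \<gamma> a) < e"
proof -
  define E where "E = \<bar>energy_bd\<bar> + 1"
  have "E > 0" "energy_bd \<le> E" by (auto simp: E_def)
  \<comment> \<open>With this weight the energy term contributes exactly e/2, and b - a < k e makes
    the constant term smaller than e/2.\<close>
  define k where "k = e / E"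
  have "k > 0" using \<open>E > 0\<close> assms by (simp add: k_def)
  have main: "norm (\<gamma> b - \<gamma> a) < e" if opt: "optimal \<gamma>" and ab: "0 \<le> a" "a \<le> b" "b \<le> T" "b - a < k * e" for \<gamma> a b
  proof -
    obtain g where g:
      "\<And>a b. a \<le> b \<Longrightarrow> (g has_integral (apply_bcontfun \<gamma> b - apply_bcontfun \<gamma> a)) {a..b}"
      "(\<lambda>s. (norm (g s))\<^sup>2) integrable_on {0..T}"
      "integral {0..T} (\<lambda>s. (norm (g s))\<^sup>2) \<le> energy_bd"
      by (rule optimal_density[OF opt]) (rule that)
    have gi: "(\<lambda>s. (norm (g s))\<^sup>2) integrable_on {a..b}"
      by (rule integrable_on_subinterval[OF g(2)]) (use ab in auto)
    have hi: "((\<lambda>s. k / 2 * (norm (g s))\<^sup>2 + 1 / (2 * k)) has_integral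
        (k / 2 * integral {a..b} (\<lambda>s. (norm (g s))\<^sup>2) + (b - a) * (1 / (2 * k)))) {a..b}"
      using has_integral_add[OF has_integral_mult_right[OF integrable_integral[OF gi], of "k / 2"]
          has_integral_const_real[of "1 / (2 * k)" a b]] ab by simp
    have "norm (integral {a..b} g) \<le> integral {a..b} (\<lambda>s. k / 2 * (norm (g s))\<^sup>2 + 1 / (2 * k))"
    proof (rule Henstock_Kurzweil_Integration.integral_norm_bound_integral)
      show "g integrable_on {a..b}" using g(1)[OF ab(2)] by blast
      show "(\<lambda>s. k / 2 * (norm (g s))\<^sup>2 + 1 / (2 * k)) integrable_on {a..b}" using hi by blast
      show "norm (g s) \<le> k / 2 * (norm (g s))\<^sup>2 + 1 / (2 * k)" for s
      proof -
        have "0 \<le> (k * norm (g s) - 1)\<^sup>2 / (2 * k)" using \<open>k > 0\<close> by simp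
        also have "\<dots> = k / 2 * (norm (g s))\<^sup>2 + 1 / (2 * k) - norm (g s)"
          using \<open>k > 0\<close> by (simp add: power2_eq_square field_simps)
        finally show ?thesis by simp
      qed
    qed
    then have "norm (\<gamma> b - \<gamma> a) \<le> k / 2 * integral {a..b} (\<lambda>s. (norm (g s))\<^sup>2) + (b - a) * (1 / (2 * k))"
      using integral_unique[OF hi] integral_unique[OF g(1)[OF ab(2)]] by simp
    moreover have "integral {a..b} (\<lambda>s. (norm (g s))\<^sup>2) \<le> E"
    proof -
      have "integral {a..b} (\<lambda>s. (norm (g s))\<^sup>2) \<le> integral {0..T} (\<lambda>s. (norm (g s))\<^sup>2)"
        by (rule integral_subset_le[OF _ gi g(2)]) (use ab in auto)
      then show ?thesis using g(3) \<open>energy_bd \<le> E\<close> by linarith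
    qed
    then have "k / 2 * integral {a..b} (\<lambda>s. (norm (g s))\<^sup>2) \<le> k / 2 * E"
      using \<open>k > 0\<close> by (intro mult_left_mono) auto
    moreover have "k / 2 * E = e / 2" using \<open>E > 0\<close> by (simp add: k_def)
    moreover have "(b - a) * (1 / (2 * k)) < e / 2" using ab(4) \<open>k > 0\<close> by (simp add: field_simps)
    ultimately show ?thesis by linarith
  qed
  show ?thesis
  proof (rule that[of "k * e"])
    show "k * e > 0" using \<open>k > 0\<close> assms by simp
    show "norm (\<gamma> b - \<gamma> a) < e" if "optimal \<gamma>" "a \<in> {0..T}" "b \<in> {0..T}" "\<bar>b - a\<bar> < k * e" for \<gamma> a b
      using main[of \<gamma> a b] main[of \<gamma> b a] that by (cases "a \<le> b") (auto simp: norm_minus_commute)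
  qed
qed

text \<open>The cost sees the flow on [0, T] only, where \<open>m\<close> and the evaluation flow
  agree.\<close>

lemma equilibrium_optimal:
  assumes eq: "constrained_equilibrium \<Omega> T L F G m0 \<eta>" and m: "\<And>s. s \<in> {0..T} \<Longrightarrow> m s = eval_flow \<eta> s"
    and \<gamma>: "\<gamma> \<in> msupport \<eta>"
  shows "optimal \<gamma>"
proof -
  obtain x where x: "\<gamma> \<in> Gamma_at \<Omega> T 0 x"
    "\<And>\<gamma>'. \<gamma>' \<in> Gamma_at \<Omega> T 0 x \<Longrightarrow> cost L F G T (eval_flow \<eta>) 0 \<gamma> \<le> cost L F G T (eval_flow \<eta>) 0 \<gamma>'"
    using eq \<gamma> unfolding constrained_equilibrium_def optimal_curves_def by blast
  have "cost L F G T (eval_flow \<eta>) 0 \<gamma>' = cost L F G T m 0 \<gamma>'" for \<gamma>'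
  proof -
    have "ext_integral {0..T} (\<lambda>s. L (\<gamma>' s) (vector_derivative (apply_bcontfun \<gamma>') (at s)) + F (\<gamma>' s) (eval_flow \<eta> s))
      = ext_integral {0..T} (\<lambda>s. L (\<gamma>' s) (vector_derivative (apply_bcontfun \<gamma>') (at s)) + F (\<gamma>' s) (m s))"
      using m by (intro ext_integral_cong_AE AE_I2) auto
    then show ?thesis unfolding cost_def using m[of T] T_pos by simp
  qed
  then show ?thesis using x unfolding optimal_def by (auto simp: Gamma_at_def)
qed

text \<open>That x supports the image measure yields only supported curves passing ever closer to x
  at time t. They are optimal, hence equicontinuous, so a subsequence converges; its limit stays in
  the support, which is closed, and passes through x.\<close>

lemma optimal_curve_through:
  assumes eq: "constrained_equilibrium \<Omega> T L F G m0 \<eta>" and m: "\<And>s. s \<in> {0..T} \<Longrightarrow> m s = eval_flow \<eta> s"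
    and t: "t \<in> {0..T}" and x: "x \<in> msupport (m t)"
  obtains \<gamma> where "optimal \<gamma>" "apply_bcontfun \<gamma> t = x"
proof -
  have \<eta>: "prob_space \<eta>" "sets \<eta> = sets borel" "emeasure \<eta> (Cpaths \<Omega> T) = 1"
    using eq by (auto simp: constrained_equilibrium_def)
  interpret prob_space \<eta> by fact
  have sp: "space \<eta> = UNIV" using sets_eq_imp_space_eq[OF \<eta>(2)] by simp
  \<comment> \<open>Sets that are not measurable have \<open>emeasure\<close> 0 by convention, so
    the value 1 proves measurability.\<close>
  have Cm: "Cpaths \<Omega> T \<in> sets \<eta>" 
  proof (rule ccontr)
    assume "\<not> ?thesis"
    from emeasure_notin_sets[OF this] show False using \<eta>(3) by simp
  qed
  have "emeasure \<eta> (space \<eta> - Cpaths \<Omega> T) = emeasure \<eta> (space \<eta>) - emeasure \<eta> (Cpaths \<Omega> T)"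
    using Cm \<eta>(3) sets.sets_into_space[OF Cm] by (intro emeasure_Diff) auto
  then have Cn: "emeasure \<eta> (- Cpaths \<Omega> T) = 0" using \<eta>(3) emeasure_space_1 by (simp add: sp Compl_eq_Diff_UNIV)
  obtain code :: "nat \<Rightarrow> (real \<Rightarrow>\<^sub>C 'a) \<Rightarrow> nat" where code:
    "\<And>n x y. x \<in> Cpaths \<Omega> T \<Longrightarrow> y \<in> Cpaths \<Omega> T \<Longrightarrow> code n x = code n y \<Longrightarrow> dist x y < 1 / real (Suc n)"
    by (rule Cpaths_code[OF T_pos]) (rule that)
  have ev: "continuous_on UNIV (\<lambda>\<gamma>::real \<Rightarrow>\<^sub>C 'a. apply_bcontfun \<gamma> t)"
    unfolding continuous_on_iff using dist_fun_lt_imp_dist_val_lt by blast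
  have "\<exists>\<gamma>. \<gamma> \<in> msupport \<eta> \<and> dist (apply_bcontfun \<gamma> t) x < 1 / real (Suc n)" for n
  proof -
    let ?B = "ball x (1 / real (Suc n))" and ?A = "(\<lambda>\<gamma>::real \<Rightarrow>\<^sub>C 'a. apply_bcontfun \<gamma> t) -` ball x (1 / real (Suc n))"
    have "emeasure (m t) ?B > 0" using x by (simp add: msupport_def)
    moreover have "emeasure (m t) ?B = emeasure \<eta> ?A"
    proof -
      have "(\<lambda>\<gamma>. apply_bcontfun \<gamma> t) \<in> measurable \<eta> borel"
        using borel_measurable_continuous_onI[OF ev] measurable_cong_sets[OF \<eta>(2) refl] by blast
      then show ?thesis using m[OF t] by (simp add: eval_flow_def emeasure_distr sp)
    qed
    moreover have "open ?A" using ev by (simp add: continuous_on_open_vimage)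
    moreover have "Cpaths \<Omega> T \<in> sets borel" using Cm \<eta>(2) by simp
    ultimately have "msupport \<eta> \<inter> ?A \<noteq> {}"
      by (intro msupport_meets_open[OF \<eta>(2) Cn _ code, of code]) simp_all
    then show ?thesis by (auto simp: dist_commute)
  qed
  then obtain f where f: "\<And>n. f n \<in> msupport \<eta>" "\<And>n. dist (apply_bcontfun (f n) t) x < 1 / real (Suc n)" by metis
  have fo: "optimal (f n)" for n by (rule equilibrium_optimal[OF eq m f(1)])
  obtain l k where lk: "strict_mono (k :: nat \<Rightarrow> nat)" "(\<lambda>n. f (k n)) \<longlonglongrightarrow> l"
  proof (rule Cpaths_uniform_limit[OF T_pos _ bounded_Omega])
    show "f n \<in> Cpaths \<Omega> T" for n using fo[of n] by (simp add: optimal_def Gamma_def)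
    show "\<exists>d>0. \<forall>n a b. a \<in> {0..T} \<and> b \<in> {0..T} \<and> \<bar>b - a\<bar> < d \<longrightarrow> norm (f n b - f n a) < e" if "e > 0" for e
    proof -
      obtain d where "d > 0" "\<And>\<gamma> a b. optimal \<gamma> \<Longrightarrow> a \<in> {0..T} \<Longrightarrow> b \<in> {0..T} \<Longrightarrow> \<bar>b - a\<bar> < d \<Longrightarrow>
          norm (apply_bcontfun \<gamma> b - apply_bcontfun \<gamma> a) < e"
        by (rule optimal_equicontinuous[OF \<open>e > 0\<close>]) (rule that)
      then show ?thesis using fo by blast
    qed
  qed (rule that)
  have "l \<in> msupport \<eta>" by (rule closed_msupport[OF lk(2)]) (rule f(1))
  from equilibrium_optimal[OF eq m this] have "optimal l" .
  moreover have "apply_bcontfun l t = x"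
  proof -
    have "(\<lambda>n. apply_bcontfun (f (k n)) t) \<longlonglongrightarrow> apply_bcontfun l t"
      by (rule continuous_on_tendsto_compose[OF ev lk(2)]) auto
    moreover have "(\<lambda>n. apply_bcontfun (f n) t) \<longlonglongrightarrow> x"
    proof (rule metric_tendsto_imp_tendsto[of "\<lambda>n. 1 / real (Suc n)" 0])
      show "(\<lambda>n. 1 / real (Suc n)) \<longlonglongrightarrow> 0" using LIMSEQ_inverse_real_of_nat by (simp add: inverse_eq_divide)
      show "\<forall>\<^sub>F n in sequentially. dist (apply_bcontfun (f n) t) x \<le> dist (1 / real (Suc n)) 0"
        using f(2) by (intro always_eventually allI) (simp add: less_imp_le)
    qed
    then have "(\<lambda>n. apply_bcontfun (f (k n)) t) \<longlonglongrightarrow> x"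
      using LIMSEQ_subseq_LIMSEQ[OF _ lk(1), of "\<lambda>n. apply_bcontfun (f n) t" x] by (simp add: o_def)
    ultimately show ?thesis by (rule LIMSEQ_unique)
  qed
  ultimately show ?thesis using that by blast
qed

end

section \<open>Local geometry of the boundary\<close>

locale boundary_chart =
  fixes \<Omega> :: "'a::euclidean_space set" and x :: 'a and r :: real and \<psi> :: "'a \<Rightarrow> real" and g :: "'a \<Rightarrow> 'a"
  assumes chart: "local_defining_fn \<Omega> x r \<psi> g" and open_Omega: "open \<Omega>" and x_frontier: "x \<in> frontier \<Omega>"
begin

lemma r_pos: "r > 0" and psi_deriv: "y \<in> ball x r \<Longrightarrow> (\<psi> has_derivative (\<lambda>h. g y \<bullet> h)) (at y)"
  and g_nz: "y \<in> ball x r \<Longrightarrow> g y \<noteq> 0" and Omega_psi: "y \<in> ball x r \<Longrightarrow> y \<in> \<Omega> \<longleftrightarrow> \<psi> y < 0"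
  and g_cont: "y \<in> ball x r \<Longrightarrow> isCont g y"
  using chart has_derivative_continuous unfolding local_defining_fn_def C2_with_grad_def by blast+

lemma psi_cont: "y \<in> ball x r \<Longrightarrow> isCont \<psi> y"
  using psi_deriv has_derivative_continuous by blast

lemma psi_line_deriv:
  assumes "p + s *\<^sub>R d \<in> ball x r"
  shows "((\<lambda>s. \<psi> (p + s *\<^sub>R d)) has_real_derivative g (p + s *\<^sub>R d) \<bullet> d) (at s)"
proof -
  have 1: "((\<lambda>s. p + s *\<^sub>R d) has_derivative (\<lambda>h. h *\<^sub>R d)) (at s)"
    by (auto intro!: derivative_eq_intros)
  have "((\<lambda>s. \<psi> (p + s *\<^sub>R d)) has_derivative (\<lambda>h. g (p + s *\<^sub>R d) \<bullet> (h *\<^sub>R d))) (at s)"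
    by (rule has_derivative_compose[OF 1 psi_deriv[OF assms]])
  then show ?thesis unfolding has_field_derivative_def
    by (rule has_derivative_eq_rhs) (auto simp: fun_eq_iff)
qed

lemma psi_mvt:
  assumes "p \<in> ball x R" "p + d \<in> ball x R" "R \<le> r"
  obtains \<xi> where "\<xi> \<in> ball x R" "\<psi> (p + d) - \<psi> p = g \<xi> \<bullet> d"
proof -
  have seg: "p + s *\<^sub>R d \<in> ball x R" if "0 \<le> s" "s \<le> 1" for s
  proof -
    have "(1 - s) *\<^sub>R p + s *\<^sub>R (p + d) \<in> ball x R"
      using assms that by (intro convexD) auto
    moreover have "(1 - s) *\<^sub>R p + s *\<^sub>R (p + d) = p + s *\<^sub>R d" by (simp add: algebra_simps)
    ultimately show ?thesis by simp
  qed
  have sub: "ball x R \<subseteq> ball x r" using assms(3) by (rule subset_ball)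
  have "((\<lambda>s. \<psi> (p + s *\<^sub>R d)) has_real_derivative g (p + s *\<^sub>R d) \<bullet> d) (at s)" if "0 \<le> s" "s \<le> 1" for s
    by (rule psi_line_deriv) (use seg[OF that] sub in blast)
  from MVT2[OF zero_less_one this] obtain z where "0 < z" "z < 1" "\<psi> (p + 1 *\<^sub>R d) - \<psi> (p + 0 *\<^sub>R d) = (1 - 0) * (g (p + z *\<^sub>R d) \<bullet> d)"
    by blast
  then show ?thesis using that[of "p + z *\<^sub>R d"] seg[of z] by simp
qed

text \<open>A positive value of \<psi> persists nearby and keeps \<Omega> away. At a zero the
  gradient does not vanish, so small steps against it enter \<Omega>, and the zero level belongs to
  the closure.\<close>

lemma closure_psi:
  assumes y: "y \<in> ball x r"
  shows "y \<in> closure \<Omega> \<longleftrightarrow> \<psi> y \<le> 0"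
proof
  assume cl: "y \<in> closure \<Omega>"
  show "\<psi> y \<le> 0"
  proof (rule ccontr)
    assume "\<not> \<psi> y \<le> 0"
    then have "eventually (\<lambda>z. \<psi> z > 0) (nhds y)"
      using psi_cont[OF y] order_tendstoD(1)[of \<psi> "\<psi> y" "at y" 0] by (auto simp: continuous_at eventually_at_filter isCont_def elim!: eventually_mono)
    moreover have "eventually (\<lambda>z. z \<in> ball x r) (nhds y)" using y by (intro eventually_nhds_in_open) auto
    ultimately have "eventually (\<lambda>z. z \<notin> \<Omega>) (nhds y)"
      by eventually_elim (use Omega_psi in auto)
    then obtain S where "open S" "y \<in> S" "\<And>z. z \<in> S \<Longrightarrow> z \<notin> \<Omega>" unfolding eventually_nhds by blast
    then show False using cl closure_iff_nhds_not_empty by blast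
  qed
next
  assume le: "\<psi> y \<le> 0"
  show "y \<in> closure \<Omega>"
  proof (cases "\<psi> y < 0")
    case True
    then show ?thesis using Omega_psi[OF y] closure_subset by blast
  next
    case False
    then have 0: "\<psi> y = 0" using le by simp
    have "((\<lambda>s. \<psi> (y + s *\<^sub>R (- g y))) has_real_derivative g (y + 0 *\<^sub>R (- g y)) \<bullet> (- g y)) (at 0)"
      by (rule psi_line_deriv) (use y in simp)
    moreover have "g (y + 0 *\<^sub>R (- g y)) \<bullet> (- g y) < 0" using g_nz[OF y] by simp
    ultimately obtain d where d: "d > 0" "\<And>h. h > 0 \<Longrightarrow> h < d \<Longrightarrow> \<psi> (y + (0 + h) *\<^sub>R (- g y)) < \<psi> (y + 0 *\<^sub>R (- g y))"
      using DERIV_neg_dec_right by blast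
    show ?thesis
      unfolding closure_approachable
    proof (intro allI impI)
      fix e :: real assume "e > 0"
      obtain e' where e': "e' > 0" "ball y e' \<subseteq> ball x r" using y open_ball openE by blast
      define h where "h = min (d / 2) (min e e' / (2 * norm (g y)))"
      have gp: "norm (g y) > 0" using g_nz[OF y] by simp
      have h: "h > 0" "h < d" using d(1) \<open>e > 0\<close> e'(1) gp by (auto simp: h_def)
      have "h \<le> min e e' / (2 * norm (g y))" by (simp add: h_def)
      then have "h * norm (g y) \<le> min e e' / 2" using gp by (simp add: field_simps)
      then have dist: "dist (y + h *\<^sub>R (- g y)) y < e" "dist (y + h *\<^sub>R (- g y)) y < e'"
        using h(1) \<open>e > 0\<close> e'(1) by (auto simp: dist_norm)
      have "y + h *\<^sub>R (- g y) \<in> ball y e'" using dist(2) by (simp only: mem_ball dist_commute)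
      then have "y + h *\<^sub>R (- g y) \<in> ball x r" using e'(2) by blast
      moreover have "\<psi> (y + h *\<^sub>R (- g y)) < 0" using d(2)[OF h] 0 by simp
      ultimately show "\<exists>z\<in>\<Omega>. dist z y < e" using Omega_psi dist(1) by blast
    qed
  qed
qed

lemma x_ball: "x \<in> ball x r" using r_pos by simp

lemma psi_x: "\<psi> x = 0"
proof -
  have "x \<in> closure \<Omega>" "x \<notin> \<Omega>" using x_frontier open_Omega by (auto simp: frontier_def interior_open)
  then show ?thesis using closure_psi[OF x_ball] Omega_psi[OF x_ball] by linarith
qed

text \<open>Along a chord the defining function exceeds its linear interpolation by at most the oscillation
  of its gradient times the length of the chord, so continuity of the gradient makes the bump small.\<close>
lemma chord_bump:
  assumes "\<omega> > 0"
  obtains \<rho> where "\<rho> > 0"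
    "\<And>a d l. a \<in> closure \<Omega> \<Longrightarrow> a + d \<in> closure \<Omega> \<Longrightarrow> a \<in> ball x \<rho> \<Longrightarrow> a + d \<in> ball x \<rho> \<Longrightarrow> 0 \<le> l \<Longrightarrow> l \<le> 1 \<Longrightarrow>
       a + l *\<^sub>R d - (\<omega> * norm d * (l * (1 - l))) *\<^sub>R (g x /\<^sub>R norm (g x)) \<in> closure \<Omega>"
proof -
  define c where "c = norm (g x)"
  have c: "c > 0" using g_nz[OF x_ball] by (simp add: c_def)
  define n where "n = g x /\<^sub>R norm (g x)"
  have n: "norm n = 1" "g x \<bullet> n = c" using c by (auto simp: n_def c_def power2_norm_eq_inner[symmetric] power2_eq_square)
  \<comment> \<open>Permitted oscillation of the gradient: \<theta> \<le> c/2 keeps the slope of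
    \<psi> along n at least c/2 near x, and 2 \<theta> \<le> \<omega> c/2 makes the decrease caused
    by the push outweigh the excess over the chord.\<close>
  define \<theta> where "\<theta> = min (c / 2) (\<omega> * c / 4)"
  have \<theta>: "\<theta> > 0" "\<theta> \<le> c / 2" "2 * \<theta> \<le> \<omega> * (c / 2)" using c assms by (auto simp: \<theta>_def min_def)
  obtain R0 where R0: "R0 > 0" "\<And>y. dist y x < R0 \<Longrightarrow> dist (g y) (g x) < \<theta>"
    using g_cont[OF x_ball] \<theta>(1) unfolding continuous_at_eps_delta by blast
  define R where "R = min r R0"
  have R: "R > 0" "R \<le> r" "\<And>y. y \<in> ball x R \<Longrightarrow> norm (g y - g x) \<le> \<theta>"
    using R0 r_pos by (auto simp: R_def dist_commute dist_norm less_imp_le)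
  \<comment> \<open>Chords with both ends in this ball have length at most 2 \<rho>, so the push is
    at most 2 \<omega> \<rho> and the pushed point remains in the ball of radius R.\<close>
  define \<rho> where "\<rho> = R / (1 + 2 * \<omega>)"
  have \<rho>: "\<rho> > 0" "\<rho> * (1 + 2 * \<omega>) = R" "\<rho> \<le> R" using R(1) assms by (auto simp: \<rho>_def field_simps)
  have main: "a + l *\<^sub>R d - (\<omega> * norm d * (l * (1 - l))) *\<^sub>R n \<in> closure \<Omega>"
    if a: "a \<in> closure \<Omega>" "a + d \<in> closure \<Omega>" "a \<in> ball x \<rho>" "a + d \<in> ball x \<rho>" and l: "0 \<le> l" "l \<le> 1" for a d l
  proof -
    let ?y = "a + l *\<^sub>R d"
    have sub: "ball x \<rho> \<subseteq> ball x R" "ball x R \<subseteq> ball x r" using \<rho>(3) R(2) by auto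
    have y: "?y \<in> ball x \<rho>"
    proof -
      have "(1 - l) *\<^sub>R a + l *\<^sub>R (a + d) \<in> ball x \<rho>" using a l by (intro convexD) auto
      moreover have "(1 - l) *\<^sub>R a + l *\<^sub>R (a + d) = ?y" by (simp add: algebra_simps)
      ultimately show ?thesis by simp
    qed
    obtain \<xi>1 where \<xi>1: "\<xi>1 \<in> ball x R" "\<psi> (a + l *\<^sub>R d) - \<psi> a = g \<xi>1 \<bullet> (l *\<^sub>R d)"
      by (rule psi_mvt[of a R "l *\<^sub>R d"]) (use a y sub R(2) in auto)
    have eq: "?y + (1 - l) *\<^sub>R d = a + d" by (simp add: algebra_simps)
    obtain \<xi>2 where \<xi>2: "\<xi>2 \<in> ball x R" "\<psi> (a + d) - \<psi> ?y = g \<xi>2 \<bullet> ((1 - l) *\<^sub>R d)"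
      by (rule psi_mvt[of ?y R "(1 - l) *\<^sub>R d", unfolded eq]) (use a y sub R(2) in auto)
    have le0: "\<psi> a \<le> 0" "\<psi> (a + d) \<le> 0" using closure_psi a sub by blast+
    have "\<psi> ?y = (1 - l) * \<psi> ?y + l * \<psi> ?y" by (simp add: algebra_simps)
    \<comment> \<open>Expanding from both ends and weighting by 1 - l and l makes the two
      first-order terms cancel up to the difference of the gradients at the intermediate
      points.\<close>
    also have "\<dots> = (1 - l) * (\<psi> a + g \<xi>1 \<bullet> (l *\<^sub>R d)) + l * (\<psi> (a + d) - g \<xi>2 \<bullet> ((1 - l) *\<^sub>R d))"
    proof -
      have "\<psi> ?y = \<psi> a + g \<xi>1 \<bullet> (l *\<^sub>R d)" "\<psi> ?y = \<psi> (a + d) - g \<xi>2 \<bullet> ((1 - l) *\<^sub>R d)"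
        using \<xi>1(2) \<xi>2(2) by linarith+
      then show ?thesis by metis
    qed
    also have "\<dots> = (1 - l) * \<psi> a + l * \<psi> (a + d) + l * (1 - l) * ((g \<xi>1 - g \<xi>2) \<bullet> d)"
      by (simp add: algebra_simps inner_diff_left)
    also have "\<dots> \<le> 0 + 0 + l * (1 - l) * (2 * \<theta> * norm d)"
    proof (intro add_mono mult_left_mono)
      have "norm (g \<xi>1 - g \<xi>2) \<le> 2 * \<theta>"
        using R(3)[OF \<xi>1(1)] R(3)[OF \<xi>2(1)] norm_triangle_ineq4[of "g \<xi>1 - g x" "g \<xi>2 - g x"] by simp
      then show "(g \<xi>1 - g \<xi>2) \<bullet> d \<le> 2 * \<theta> * norm d"
        by (intro order_trans[OF norm_cauchy_schwarz] mult_right_mono) auto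
    qed (use l le0 in \<open>auto simp: mult_nonneg_nonpos\<close>)
    finally have psiy: "\<psi> ?y \<le> l * (1 - l) * (2 * \<theta> * norm d)" by simp
    define \<beta> where "\<beta> = \<omega> * norm d * (l * (1 - l))"
    have \<beta>0: "0 \<le> \<beta>" using assms l by (simp add: \<beta>_def)
    have "norm d \<le> 2 * \<rho>"
    proof -
      have "norm d \<le> dist x a + dist x (a + d)"
        using dist_triangle3[of "a + d" a x] by (simp add: dist_norm)
      then show ?thesis using a by auto
    qed
    moreover have "l * (1 - l) \<le> 1" using l mult_le_one[of l "1 - l"] by simp
    ultimately have "\<beta> \<le> \<omega> * (2 * \<rho>) * 1"
      unfolding \<beta>_def using assms l \<rho>(1) by (intro mult_mono) auto
    have "dist x (?y - \<beta> *\<^sub>R n) \<le> dist x ?y + \<beta>"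
      using dist_triangle[of x "?y - \<beta> *\<^sub>R n" ?y] n(1) \<beta>0 by (simp add: dist_norm)
    also have "\<dots> < R"
    proof -
      have "dist x ?y < \<rho>" using y by simp
      moreover have "R = \<rho> + \<omega> * (2 * \<rho>)" using \<rho>(2) by (simp add: algebra_simps)
      ultimately show ?thesis using \<open>\<beta> \<le> \<omega> * (2 * \<rho>) * 1\<close> by linarith
    qed
    finally have yn: "?y + (- \<beta> *\<^sub>R n) \<in> ball x R" by simp
    obtain \<zeta> where \<zeta>: "\<zeta> \<in> ball x R" "\<psi> (?y + (- \<beta> *\<^sub>R n)) - \<psi> ?y = g \<zeta> \<bullet> (- \<beta> *\<^sub>R n)"
      by (rule psi_mvt[OF _ yn R(2)]) (use y sub in auto)
    have "c / 2 \<le> g \<zeta> \<bullet> n"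
    proof -
      have "\<bar>(g \<zeta> - g x) \<bullet> n\<bar> \<le> \<theta>"
        using Cauchy_Schwarz_ineq2[of "g \<zeta> - g x" n] R(3)[OF \<zeta>(1)] n(1) by simp
      then show ?thesis using n(2) \<theta>(2) by (simp add: inner_diff_left)
    qed
    then have "\<beta> * (c / 2) \<le> \<beta> * (g \<zeta> \<bullet> n)" using \<beta>0 by (rule mult_left_mono)
    then have "\<psi> (?y + (- \<beta> *\<^sub>R n)) \<le> \<psi> ?y - \<beta> * (c / 2)" using \<zeta>(2) by simp
    also have "\<dots> \<le> l * (1 - l) * norm d * (2 * \<theta> - \<omega> * (c / 2))"
      using psiy by (simp add: \<beta>_def algebra_simps)
    also have "\<dots> \<le> 0" using \<theta>(3) l by (intro mult_nonneg_nonpos) auto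
    finally have "?y + (- \<beta> *\<^sub>R n) \<in> closure \<Omega>" using closure_psi yn sub by blast
    then show ?thesis by (simp add: \<beta>_def)
  qed
  show ?thesis by (rule that[OF \<rho>(1)]) (use main in \<open>simp add: n_def\<close>)
qed

text \<open>\<psi> vanishes at x and is nonpositive at the displaced points, so the gradient at some
  intermediate point has nonpositive product with \<open>v k\<close>; the intermediate points tend
  to x.\<close>

lemma tangent_sign:
  assumes h: "h \<longlonglongrightarrow> 0" "\<And>k. h k > (0::real)" and v: "v \<longlonglongrightarrow> w" and cl: "\<And>k::nat. x + h k *\<^sub>R v k \<in> closure \<Omega>"
  shows "g x \<bullet> w \<le> 0"
proof -
  have lim: "(\<lambda>k. h k *\<^sub>R v k) \<longlonglongrightarrow> 0" using tendsto_scaleR[OF h(1) v] by simp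
  \<comment> \<open>The summand \<open>h k\<close> keeps the radius positive and the displaced point
    strictly inside, even if \<open>v k\<close> is 0.\<close>
  define R where "R k = norm (h k *\<^sub>R v k) + h k" for k
  have R0: "R \<longlonglongrightarrow> 0" unfolding R_def using tendsto_add[OF tendsto_norm[OF lim] h(1)] by simp
  have Rp: "R k > 0" "x + h k *\<^sub>R v k \<in> ball x (R k)" for k
    using h(2)[of k] unfolding R_def by (auto simp: dist_norm intro!: add_nonneg_pos)
  have ev: "eventually (\<lambda>k. R k < r) sequentially" using order_tendstoD(2)[OF R0 r_pos] .
  have "\<exists>\<xi>. R k < r \<longrightarrow> (\<xi> \<in> ball x (R k) \<and> g \<xi> \<bullet> v k \<le> 0)" for k
  proof (cases "R k < r")
    case True
    obtain \<xi> where \<xi>: "\<xi> \<in> ball x (R k)" "\<psi> (x + h k *\<^sub>R v k) - \<psi> x = g \<xi> \<bullet> (h k *\<^sub>R v k)"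
      by (rule psi_mvt[of x "R k" "h k *\<^sub>R v k"]) (use Rp[of k] True in auto)
    have "x + h k *\<^sub>R v k \<in> ball x r" using Rp(2)[of k] True by (auto simp: dist_norm)
    then have "\<psi> (x + h k *\<^sub>R v k) \<le> 0" using closure_psi cl by blast
    then have "h k * (g \<xi> \<bullet> v k) \<le> 0" using \<xi>(2) psi_x by simp
    then have "g \<xi> \<bullet> v k \<le> 0" using h(2)[of k] by (simp add: mult_le_0_iff)
    then show ?thesis using \<xi> by blast
  qed simp
  then obtain \<xi> where \<xi>: "\<And>k. R k < r \<Longrightarrow> \<xi> k \<in> ball x (R k) \<and> g (\<xi> k) \<bullet> v k \<le> 0" by metis
  have "\<xi> \<longlonglongrightarrow> x"
  proof (rule metric_tendsto_imp_tendsto[OF R0])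
    show "eventually (\<lambda>k. dist (\<xi> k) x \<le> dist (R k) 0) sequentially"
      using ev
    proof eventually_elim
      case (elim k)
      then show ?case using \<xi>[OF elim] by (auto simp: dist_commute)
    qed
  qed
  then have "(\<lambda>k. g (\<xi> k)) \<longlonglongrightarrow> g x" by (rule isCont_tendsto_compose[OF g_cont[OF x_ball]])
  then have "(\<lambda>k. g (\<xi> k) \<bullet> v k) \<longlonglongrightarrow> g x \<bullet> w" using v by (rule tendsto_inner)
  moreover have "eventually (\<lambda>k. g (\<xi> k) \<bullet> v k \<le> 0) sequentially"
    using ev by eventually_elim (use \<xi> in blast)
  ultimately show ?thesis by (rule tendsto_upperbound) simp
qed

lemma inward_segment:
  assumes "g x \<bullet> w < 0"
  obtains d where "d > 0" "\<And>s. 0 \<le> s \<Longrightarrow> s < d \<Longrightarrow> x + s *\<^sub>R w \<in> closure \<Omega>"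
proof -
  have "((\<lambda>s. \<psi> (x + s *\<^sub>R w)) has_real_derivative g (x + 0 *\<^sub>R w) \<bullet> w) (at 0)"
    by (rule psi_line_deriv) (use r_pos in simp)
  moreover have "g (x + 0 *\<^sub>R w) \<bullet> w < 0" using assms by simp
  ultimately obtain d where d: "d > 0" "\<And>h. h > 0 \<Longrightarrow> h < d \<Longrightarrow> \<psi> (x + (0 + h) *\<^sub>R w) < \<psi> (x + 0 *\<^sub>R w)"
    using DERIV_neg_dec_right by blast
  have wn: "norm w + 1 > 0" using norm_ge_zero[of w] by linarith
  show ?thesis
  proof (rule that[of "min d (r / (norm w + 1))"])
    show "min d (r / (norm w + 1)) > 0" using d(1) r_pos wn by simp
    fix s assume s: "0 \<le> s" "s < min d (r / (norm w + 1))"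
    then have "s * (norm w + 1) < r" using wn by (simp add: field_simps)
    moreover have "s * norm w \<le> s * (norm w + 1)" using s(1) by (intro mult_left_mono) auto
    ultimately have b: "x + s *\<^sub>R w \<in> ball x r" using s(1) by (simp add: dist_norm)
    have "\<psi> (x + s *\<^sub>R w) \<le> 0"
      using d(2)[of s] s psi_x by (cases "s = 0") auto
    then show "x + s *\<^sub>R w \<in> closure \<Omega>" using closure_psi[OF b] by blast
  qed
qed

end

section \<open>Optimal curves have no corner at the boundary\<close>

lemma has_integral_inner_right:
  fixes f :: "real \<Rightarrow> 'b::euclidean_space"
  assumes "(f has_integral I) S"
  shows "((\<lambda>s. q \<bullet> f s) has_integral q \<bullet> I) S"
  using has_integral_linear[OF assms bounded_linear_inner_right[of q]] by (simp add: o_def)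

lemma has_integral_inner_left:
  fixes f :: "real \<Rightarrow> 'b::euclidean_space"
  assumes "(f has_integral I) S"
  shows "((\<lambda>s. f s \<bullet> q) has_integral I \<bullet> q) S"
  using has_integral_inner_right[OF assms, of q] by (simp add: inner_commute)

locale mfg_contact = mfg_value + boundary_chart \<Omega> x r \<psi> gr for x r \<psi> gr +
  fixes \<gamma> :: "real \<Rightarrow>\<^sub>C 'a" and t :: real and dens :: "real \<Rightarrow> 'a"
  assumes opt: "optimal \<gamma>" and t: "0 < t" "t < T" and \<gamma>_t: "apply_bcontfun \<gamma> t = x"
    and dens_integral: "\<And>a b. a \<le> b \<Longrightarrow> (dens has_integral (apply_bcontfun \<gamma> b - apply_bcontfun \<gamma> a)) {a..b}"
    and dens_sq: "(\<lambda>s. (norm (dens s))\<^sup>2) integrable_on {0..T}"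
    and dens_lag: "(\<lambda>s. L (apply_bcontfun \<gamma> s) (dens s) + F (apply_bcontfun \<gamma> s) (m s)) integrable_on {0..T}"
    and lag_dens: "\<And>a b. integral {a..b} (lag \<gamma>) =
       integral {a..b} (\<lambda>s. L (apply_bcontfun \<gamma> s) (dens s) + F (apply_bcontfun \<gamma> s) (m s))"
begin

lemma \<gamma>_Gamma: "\<gamma> \<in> Gamma \<Omega> T" using opt by (simp add: optimal_def)

lemma x_closure: "x \<in> closure \<Omega>" and x_U: "x \<in> U"
  using Gamma_closure[OF \<gamma>_Gamma, of t] Gamma_U[OF \<gamma>_Gamma, of t] t \<gamma>_t by auto

lemma deviation_integrable:
  assumes ab: "0 \<le> a" "a \<le> b" "b \<le> T"
  shows "(\<lambda>s. (norm (dens s - w))\<^sup>2) integrable_on {a..b}"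
proof -
  have "(\<lambda>s. (norm (dens s))\<^sup>2) integrable_on {a..b}"
    by (rule integrable_on_subinterval[OF dens_sq]) (use ab in auto)
  moreover have "(\<lambda>s. dens s \<bullet> (2 *\<^sub>R w)) integrable_on {a..b}"
    using has_integral_inner_left[OF dens_integral[OF ab(2)]] by blast
  ultimately have "(\<lambda>s. (norm (dens s))\<^sup>2 - dens s \<bullet> (2 *\<^sub>R w) + (norm w)\<^sup>2) integrable_on {a..b}"
    by (intro integrable_add integrable_diff integrable_const_ivl)
  moreover have "(norm (dens s))\<^sup>2 - dens s \<bullet> (2 *\<^sub>R w) + (norm w)\<^sup>2 = (norm (dens s - w))\<^sup>2" for s
    by (simp add: power2_norm_eq_inner inner_diff_left inner_diff_right inner_commute)
  ultimately show ?thesis by simp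
qed

text \<open>Jensen's inequality for the squared norm: with c the mean of \<open>dens - w\<close>,
  integrate the inequality stating that the square of \<open>norm (dens s - w - c)\<close> is
  nonnegative.\<close>

lemma deviation_lower:
  assumes ab: "0 \<le> a" "a < b" "b \<le> T"
  shows "(b - a) * (norm ((apply_bcontfun \<gamma> b - apply_bcontfun \<gamma> a) /\<^sub>R (b - a) - w))\<^sup>2
     \<le> integral {a..b} (\<lambda>s. (norm (dens s - w))\<^sup>2)"
proof -
  have ab': "a \<le> b" using ab by simp
  let ?c = "(\<gamma> b - \<gamma> a) /\<^sub>R (b - a) - w"
  have avg: "\<gamma> b - \<gamma> a = (b - a) *\<^sub>R (?c + w)" using ab by simp
  have "((\<lambda>s. dens s \<bullet> (2 *\<^sub>R ?c) - (w \<bullet> (2 *\<^sub>R ?c) + (norm ?c)\<^sup>2)) has_integral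
      (\<gamma> b - \<gamma> a) \<bullet> (2 *\<^sub>R ?c) - (b - a) * (w \<bullet> (2 *\<^sub>R ?c) + (norm ?c)\<^sup>2)) {a..b}"
    using has_integral_diff[OF has_integral_inner_left[OF dens_integral[OF ab'], of "2 *\<^sub>R ?c"]
        has_integral_const_real[of "w \<bullet> (2 *\<^sub>R ?c) + (norm ?c)\<^sup>2" a b]] ab' by simp
  moreover have "(\<gamma> b - \<gamma> a) \<bullet> (2 *\<^sub>R ?c) - (b - a) * (w \<bullet> (2 *\<^sub>R ?c) + (norm ?c)\<^sup>2) = (b - a) * (norm ?c)\<^sup>2"
    by (subst (1) avg) (simp add: power2_norm_eq_inner inner_add_left algebra_simps)
  ultimately have i: "((\<lambda>s. dens s \<bullet> (2 *\<^sub>R ?c) - (w \<bullet> (2 *\<^sub>R ?c) + (norm ?c)\<^sup>2)) has_integral (b - a) * (norm ?c)\<^sup>2) {a..b}"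
    by simp
  show ?thesis
  proof (rule has_integral_le[OF i integrable_integral[OF deviation_integrable[OF ab(1) ab' ab(3)]]])
    fix s
    have "0 \<le> (norm (dens s - w - ?c))\<^sup>2" by simp
    also have "\<dots> = (norm (dens s - w))\<^sup>2 - (dens s \<bullet> (2 *\<^sub>R ?c) - (w \<bullet> (2 *\<^sub>R ?c) + (norm ?c)\<^sup>2))"
      by (simp only: power2_norm_eq_inner inner_diff_left[of "dens s - w" ?c] inner_diff_right[of _ "dens s - w" ?c])
         (simp add: inner_diff_left inner_diff_right inner_commute algebra_simps)
    finally show "dens s \<bullet> (2 *\<^sub>R ?c) - (w \<bullet> (2 *\<^sub>R ?c) + (norm ?c)\<^sup>2) \<le> (norm (dens s - w))\<^sup>2" by simp
  qed
qed

text \<open>The constant of \<open>L_lipschitz_x\<close>, where it multiplies one plus the squared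
  speed.\<close>

definition K :: real where "K = M + 2 * c_mu"

lemma K_pos: "K > 0" using M_nonneg[OF x_U] L1_mu by (simp add: K_def)

text \<open>Jensen's inequality with remainder: strong convexity at the velocity w controls the deviation
  of the actual velocity from w.\<close>
lemma lag_integral_lower:
  assumes ab: "0 \<le> a" "a \<le> b" "b \<le> T" and R: "ball x R \<subseteq> U" "\<rho> < R"
    and near: "\<And>s. s \<in> {a..b} \<Longrightarrow> norm (apply_bcontfun \<gamma> s - x) \<le> \<rho>"
    and nearF: "\<And>s. s \<in> {a..b} \<Longrightarrow> \<bar>F (apply_bcontfun \<gamma> s) (m s) - F x (m t)\<bar> \<le> \<delta>"
  shows "(b - a) * (L x w + F x (m t) - \<delta> - K * \<rho> * (1 + 2 * (norm w)\<^sup>2))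
      + Lv x w \<bullet> (apply_bcontfun \<gamma> b - apply_bcontfun \<gamma> a - (b - a) *\<^sub>R w)
      + (1 / (2 * c_mu) - 2 * (K * \<rho>)) * integral {a..b} (\<lambda>s. (norm (dens s - w))\<^sup>2)
    \<le> integral {a..b} (lag \<gamma>)"
proof -
  let ?q = "Lv x w" and ?S = "integral {a..b} (\<lambda>s. (norm (dens s - w))\<^sup>2)"
  let ?A = "L x w + F x (m t) - \<delta> - K * \<rho> * (1 + 2 * (norm w)\<^sup>2) - ?q \<bullet> w"
  let ?f = "\<lambda>s. L (\<gamma> s) (dens s) + F (\<gamma> s) (m s)"
  have "?f integrable_on {a..b}"
    by (rule integrable_on_subinterval[OF dens_lag]) (use ab in auto)
  then have fi: "(?f has_integral integral {a..b} (lag \<gamma>)) {a..b}"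
    using lag_dens[of a b] integrable_integral by fastforce
  have "((\<lambda>s. ?A + ?q \<bullet> dens s + (1 / (2 * c_mu) - 2 * (K * \<rho>)) * (norm (dens s - w))\<^sup>2) has_integral
     (b - a) * ?A + ?q \<bullet> (\<gamma> b - \<gamma> a) + (1 / (2 * c_mu) - 2 * (K * \<rho>)) * ?S) {a..b}"
    using has_integral_add[OF has_integral_add[OF has_integral_const_real[of ?A a b]
          has_integral_inner_right[OF dens_integral[OF ab(2)], of ?q]]
        has_integral_mult_right[OF integrable_integral[OF deviation_integrable[OF ab, of w]], of "1 / (2 * c_mu) - 2 * (K * \<rho>)"]] ab
    by simp
  from this fi have "(b - a) * ?A + ?q \<bullet> (\<gamma> b - \<gamma> a) + (1 / (2 * c_mu) - 2 * (K * \<rho>)) * ?S \<le> integral {a..b} (lag \<gamma>)"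
  proof (rule has_integral_le)
    fix s assume s: "s \<in> {a..b}"
    let ?y = "dens s"
    have "norm (\<gamma> s - x) \<le> \<rho>" using near s by blast
    then have rho0: "0 \<le> \<rho>" by (meson norm_ge_zero order_trans)
    have "\<gamma> s \<in> ball x R" using \<open>norm (\<gamma> s - x) \<le> \<rho>\<close> R(2) by (simp add: dist_norm norm_minus_commute)
    moreover have "x \<in> ball x R" using rho0 R(2) by simp
    ultimately have "\<bar>L (\<gamma> s) ?y - L x ?y\<bar> \<le> K * (1 + (norm ?y)\<^sup>2) * norm (\<gamma> s - x)"
      using L_lipschitz_x[OF convex_ball R(1), of "\<gamma> s" x ?y] unfolding K_def by simp
    also have "\<dots> \<le> K * (1 + (norm ?y)\<^sup>2) * \<rho>"
      using \<open>norm (\<gamma> s - x) \<le> \<rho>\<close> K_pos by (intro mult_left_mono) auto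
    \<comment> \<open>Freezing the position costs an error quadratic in the velocity. Splitting the
      velocity into w and its deviation turns one part into a constant and charges the other to
      strong convexity, whence the factor \<open>1 / (2 * c_mu) - 2 * (K * \<rho>)\<close>.\<close>
    also have "\<dots> \<le> K * (1 + (2 * (norm (?y - w))\<^sup>2 + 2 * (norm w)\<^sup>2)) * \<rho>"
    proof (intro mult_right_mono mult_left_mono add_left_mono)
      have "norm ?y \<le> norm (?y - w) + norm w" using norm_triangle_ineq[of "?y - w" w] by simp
      then have "(norm ?y)\<^sup>2 \<le> (norm (?y - w) + norm w)\<^sup>2" by (intro power_mono) auto
      also have "\<dots> \<le> 2 * (norm (?y - w))\<^sup>2 + 2 * (norm w)\<^sup>2"
        using sum_squares_bound[of "norm (?y - w)" "norm w"] by (simp add: power2_sum)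
      finally show "(norm ?y)\<^sup>2 \<le> 2 * (norm (?y - w))\<^sup>2 + 2 * (norm w)\<^sup>2" .
    qed (use K_pos rho0 in auto)
    finally have 1: "L x ?y - K * (1 + (2 * (norm (?y - w))\<^sup>2 + 2 * (norm w)\<^sup>2)) * \<rho> \<le> L (\<gamma> s) ?y" by linarith
    have 2: "L x w + ?q \<bullet> (?y - w) + (norm (?y - w))\<^sup>2 / (2 * c_mu) \<le> L x ?y"
      using L_quadratic_bounds(1)[OF x_U, of w "?y - w"] by simp
    have 3: "F x (m t) - \<delta> \<le> F (\<gamma> s) (m s)" using nearF[OF s] by linarith
    have "?A + ?q \<bullet> ?y + (1 / (2 * c_mu) - 2 * (K * \<rho>)) * (norm (?y - w))\<^sup>2 =
       (L x w + ?q \<bullet> (?y - w) + (norm (?y - w))\<^sup>2 / (2 * c_mu)) - K * (1 + (2 * (norm (?y - w))\<^sup>2 + 2 * (norm w)\<^sup>2)) * \<rho>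
        + (F x (m t) - \<delta>)"
      by (simp add: algebra_simps inner_diff_right)
    then show "?A + ?q \<bullet> ?y + (1 / (2 * c_mu) - 2 * (K * \<rho>)) * (norm (?y - w))\<^sup>2 \<le> ?f s"
      using 1 2 3 by linarith
  qed
  then show ?thesis by (simp add: algebra_simps inner_diff_right)
qed

lemma near_point:
  assumes "\<delta> > 0"
  obtains h0 where "h0 > 0" "h0 \<le> \<delta>" "h0 < t" "t + h0 < T"
    "\<And>s. \<bar>s - t\<bar> < h0 \<Longrightarrow> norm (apply_bcontfun \<gamma> s - x) < \<delta>"
    "\<And>s y. \<bar>s - t\<bar> < h0 \<Longrightarrow> y \<in> closure \<Omega> \<Longrightarrow> norm (y - x) < h0 \<Longrightarrow> \<bar>F y (m s) - F x (m t)\<bar> < \<delta>"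
    "\<And>s. \<bar>s - t\<bar> < h0 \<Longrightarrow> \<bar>F (apply_bcontfun \<gamma> s) (m s) - F x (m t)\<bar> < \<delta>"
proof -
  have "(t, x) \<in> {0..T} \<times> closure \<Omega>" using t x_closure by auto
  then obtain d where d: "d > 0" "\<And>s y. (s, y) \<in> {0..T} \<times> closure \<Omega> \<Longrightarrow> dist (s, y) (t, x) < d \<Longrightarrow> dist (F y (m s)) (F x (m t)) < \<delta>"
    using continuous_F assms unfolding continuous_on_iff by fastforce
  define d' where "d' = min (d / 2) \<delta>"
  have d': "d' > 0" using d(1) assms by (simp add: d'_def)
  have "isCont (apply_bcontfun \<gamma>) t" using continuous_on_eq_continuous_at[OF open_UNIV] continuous_on_apply_bcontfun by blast
  then obtain e where e: "e > 0" "\<And>s. dist s t < e \<Longrightarrow> dist (\<gamma> s) x < d'"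
    using d' \<gamma>_t unfolding continuous_at_eps_delta by metis
  define h0 where "h0 = min (min e d') (min (t / 2) ((T - t) / 2))"
  have h0: "h0 \<le> e" "h0 \<le> d'" "h0 \<le> t / 2" "h0 \<le> (T - t) / 2"
    unfolding h0_def by (meson min.cobounded1 min.cobounded2 order_trans)+
  have "h0 > 0" using e(1) d' t by (simp add: h0_def)
  note h0 = this h0
  have F: "\<bar>F y (m s) - F x (m t)\<bar> < \<delta>" if s: "\<bar>s - t\<bar> < h0" "y \<in> closure \<Omega>" "norm (y - x) < d'" for s y
  proof -
    have "dist (s, y) (t, x) \<le> dist s t + dist y x"
      unfolding dist_Pair_Pair by (rule sqrt_sum_squares_le_sum) auto
    also have "\<dots> = \<bar>s - t\<bar> + norm (y - x)" by (simp add: dist_norm)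
    also have "\<dots> < d" using s h0(3) by (simp add: d'_def min_def split: if_splits)
    finally have "dist (s, y) (t, x) < d" .
    moreover have "s \<in> {0..T}" using s(1) h0(4,5) by auto
    ultimately show ?thesis using d(2)[of s y] s(2) by (simp add: dist_real_def)
  qed
  have \<gamma>: "norm (\<gamma> s - x) < d'" if "\<bar>s - t\<bar> < h0" for s
    using e(2)[of s] that h0(2) by (simp add: dist_norm)
  show ?thesis
  proof (rule that[OF h0(1)])
    show "h0 \<le> \<delta>" "h0 < t" "t + h0 < T" using h0 t by (auto simp: d'_def)
    show "norm (\<gamma> s - x) < \<delta>" if "\<bar>s - t\<bar> < h0" for s
      using \<gamma>[OF that] by (simp add: d'_def)
    show "\<bar>F y (m s) - F x (m t)\<bar> < \<delta>" if "\<bar>s - t\<bar> < h0" "y \<in> closure \<Omega>" "norm (y - x) < h0" for s y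
      by (rule F) (use that h0(3) in auto)
    show "\<bar>F (\<gamma> s) (m s) - F x (m t)\<bar> < \<delta>" if "\<bar>s - t\<bar> < h0" for s
    proof (rule F[OF that _ \<gamma>[OF that]])
      have "s \<in> {0..T}" using that h0(4,5) t by auto
      then show "\<gamma> s \<in> closure \<Omega>" by (rule Gamma_closure[OF \<gamma>_Gamma])
    qed
  qed
qed

text \<open>\<open>vel h\<close> is the mean velocity over [t - h, t], since \<gamma> is at x at
  time t, and \<open>chord h\<close> the mean over [t - h, t + h]. \<open>dev h\<close> is the
  variance of the velocity on the latter interval, not divided by its length.\<close>

definition vel :: "real \<Rightarrow> 'a" where "vel h = (x - apply_bcontfun \<gamma> (t - h)) /\<^sub>R h"
definition chord :: "real \<Rightarrow> 'a" where
  "chord h = (apply_bcontfun \<gamma> (t + h) - apply_bcontfun \<gamma> (t - h)) /\<^sub>R (2 * h)"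
definition dev :: "real \<Rightarrow> real" where
  "dev h = integral {t - h..t + h} (\<lambda>s. (norm (dens s - chord h))\<^sup>2)"

text \<open>Replacing the optimal curve on [t - h, t + h] by the chord plus a small bump pointing into the
  domain costs only o(h), whereas strong convexity gains the deviation from the chord velocity.\<close>
lemma deviation_small:
  assumes "\<epsilon> > 0"
  obtains h0 where "h0 > 0" "h0 < t" "t + h0 < T"
    "\<And>h. 0 < h \<Longrightarrow> h < h0 \<Longrightarrow> dev h \<le> \<epsilon> * (h + h * (norm (chord h))\<^sup>2 + dev h)"
proof -
  \<comment> \<open>With z the chord velocity, the errors will add up to \<delta> times 8 h + 13 h
    |z|^2 + 2 dev, hence to at most 13 \<delta> times h + h |z|^2 + dev. Clearing the convexity
    constant multiplies by 2 c_mu, which makes 26 c_mu.\<close>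
  define \<delta> where "\<delta> = \<epsilon> / (26 * c_mu)"
  have \<delta>: "\<delta> > 0" using assms L1_mu by (simp add: \<delta>_def)
  define \<omega> where "\<omega> = min 1 (\<delta> / c_mu)"
  have \<omega>: "\<omega> > 0" "\<omega> \<le> 1" "c_mu * \<omega>\<^sup>2 \<le> \<delta>"
  proof -
    show "\<omega> > 0" "\<omega> \<le> 1" using \<delta> L1_mu by (auto simp: \<omega>_def)
    then have "\<omega>\<^sup>2 \<le> \<omega>" by (simp add: power2_eq_square mult_left_le)
    also have "\<omega> \<le> \<delta> / c_mu" by (simp add: \<omega>_def)
    finally show "c_mu * \<omega>\<^sup>2 \<le> \<delta>" using L1_mu by (simp add: field_simps)
  qed
  define n where "n = gr x /\<^sub>R norm (gr x)"
  have n1: "norm n = 1" using g_nz[OF x_ball] by (simp add: n_def)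
  obtain \<rho>1 where \<rho>1: "\<rho>1 > 0"
    "\<And>a d l. a \<in> closure \<Omega> \<Longrightarrow> a + d \<in> closure \<Omega> \<Longrightarrow> a \<in> ball x \<rho>1 \<Longrightarrow> a + d \<in> ball x \<rho>1 \<Longrightarrow> 0 \<le> l \<Longrightarrow> l \<le> 1 \<Longrightarrow>
       a + l *\<^sub>R d - (\<omega> * norm d * (l * (1 - l))) *\<^sub>R n \<in> closure \<Omega>"
    using chord_bump[OF \<omega>(1)] unfolding n_def by metis
  obtain R where R: "R > 0" "ball x R \<subseteq> U" using U(1) x_U openE by blast
  obtain h1 where h1: "h1 > 0" "h1 \<le> \<delta>" "h1 < t" "t + h1 < T"
    "\<And>s. \<bar>s - t\<bar> < h1 \<Longrightarrow> norm (apply_bcontfun \<gamma> s - x) < \<delta>"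
    "\<And>s y. \<bar>s - t\<bar> < h1 \<Longrightarrow> y \<in> closure \<Omega> \<Longrightarrow> norm (y - x) < h1 \<Longrightarrow> \<bar>F y (m s) - F x (m t)\<bar> < \<delta>"
    "\<And>s. \<bar>s - t\<bar> < h1 \<Longrightarrow> \<bar>F (apply_bcontfun \<gamma> s) (m s) - F x (m t)\<bar> < \<delta>"
    by (rule near_point[OF \<delta>]) (rule that)
  define Q where "Q = min (min \<rho>1 R) (min h1 (\<delta> / K))"
  have Q: "Q > 0" "Q \<le> \<rho>1" "Q \<le> R" "Q \<le> h1" "Q \<le> \<delta> / K"
    using \<rho>1(1) R(1) h1(1) \<delta> K_pos by (auto simp: Q_def)
  \<comment> \<open>If \<gamma> stays within \<rho> of x, the comparison curve stays within 4
    \<rho>: one \<rho> for the starting point, two for the chord, one for the bump. The remaining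
    factor 2 makes the inclusions strict.\<close>
  define \<rho> where "\<rho> = Q / 8"
  have \<rho>: "\<rho> > 0" "\<rho> < \<rho>1" "8 * \<rho> \<le> R" "8 * \<rho> \<le> h1" "8 * \<rho> \<le> \<delta> / K"
    using Q by (auto simp: \<rho>_def)
  have K\<rho>: "K * (4 * \<rho>) \<le> \<delta>" "K * \<rho> \<le> \<delta>"
  proof -
    have "K * (8 * \<rho>) \<le> K * (\<delta> / K)" using \<rho>(5) K_pos by (intro mult_left_mono) auto
    then have "K * (8 * \<rho>) \<le> \<delta>" using K_pos by simp
    moreover have "0 < K * \<rho>" using K_pos \<rho>(1) by simp
    ultimately show "K * (4 * \<rho>) \<le> \<delta>" "K * \<rho> \<le> \<delta>" by auto
  qed
  obtain h2 where h2: "h2 > 0" "\<And>s. \<bar>s - t\<bar> < h2 \<Longrightarrow> norm (apply_bcontfun \<gamma> s - x) < \<rho>"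
    by (rule near_point[OF \<rho>(1)]) (rule that)
  define h0 where "h0 = min h1 h2"
  have h0: "h0 > 0" "h0 \<le> h1" "h0 \<le> h2" using h1 h2 by (auto simp: h0_def)
  have main: "dev h \<le> \<epsilon> * (h + h * (norm (chord h))\<^sup>2 + dev h)" if h: "0 < h" "h < h0" for h
  proof -
    let ?a = "t - h" and ?b = "t + h" and ?z = "chord h"
    let ?q = "Lv x ?z"
    have ab: "0 \<le> ?a" "?a \<le> ?b" "?b \<le> T" "?a < ?b" using h h0 h1 by auto
    have ns: "\<bar>s - t\<bar> < h0" if "s \<in> {?a..?b}" for s using that h by auto
    have near: "norm (\<gamma> s - x) \<le> \<rho>" if "s \<in> {?a..?b}" for s
      using h2(2)[of s] ns[OF that] h0 by simp
    have nearF: "\<bar>F (\<gamma> s) (m s) - F x (m t)\<bar> \<le> \<delta>" if "s \<in> {?a..?b}" for s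
      using h1(7)[of s] ns[OF that] h0 by simp
    have zd: "\<gamma> ?b - \<gamma> ?a = (2 * h) *\<^sub>R ?z" using h by (simp add: chord_def)
    have lower: "2 * h * (L x ?z + F x (m t) - \<delta> - K * \<rho> * (1 + 2 * (norm ?z)\<^sup>2))
        + (1 / (2 * c_mu) - 2 * (K * \<rho>)) * dev h \<le> integral {?a..?b} (lag \<gamma>)"
    proof -
      \<comment> \<open>The chord velocity is the mean velocity, so the first-order term of
        \<open>lag_integral_lower\<close> vanishes.\<close>
      have "\<gamma> ?b - \<gamma> ?a - (?b - ?a) *\<^sub>R ?z = 0" using zd by simp
      then show ?thesis
        using lag_integral_lower[OF ab(1-3) R(2) _ near nearF, of ?z] \<rho> by (simp add: dev_def)
    qed
    define l where "l s = (s - ?a) / (2 * h)" for s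
    \<comment> \<open>The pushed chord of \<open>chord_bump\<close>. Its bump vanishes at both ends,
      and its velocity differs from the chord velocity by at most
      \<open>\<omega> * norm ?z\<close>.\<close>
    define p where "p s = \<gamma> ?a + (l s) *\<^sub>R ((2 * h) *\<^sub>R ?z) - (\<omega> * norm ((2 * h) *\<^sub>R ?z) * (l s * (1 - l s))) *\<^sub>R n" for s
    define p' where "p' s = ?z - (\<omega> * norm ?z * (1 - 2 * l s)) *\<^sub>R n" for s
    have l01: "0 \<le> l s" "l s \<le> 1" if "s \<in> {?a..?b}" for s using that h by (auto simp: l_def field_simps)
    have dl: "(l has_real_derivative 1 / (2 * h)) (at s)" for s
      unfolding l_def using h by (auto intro!: derivative_eq_intros)
    have pd: "(p has_vector_derivative p' s) (at s)" for s
    proof -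
      let ?W = "(2 * h) *\<^sub>R ?z" and ?c = "\<omega> * norm ((2 * h) *\<^sub>R ?z)"
      have 1: "((\<lambda>s. l s *\<^sub>R ?W) has_vector_derivative l s *\<^sub>R 0 + (1 / (2 * h)) *\<^sub>R ?W) (at s)"
        by (rule has_vector_derivative_scaleR[OF dl has_vector_derivative_const])
      have 2: "((\<lambda>s. ?c * (l s * (1 - l s))) has_real_derivative ?c * ((1 - 2 * l s) / (2 * h))) (at s)"
        using h by (auto intro!: derivative_eq_intros dl simp: field_simps)
      have 3: "((\<lambda>s. (?c * (l s * (1 - l s))) *\<^sub>R n) has_vector_derivative
          (?c * (l s * (1 - l s))) *\<^sub>R 0 + (?c * ((1 - 2 * l s) / (2 * h))) *\<^sub>R n) (at s)"
        by (rule has_vector_derivative_scaleR[OF 2 has_vector_derivative_const])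
      have "(p has_vector_derivative 0 + (l s *\<^sub>R 0 + (1 / (2 * h)) *\<^sub>R ?W) -
          ((?c * (l s * (1 - l s))) *\<^sub>R 0 + (?c * ((1 - 2 * l s) / (2 * h))) *\<^sub>R n)) (at s)"
        unfolding p_def
        by (rule has_vector_derivative_diff[OF has_vector_derivative_add[OF has_vector_derivative_const 1] 3])
      moreover have "0 + (l s *\<^sub>R 0 + (1 / (2 * h)) *\<^sub>R ?W) -
          ((?c * (l s * (1 - l s))) *\<^sub>R 0 + (?c * ((1 - 2 * l s) / (2 * h))) *\<^sub>R n) = p' s"
        using h by (simp add: p'_def)
      ultimately show ?thesis by simp
    qed
    have p'c: "continuous_on UNIV p'"
      unfolding p'_def l_def using h by (auto intro!: continuous_intros)
    have ends: "p ?a = \<gamma> ?a" "p ?b = \<gamma> ?b"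
    proof -
      have "l ?a = 0" "l ?b = 1" using h by (auto simp: l_def)
      then show "p ?a = \<gamma> ?a" "p ?b = \<gamma> ?b" using zd by (auto simp: p_def algebra_simps)
    qed
    have sum: "\<gamma> ?a + (2 * h) *\<^sub>R ?z = \<gamma> ?b" using zd by (simp add: algebra_simps)
    have na: "norm (\<gamma> ?a - x) \<le> \<rho>" "norm (\<gamma> ?b - x) \<le> \<rho>" using near[of ?a] near[of ?b] h by auto
    have pcl: "p s \<in> closure \<Omega>" if s: "s \<in> {?a..?b}" for s
      unfolding p_def
    proof (rule \<rho>1(2))
      show "\<gamma> ?a \<in> closure \<Omega>" "\<gamma> ?a + (2 * h) *\<^sub>R ?z \<in> closure \<Omega>"
        unfolding sum using Gamma_closure[OF \<gamma>_Gamma] ab by auto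
      show "\<gamma> ?a \<in> ball x \<rho>1" "\<gamma> ?a + (2 * h) *\<^sub>R ?z \<in> ball x \<rho>1"
        unfolding sum using na \<rho>(2) by (auto simp: dist_norm norm_minus_commute)
    qed (use l01[OF s] in auto)
    have pn: "norm (p s - x) \<le> 4 * \<rho>" if s: "s \<in> {?a..?b}" for s
    proof -
      have dz: "norm ((2 * h) *\<^sub>R ?z) \<le> 2 * \<rho>"
        unfolding zd[symmetric] using na norm_triangle_ineq4[of "\<gamma> ?b - x" "\<gamma> ?a - x"] by simp
      have 1: "norm ((l s) *\<^sub>R ((2 * h) *\<^sub>R ?z)) \<le> 1 * (2 * \<rho>)"
        unfolding norm_scaleR[of "l s"] using l01[OF s] dz by (intro mult_mono) auto
      have "\<omega> * norm ((2 * h) *\<^sub>R ?z) * (l s * (1 - l s)) \<le> 1 * (2 * \<rho>) * (1 / 4)"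
      proof (intro mult_mono)
        have "0 \<le> (l s - 1 / 2)\<^sup>2" by simp
        then show "l s * (1 - l s) \<le> 1 / 4" by (simp add: power2_eq_square algebra_simps)
      qed (use \<omega> dz l01[OF s] \<rho> in auto)
      then have 2: "norm ((\<omega> * norm ((2 * h) *\<^sub>R ?z) * (l s * (1 - l s))) *\<^sub>R n) \<le> \<rho>"
        using n1 \<omega> l01[OF s] \<rho>(1) by simp
      have "p s - x = (\<gamma> ?a - x) + (l s) *\<^sub>R ((2 * h) *\<^sub>R ?z) - (\<omega> * norm ((2 * h) *\<^sub>R ?z) * (l s * (1 - l s))) *\<^sub>R n"
        by (simp add: p_def)
      then have "norm (p s - x) \<le> norm (\<gamma> ?a - x) + norm ((l s) *\<^sub>R ((2 * h) *\<^sub>R ?z)) + norm ((\<omega> * norm ((2 * h) *\<^sub>R ?z) * (l s * (1 - l s))) *\<^sub>R n)"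
        by (smt (verit) norm_triangle_ineq norm_triangle_ineq4)
      then show ?thesis using 1 2 na(1) by linarith
    qed
    let ?f = "\<lambda>s. L (p s) (p' s) + F (p s) (m s)"
    let ?A = "L x ?z + c_mu / 2 * (\<omega>\<^sup>2 * (norm ?z)\<^sup>2) + \<delta> * (1 + 4 * (norm ?z)\<^sup>2) + F x (m t) + \<delta> - ?q \<bullet> ?z"
    have upper: "integral {?a..?b} ?f \<le> 2 * h * (L x ?z + c_mu / 2 * (\<omega>\<^sup>2 * (norm ?z)\<^sup>2) + \<delta> * (1 + 4 * (norm ?z)\<^sup>2) + F x (m t) + \<delta>)"
    proof -
      obtain c where fi: "?f integrable_on {?a..?b}"
        by (rule smooth_curve[OF ab(1,4,3) pd p'c pcl]) auto
      \<comment> \<open>Sharing its ends with \<gamma>, the curve p has the chord velocity as its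
        mean velocity. The first-order term of L therefore integrates to zero, and the bump costs
        only a term quadratic in \<omega>.\<close>
      have "(p' has_integral (p ?b - p ?a)) {?a..?b}"
        by (rule fundamental_theorem_of_calculus[OF ab(2)]) (rule has_vector_derivative_at_within[OF pd])
      then have pI: "(p' has_integral ((2 * h) *\<^sub>R ?z)) {?a..?b}" using ends zd by simp
      have "((\<lambda>s. ?A + ?q \<bullet> p' s) has_integral ((?b - ?a) * ?A + ?q \<bullet> ((2 * h) *\<^sub>R ?z))) {?a..?b}"
        using has_integral_add[OF has_integral_const_real[of ?A ?a ?b] has_integral_inner_right[OF pI, of ?q]] ab by simp
      with integrable_integral[OF fi] have "integral {?a..?b} ?f \<le> (?b - ?a) * ?A + ?q \<bullet> ((2 * h) *\<^sub>R ?z)"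
      proof (rule has_integral_le)
        fix s assume s: "s \<in> {?a..?b}"
        have dp: "norm (p' s - ?z) \<le> \<omega> * norm ?z"
        proof -
          have "\<bar>1 - 2 * l s\<bar> \<le> 1" using l01[OF s] by auto
          then have "\<omega> * norm ?z * \<bar>1 - 2 * l s\<bar> \<le> \<omega> * norm ?z * 1" using \<omega> by (intro mult_left_mono) auto
          then show ?thesis using n1 \<omega> by (simp add: p'_def abs_mult)
        qed
        have 1: "L x (p' s) \<le> L x ?z + ?q \<bullet> (p' s - ?z) + c_mu / 2 * (\<omega>\<^sup>2 * (norm ?z)\<^sup>2)"
        proof -
          have "(norm (p' s - ?z))\<^sup>2 \<le> (\<omega> * norm ?z)\<^sup>2" using dp by (intro power_mono) auto
          then have "c_mu / 2 * (norm (p' s - ?z))\<^sup>2 \<le> c_mu / 2 * (\<omega>\<^sup>2 * (norm ?z)\<^sup>2)"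
            using L1_mu by (intro mult_left_mono) (auto simp: power_mult_distrib)
          then show ?thesis using L_quadratic_bounds(2)[OF x_U, of ?z "p' s - ?z"] by simp
        qed
        have "p s \<in> ball x R" using pn[OF s] \<rho> by (simp add: dist_norm norm_minus_commute)
        then have "\<bar>L (p s) (p' s) - L x (p' s)\<bar> \<le> K * (1 + (norm (p' s))\<^sup>2) * norm (p s - x)"
          using L_lipschitz_x[OF convex_ball R(2), of "p s" x "p' s"] R(1) unfolding K_def by simp
        also have "\<dots> \<le> K * (1 + (norm (p' s))\<^sup>2) * (4 * \<rho>)"
          using pn[OF s] K_pos by (intro mult_left_mono) auto
        also have "\<dots> = (K * (4 * \<rho>)) * (1 + (norm (p' s))\<^sup>2)" by simp
        also have "\<dots> \<le> \<delta> * (1 + 4 * (norm ?z)\<^sup>2)"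
        proof (intro mult_mono add_left_mono K\<rho>(1))
          have "norm (p' s) \<le> norm (p' s - ?z) + norm ?z" using norm_triangle_ineq[of "p' s - ?z" ?z] by simp
          also have "\<dots> \<le> 1 * norm ?z + norm ?z" using dp \<omega>(2) mult_right_mono[of \<omega> 1 "norm ?z"] by simp
          finally have "(norm (p' s))\<^sup>2 \<le> (2 * norm ?z)\<^sup>2" by (intro power_mono) auto
          then show "(norm (p' s))\<^sup>2 \<le> 4 * (norm ?z)\<^sup>2" by (simp add: power_mult_distrib)
        qed (use \<delta> in auto)
        finally have 2: "L (p s) (p' s) \<le> L x (p' s) + \<delta> * (1 + 4 * (norm ?z)\<^sup>2)" by linarith
        have 3: "F (p s) (m s) \<le> F x (m t) + \<delta>"
          using h1(6)[OF _ pcl[OF s], of s] ns[OF s] h0 pn[OF s] \<rho> by auto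
        show "?f s \<le> ?A + ?q \<bullet> p' s" using 1 2 3 by (simp add: inner_diff_right)
      qed
      then show ?thesis by (simp add: algebra_simps)
    qed
    have "integral {?a..?b} (lag \<gamma>) \<le> integral {?a..?b} ?f"
      by (rule optimal_segment[OF opt ab(1,4,3) pd p'c pcl ends])
    then have "(1 / (2 * c_mu) - 2 * (K * \<rho>)) * dev h \<le>
        2 * h * (c_mu / 2 * (\<omega>\<^sup>2 * (norm ?z)\<^sup>2) + \<delta> * (1 + 4 * (norm ?z)\<^sup>2) + 2 * \<delta> + K * \<rho> * (1 + 2 * (norm ?z)\<^sup>2))"
      using lower upper by (simp add: algebra_simps)
    also have "\<dots> \<le> 2 * h * (\<delta> / 2 * (norm ?z)\<^sup>2 + \<delta> * (1 + 4 * (norm ?z)\<^sup>2) + 2 * \<delta> + \<delta> * (1 + 2 * (norm ?z)\<^sup>2))"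
    proof (intro mult_left_mono add_mono order_refl)
      have "c_mu / 2 * (\<omega>\<^sup>2 * (norm ?z)\<^sup>2) = (c_mu * \<omega>\<^sup>2) / 2 * (norm ?z)\<^sup>2" by simp
      also have "\<dots> \<le> \<delta> / 2 * (norm ?z)\<^sup>2" using \<omega>(3) by (intro mult_right_mono) auto
      finally show "c_mu / 2 * (\<omega>\<^sup>2 * (norm ?z)\<^sup>2) \<le> \<delta> / 2 * (norm ?z)\<^sup>2" .
      show "K * \<rho> * (1 + 2 * (norm ?z)\<^sup>2) \<le> \<delta> * (1 + 2 * (norm ?z)\<^sup>2)"
        using K\<rho>(2) by (intro mult_right_mono) auto
    qed (use h \<delta> in auto)
    also have "\<dots> = \<delta> * (8 * h + 13 * (h * (norm ?z)\<^sup>2))" by (simp add: algebra_simps)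
    finally have 1: "dev h / (2 * c_mu) \<le> \<delta> * (8 * h + 13 * (h * (norm ?z)\<^sup>2)) + 2 * (K * \<rho>) * dev h"
      by (simp add: algebra_simps)
    have dev0: "0 \<le> dev h" unfolding dev_def by (rule integral_nonneg[OF deviation_integrable]) (use ab in auto)
    have "2 * (K * \<rho>) * dev h \<le> 2 * \<delta> * dev h" using K\<rho>(2) dev0 by (intro mult_right_mono) auto
    then have "dev h / (2 * c_mu) \<le> \<delta> * (8 * h + 13 * (h * (norm ?z)\<^sup>2) + 2 * dev h)"
      using 1 by (simp add: algebra_simps)
    also have "\<dots> \<le> \<delta> * (13 * (h + h * (norm ?z)\<^sup>2 + dev h))"
      using \<delta> h dev0 by (intro mult_left_mono) auto
    finally have "dev h \<le> (2 * c_mu) * (\<delta> * (13 * (h + h * (norm ?z)\<^sup>2 + dev h)))"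
      using L1_mu by (simp add: field_simps)
    also have "\<dots> = \<epsilon> * (h + h * (norm ?z)\<^sup>2 + dev h)" using L1_mu by (simp add: \<delta>_def)
    finally show ?thesis .
  qed
  show ?thesis by (rule that[OF h0(1)]) (use h0 h1 main in auto)
qed

end

section \<open>The equation on the tangent hyperplane\<close>

context mfg_contact
begin

text \<open>By dynamic programming the running cost over [t - h, t] is at most the drop of u along
  \<gamma>, and the superdifferential bounds this drop, the displacement from (t, x) being -h in
  time and -h \<open>vel h\<close> in space.\<close>

lemma superdiff_past:
  assumes p: "(p1, p2) \<in> superdiff \<Omega> T u t x" and "\<epsilon> > 0"
  obtains h0 where "h0 > 0" "\<And>h. 0 < h \<Longrightarrow> h < h0 \<Longrightarrow>
    integral {t - h..t} (lag \<gamma>) \<le> h * (- p1 - p2 \<bullet> vel h + \<epsilon> * (1 + norm (vel h)))"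
proof -
  obtain \<delta> where \<delta>: "\<delta> > 0" "\<And>s y. s \<in> {0<..<T} \<Longrightarrow> y \<in> closure \<Omega> \<Longrightarrow> \<bar>s - t\<bar> + norm (y - x) < \<delta> \<Longrightarrow>
      u s y - u t x - p1 * (s - t) - p2 \<bullet> (y - x) \<le> \<epsilon> * (\<bar>s - t\<bar> + norm (y - x))"
    using p \<open>\<epsilon> > 0\<close> unfolding superdiff_def by auto
  obtain h1 where h1: "h1 > 0" "h1 \<le> \<delta> / 2" "h1 < t" "\<And>s. \<bar>s - t\<bar> < h1 \<Longrightarrow> norm (apply_bcontfun \<gamma> s - x) < \<delta> / 2"
    by (rule near_point[OF half_gt_zero[OF \<delta>(1)]]) (rule that)
  have "integral {t - h..t} (lag \<gamma>) \<le> h * (- p1 - p2 \<bullet> vel h + \<epsilon> * (1 + norm (vel h)))" if h: "0 < h" "h < h1" for h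
  proof -
    let ?s = "t - h"
    have vh: "\<gamma> ?s - x = - (h *\<^sub>R vel h)" using h by (simp add: vel_def)
    have s: "?s \<in> {0<..<T}" "\<bar>?s - t\<bar> = h" using h h1 t by auto
    have "\<gamma> ?s \<in> closure \<Omega>" using Gamma_closure[OF \<gamma>_Gamma, of ?s] s by auto
    moreover have "\<bar>?s - t\<bar> + norm (\<gamma> ?s - x) < \<delta>" using h1(2) h1(4)[of ?s] s h by auto
    ultimately have "u ?s (\<gamma> ?s) - u t x - p1 * (?s - t) - p2 \<bullet> (\<gamma> ?s - x) \<le> \<epsilon> * (\<bar>?s - t\<bar> + norm (\<gamma> ?s - x))"
      using \<delta>(2) s by blast
    then have "u ?s (\<gamma> ?s) - u t x \<le> h * (- p1 - p2 \<bullet> vel h + \<epsilon> * (1 + norm (vel h)))"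
      unfolding vh using h by (simp add: algebra_simps)
    moreover have "integral {?s..t} (lag \<gamma>) + u t (\<gamma> t) \<le> u ?s (\<gamma> ?s)"
      using value_along_optimal[OF opt, of ?s t] h h1 t by auto
    ultimately show ?thesis using \<gamma>_t by simp
  qed
  then show ?thesis by (rule that[OF h1(1)])
qed

text \<open>Integrated coercivity; \<open>deviation_lower\<close> with w = 0 passes from the energy
  to the mean velocity.\<close>

lemma past_energy:
  assumes h: "0 < h" "h \<le> t"
  shows "h * ((norm (vel h))\<^sup>2 / (4 * c_mu) - (C0 + F_bd)) \<le> integral {t - h..t} (lag \<gamma>)"
proof -
  let ?a = "t - h" and ?f = "\<lambda>s. L (\<gamma> s) (dens s) + F (\<gamma> s) (m s)"
  have ab: "0 \<le> ?a" "?a < t" "?a \<le> t" "t \<le> T" using h t by auto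
  have "?f integrable_on {?a..t}" by (rule integrable_on_subinterval[OF dens_lag]) (use ab in auto)
  then have fi: "(?f has_integral integral {?a..t} (lag \<gamma>)) {?a..t}"
    using lag_dens[of ?a t] integrable_integral by fastforce
  let ?E = "integral {?a..t} (\<lambda>s. (norm (dens s))\<^sup>2)"
  have Ei: "(\<lambda>s. (norm (dens s))\<^sup>2) integrable_on {?a..t}"
    by (rule integrable_on_subinterval[OF dens_sq]) (use ab in auto)
  have "((\<lambda>s. 1 / (4 * c_mu) * (norm (dens s))\<^sup>2 + (- (C0 + F_bd))) has_integral
      1 / (4 * c_mu) * ?E + (t - ?a) * (- (C0 + F_bd))) {?a..t}"
    using has_integral_add[OF has_integral_mult_right[OF integrable_integral[OF Ei], of "1 / (4 * c_mu)"]
        has_integral_const_real[of "- (C0 + F_bd)" ?a t]] ab by simp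
  from this fi have "1 / (4 * c_mu) * ?E + (t - ?a) * (- (C0 + F_bd)) \<le> integral {?a..t} (lag \<gamma>)"
  proof (rule has_integral_le)
    fix s assume "s \<in> {?a..t}"
    then have s: "s \<in> {0..T}" using ab by auto
    show "1 / (4 * c_mu) * (norm (dens s))\<^sup>2 + (- (C0 + F_bd)) \<le> ?f s"
      using L_coercive[OF Gamma_U[OF \<gamma>_Gamma s], of "dens s"] F_bd(2)[OF s Gamma_closure[OF \<gamma>_Gamma s]] by auto
  qed
  moreover have "h * (norm (vel h))\<^sup>2 \<le> ?E"
    using deviation_lower[OF ab(1,2,4), of 0] h \<gamma>_t by (simp add: vel_def)
  then have "1 / (4 * c_mu) * (h * (norm (vel h))\<^sup>2) \<le> 1 / (4 * c_mu) * ?E"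
    using L1_mu by (intro mult_left_mono) auto
  ultimately show ?thesis by (simp add: algebra_simps)
qed

text \<open>The running cost grows quadratically in the mean velocity, whereas the
  superdifferential, used with \<epsilon> = 1, allows linear growth only.\<close>

lemma vel_bounded:
  assumes p: "(p1, p2) \<in> superdiff \<Omega> T u t x"
  obtains B h0 where "B \<ge> 0" "h0 > 0" "\<And>h. 0 < h \<Longrightarrow> h < h0 \<Longrightarrow> norm (vel h) \<le> B"
proof -
  obtain h1 where h1: "h1 > 0" "\<And>h. 0 < h \<Longrightarrow> h < h1 \<Longrightarrow>
    integral {t - h..t} (lag \<gamma>) \<le> h * (- p1 - p2 \<bullet> vel h + 1 * (1 + norm (vel h)))"
    by (rule superdiff_past[OF p zero_less_one]) (rule that)
  define A where "A = (\<bar>C0 + F_bd\<bar> + \<bar>p1\<bar> + 1) + (norm p2 + 1)"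
  have A: "A \<ge> 0" by (simp add: A_def)
  have "norm (vel h) \<le> max 1 (4 * c_mu * A)" if h: "0 < h" "h < min h1 t" for h
  proof (cases "norm (vel h) \<le> 1")
    case False
    let ?n = "norm (vel h)"
    have "h * (?n\<^sup>2 / (4 * c_mu) - (C0 + F_bd)) \<le> h * (- p1 - p2 \<bullet> vel h + 1 * (1 + ?n))"
      by (rule order_trans[OF past_energy h1(2)]) (use h in auto)
    then have "?n\<^sup>2 / (4 * c_mu) - (C0 + F_bd) \<le> - p1 - p2 \<bullet> vel h + (1 + ?n)" using h by simp
    moreover have "- (p2 \<bullet> vel h) \<le> norm p2 * ?n" using Cauchy_Schwarz_ineq2[of p2 "vel h"] by linarith
    ultimately have "?n\<^sup>2 / (4 * c_mu) \<le> (\<bar>C0 + F_bd\<bar> + \<bar>p1\<bar> + 1) * 1 + (norm p2 + 1) * ?n"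
      by (simp add: algebra_simps)
    also have "\<dots> \<le> (\<bar>C0 + F_bd\<bar> + \<bar>p1\<bar> + 1) * ?n + (norm p2 + 1) * ?n"
      using False by (intro add_right_mono mult_left_mono) auto
    also have "\<dots> = A * ?n" by (simp add: A_def algebra_simps)
    finally have "?n * ?n \<le> (4 * c_mu * A) * ?n" using L1_mu by (simp add: power2_eq_square field_simps)
    moreover have "0 < ?n" using False by linarith
    ultimately have "?n \<le> 4 * c_mu * A" by (simp only: mult_le_cancel_right_pos)
    then show ?thesis by simp
  qed simp
  moreover have "min h1 t > 0" using h1(1) t by simp
  ultimately show ?thesis using that[of "max 1 (4 * c_mu * A)" "min h1 t"] by simp
qed

lemma vel_chord_dev:
  assumes h: "0 < h" "h < t" "t + h < T"
  shows "h * (norm (vel h - chord h))\<^sup>2 \<le> dev h"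
proof -
  have "h * (norm (vel h - chord h))\<^sup>2 \<le> integral {t - h..t} (\<lambda>s. (norm (dens s - chord h))\<^sup>2)"
    using deviation_lower[of "t - h" t "chord h"] h t \<gamma>_t by (simp add: vel_def)
  also have "\<dots> \<le> dev h" unfolding dev_def
    by (rule integral_subset_le) (use h t in \<open>auto intro!: deviation_integrable\<close>)
  finally show ?thesis .
qed

text \<open>\<open>deviation_small\<close> bounds the deviation in terms of itself and of the chord
  velocity. The chord velocity is within the deviation of the bounded past velocity, so everything
  unbounded can be moved to the left.\<close>

lemma vel_chord_close:
  assumes B: "B \<ge> 0" "h0 > 0" "\<And>h. 0 < h \<Longrightarrow> h < h0 \<Longrightarrow> norm (vel h) \<le> B" and "\<epsilon> > 0"
  obtains h1 where "h1 > 0" "h1 < t" "t + h1 < T" "\<And>h. 0 < h \<Longrightarrow> h < h1 \<Longrightarrow> (norm (vel h - chord h))\<^sup>2 \<le> \<epsilon>"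
proof -
  define C where "C = 1 + 2 * B\<^sup>2"
  have C: "C > 0" by (simp add: C_def add_pos_nonneg)
  \<comment> \<open>The chord velocity contributes 2 dev and the deviation itself 1 dev, so e \<le>
    1/6 lets half of dev be absorbed; the second entry turns the remaining 2 e C into at most
    \<epsilon>.\<close>
  define e where "e = min (1 / 6) (\<epsilon> / (2 * C))"
  have e: "e > 0" "e \<le> 1 / 6" "2 * e * C \<le> \<epsilon>"
  proof -
    show "e > 0" "e \<le> 1 / 6" using \<open>\<epsilon> > 0\<close> C by (auto simp: e_def)
    have "e \<le> \<epsilon> / (2 * C)" by (simp add: e_def)
    then show "2 * e * C \<le> \<epsilon>" using C by (simp add: field_simps)
  qed
  obtain h2 where h2: "h2 > 0" "h2 < t" "t + h2 < T"
    "\<And>h. 0 < h \<Longrightarrow> h < h2 \<Longrightarrow> dev h \<le> e * (h + h * (norm (chord h))\<^sup>2 + dev h)"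
    by (rule deviation_small[OF e(1)]) (rule that)
  have "(norm (vel h - chord h))\<^sup>2 \<le> \<epsilon>" if h: "0 < h" "h < min h0 h2" for h
  proof -
    let ?z = "chord h" and ?v = "vel h"
    have vd: "h * (norm (?v - ?z))\<^sup>2 \<le> dev h" by (rule vel_chord_dev) (use h h2 in auto)
    have "norm ?z \<le> norm ?v + norm (?v - ?z)" using norm_triangle_ineq4[of ?v "?v - ?z"] by simp
    then have "(norm ?z)\<^sup>2 \<le> (norm ?v + norm (?v - ?z))\<^sup>2" by (intro power_mono) auto
    also have "\<dots> \<le> 2 * (norm ?v)\<^sup>2 + 2 * (norm (?v - ?z))\<^sup>2"
      using sum_squares_bound[of "norm ?v" "norm (?v - ?z)"] by (simp add: power2_sum)
    also have "\<dots> \<le> 2 * B\<^sup>2 + 2 * (norm (?v - ?z))\<^sup>2"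
      using B(3)[of h] h by (simp add: power_mono)
    finally have "h * (norm ?z)\<^sup>2 \<le> h * (2 * B\<^sup>2 + 2 * (norm (?v - ?z))\<^sup>2)" using h by simp
    also have "\<dots> \<le> h * (2 * B\<^sup>2) + 2 * dev h" using vd by (simp add: algebra_simps)
    finally have hz: "h * (norm ?z)\<^sup>2 \<le> h * (2 * B\<^sup>2) + 2 * dev h" .
    have "dev h \<le> e * (h + h * (norm ?z)\<^sup>2 + dev h)" using h2(4) h by simp
    also have "\<dots> \<le> e * (h * C + 3 * dev h)"
      using hz e(1) by (intro mult_left_mono) (auto simp: C_def algebra_simps)
    also have "\<dots> = e * C * h + (3 * e) * dev h" by (simp add: algebra_simps)
    also have "\<dots> \<le> e * C * h + (1 / 2) * dev h"
    proof (intro add_left_mono mult_right_mono)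
      show "0 \<le> dev h" using vd h by (smt (verit) mult_nonneg_nonneg zero_le_power2)
    qed (use e in auto)
    finally have "dev h \<le> (2 * e * C) * h" by simp
    also have "\<dots> \<le> \<epsilon> * h" using e(3) h by (intro mult_right_mono) auto
    finally have "h * (norm (?v - ?z))\<^sup>2 \<le> h * \<epsilon>" using vd by (simp add: mult.commute)
    then show ?thesis using h by simp
  qed
  then show ?thesis using that[of "min h0 h2"] B(2) h2 by auto
qed

lemma vel_subsolution:
  assumes p: "(p1, p2) \<in> superdiff \<Omega> T u t x" and "\<epsilon> > 0"
  obtains h0 where "h0 > 0" "\<And>h. 0 < h \<Longrightarrow> h < h0 \<Longrightarrow>
    L x (vel h) + F x (m t) + p1 + p2 \<bullet> vel h \<le> \<epsilon> * (3 + norm (vel h) + 2 * (norm (vel h))\<^sup>2)"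
proof -
  obtain R where R: "R > 0" "ball x R \<subseteq> U" using U(1) x_U openE by blast
  \<comment> \<open>The first entry keeps the curve inside a ball contained in U, the second makes
    the freezing error at most \<epsilon>, and the third keeps the coefficient of the deviation
    nonnegative.\<close>
  define \<rho> where "\<rho> = min (R / 2) (min (\<epsilon> / K) (1 / (4 * c_mu * K)))"
  have \<rho>: "\<rho> > 0" "\<rho> < R" "K * \<rho> \<le> \<epsilon>" "K * \<rho> \<le> 1 / (4 * c_mu)"
  proof -
    show "\<rho> > 0" using R(1) \<open>\<epsilon> > 0\<close> K_pos L1_mu by (simp add: \<rho>_def)
    have le: "\<rho> \<le> R / 2" "\<rho> \<le> \<epsilon> / K" "\<rho> \<le> 1 / (4 * c_mu * K)"
      unfolding \<rho>_def by (meson min.cobounded1 min.cobounded2 order_trans)+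
    show "\<rho> < R" using le(1) R(1) by linarith
    show "K * \<rho> \<le> \<epsilon>" "K * \<rho> \<le> 1 / (4 * c_mu)" using le(2,3) K_pos L1_mu by (auto simp: field_simps)
  qed
  obtain h1 where h1: "h1 > 0" "h1 < t" "\<And>s. \<bar>s - t\<bar> < h1 \<Longrightarrow> norm (apply_bcontfun \<gamma> s - x) < \<rho>"
    by (rule near_point[OF \<rho>(1)]) (rule that)
  obtain h2 where h2: "h2 > 0" "\<And>s. \<bar>s - t\<bar> < h2 \<Longrightarrow> \<bar>F (apply_bcontfun \<gamma> s) (m s) - F x (m t)\<bar> < \<epsilon>"
    by (rule near_point[OF \<open>\<epsilon> > 0\<close>]) (rule that)
  obtain h3 where h3: "h3 > 0" "\<And>h. 0 < h \<Longrightarrow> h < h3 \<Longrightarrow>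
    integral {t - h..t} (lag \<gamma>) \<le> h * (- p1 - p2 \<bullet> vel h + \<epsilon> * (1 + norm (vel h)))"
    by (rule superdiff_past[OF p \<open>\<epsilon> > 0\<close>]) (rule that)
  have "L x (vel h) + F x (m t) + p1 + p2 \<bullet> vel h \<le> \<epsilon> * (3 + norm (vel h) + 2 * (norm (vel h))\<^sup>2)"
    if h: "0 < h" "h < min h1 (min h2 h3)" for h
  proof -
    let ?v = "vel h"
    have ab: "0 \<le> t - h" "t - h \<le> t" "t \<le> T" using h h1 t by auto
    have near: "norm (\<gamma> s - x) \<le> \<rho>" if "s \<in> {t - h..t}" for s using h1(3)[of s] that h by auto
    have nearF: "\<bar>F (\<gamma> s) (m s) - F x (m t)\<bar> \<le> \<epsilon>" if "s \<in> {t - h..t}" for s using h2(2)[of s] that h by auto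
    let ?S = "integral {t - h..t} (\<lambda>s. (norm (dens s - ?v))\<^sup>2)"
    have "0 \<le> ?S" by (rule integral_nonneg[OF deviation_integrable]) (use ab in auto)
    moreover have "0 \<le> 1 / (2 * c_mu) - 2 * (K * \<rho>)" using \<rho>(4) L1_mu by (simp add: field_simps)
    ultimately have "0 \<le> (1 / (2 * c_mu) - 2 * (K * \<rho>)) * ?S" by simp
    moreover have "\<gamma> t - \<gamma> (t - h) - (t - (t - h)) *\<^sub>R ?v = 0" using h \<gamma>_t by (simp add: vel_def)
    ultimately have "h * (L x ?v + F x (m t) - \<epsilon> - K * \<rho> * (1 + 2 * (norm ?v)\<^sup>2)) \<le> integral {t - h..t} (lag \<gamma>)"
      using lag_integral_lower[OF ab R(2) \<rho>(2) near nearF, of ?v] by simp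
    also have "\<dots> \<le> h * (- p1 - p2 \<bullet> ?v + \<epsilon> * (1 + norm ?v))" using h3(2)[of h] h by simp
    finally have "L x ?v + F x (m t) - \<epsilon> - K * \<rho> * (1 + 2 * (norm ?v)\<^sup>2) \<le> - p1 - p2 \<bullet> ?v + \<epsilon> * (1 + norm ?v)"
      using h by simp
    moreover have "K * \<rho> * (1 + 2 * (norm ?v)\<^sup>2) \<le> \<epsilon> * (1 + 2 * (norm ?v)\<^sup>2)" using \<rho>(3) by (intro mult_right_mono) auto
    ultimately show ?thesis by (simp add: algebra_simps)
  qed
  moreover have "min h1 (min h2 h3) > 0" using h1 h2 h3 by simp
  ultimately show ?thesis using that by blast
qed

lemma continuous_L_v: "continuous_on UNIV (L x)"
  by (intro continuous_at_imp_continuous_on ballI has_derivative_continuous[OF has_derivative_L_v[OF x_U]])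

text \<open>w is a limit of past mean velocities. Seen from x, past positions lie in the directions
  - \<open>vel\<close> and future ones in the directions of the mean velocities after t; these tend
  to -w and w, so \<open>tangent_sign\<close> applies with both signs.\<close>

lemma tangential_velocity_exists:
  assumes p: "(p1, p2) \<in> superdiff \<Omega> T u t x"
  obtains w where "gr x \<bullet> w = 0" "L x w + F x (m t) + p1 + p2 \<bullet> w \<le> 0"
proof -
  obtain B h0 where B: "B \<ge> 0" "h0 > 0" "\<And>h. 0 < h \<Longrightarrow> h < h0 \<Longrightarrow> norm (vel h) \<le> B"
    by (rule vel_bounded[OF p]) (rule that)
  define h1 where "h1 = min h0 (min t (T - t))"
  have h1: "h1 > 0" "h1 \<le> h0" "h1 \<le> t" "h1 \<le> T - t"
    using B(2) t by (auto simp: h1_def)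
  \<comment> \<open>The shift by 2 keeps \<open>H k\<close> strictly below \<open>h1\<close> already
    for k = 0.\<close>
  define H where "H k = h1 / real (k + 2)" for k
  have H: "H k > 0" "H k < h1" for k
    using h1(1) by (auto simp: H_def divide_less_eq)
  have Hlim: "H \<longlonglongrightarrow> 0"
    unfolding H_def using LIMSEQ_ignore_initial_segment[OF lim_const_over_n[of h1], of 2] by simp
  have "\<forall>k. vel (H k) \<in> cball 0 B" using B(3)[OF H(1)] H(2) h1(2) by (auto intro: less_le_trans)
  moreover have "seq_compact (cball 0 B :: 'a set)" by (simp add: compact_imp_seq_compact)
  ultimately obtain w k where k: "strict_mono (k :: nat \<Rightarrow> nat)" and w: "((\<lambda>i. vel (H i)) \<circ> k) \<longlonglongrightarrow> w"
    unfolding seq_compact_def by metis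
  define h where "h i = H (k i)" for i
  have h: "h i > 0" "h i < h0" "h i < t" "t + h i < T" for i
    using H[of "k i"] h1 by (auto simp: h_def)
  have hlim: "h \<longlonglongrightarrow> 0" using LIMSEQ_subseq_LIMSEQ[OF Hlim k] by (simp add: h_def[abs_def] o_def)
  have vlim: "(\<lambda>i. vel (h i)) \<longlonglongrightarrow> w" using w by (simp add: h_def o_def)
  have small: "eventually (\<lambda>i. h i < e) sequentially" if "e > 0" for e
    using order_tendstoD(2)[OF hlim that] .
  have dlim: "(\<lambda>i. vel (h i) - chord (h i)) \<longlonglongrightarrow> 0"
  proof (rule tendstoI)
    fix e :: real assume "e > 0"
    obtain h2 where h2: "h2 > 0" "\<And>h. 0 < h \<Longrightarrow> h < h2 \<Longrightarrow> (norm (vel h - chord h))\<^sup>2 \<le> (e / 2)\<^sup>2"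
      by (rule vel_chord_close[OF B, of "(e / 2)\<^sup>2"]) (use \<open>e > 0\<close> that in auto)
    show "eventually (\<lambda>i. dist (vel (h i) - chord (h i)) 0 < e) sequentially"
      using small[OF h2(1)]
    proof eventually_elim
      case (elim i)
      have "(norm (vel (h i) - chord (h i)))\<^sup>2 \<le> (e / 2)\<^sup>2" using h2(2) h(1) elim by blast
      then have "norm (vel (h i) - chord (h i)) \<le> e / 2" by (rule power2_le_imp_le) (use \<open>e > 0\<close> in simp)
      then show ?case using \<open>e > 0\<close> by simp
    qed
  qed
  \<comment> \<open>Twice the chord velocity minus the past velocity, that is, the mean velocity
    over [t, t + h i], written as a perturbation of the past velocity.\<close>
  have "(\<lambda>i. vel (h i) - 2 *\<^sub>R (vel (h i) - chord (h i))) \<longlonglongrightarrow> w - 2 *\<^sub>R 0"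
    by (intro tendsto_intros vlim dlim)
  then have flim: "(\<lambda>i. vel (h i) - 2 *\<^sub>R (vel (h i) - chord (h i))) \<longlonglongrightarrow> w" by simp
  have cl: "\<gamma> s \<in> closure \<Omega>" if "0 \<le> s" "s \<le> T" for s using Gamma_closure[OF \<gamma>_Gamma] that by auto
  have "gr x \<bullet> (- w) \<le> 0"
  proof (rule tangent_sign[OF hlim h(1) tendsto_minus[OF vlim]])
    fix i
    have "x + h i *\<^sub>R - vel (h i) = \<gamma> (t - h i)" using h(1)[of i] by (simp add: vel_def)
    then show "x + h i *\<^sub>R - vel (h i) \<in> closure \<Omega>" using cl[of "t - h i"] h[of i] t by auto
  qed
  moreover have "gr x \<bullet> w \<le> 0"
  proof (rule tangent_sign[OF hlim h(1) flim])
    fix i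
    let ?h = "h i"
    have "?h *\<^sub>R vel ?h = x - \<gamma> (t - ?h)" "(2 * ?h) *\<^sub>R chord ?h = \<gamma> (t + ?h) - \<gamma> (t - ?h)"
      using h(1)[of i] by (auto simp: vel_def chord_def)
    moreover have "x + ?h *\<^sub>R (vel ?h - 2 *\<^sub>R (vel ?h - chord ?h)) = x - ?h *\<^sub>R vel ?h + (2 * ?h) *\<^sub>R chord ?h"
      unfolding mult_2 scaleR_left_distrib by (simp add: algebra_simps scaleR_2)
    ultimately have "x + ?h *\<^sub>R (vel ?h - 2 *\<^sub>R (vel ?h - chord ?h)) = \<gamma> (t + ?h)" by simp
    then show "x + ?h *\<^sub>R (vel ?h - 2 *\<^sub>R (vel ?h - chord ?h)) \<in> closure \<Omega>" using cl[of "t + ?h"] h[of i] t by auto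
  qed
  ultimately have tang: "gr x \<bullet> w = 0" by simp
  have "L x w + F x (m t) + p1 + p2 \<bullet> w \<le> 0"
  proof (rule field_le_epsilon)
    fix e :: real assume "e > 0"
    define C where "C = 3 + B + 2 * B\<^sup>2"
    have C: "C > 0" using B(1) by (simp add: C_def add_pos_nonneg)
    have "e / C > 0" using \<open>e > 0\<close> C by simp
    then obtain h2 where h2: "h2 > 0" "\<And>h. 0 < h \<Longrightarrow> h < h2 \<Longrightarrow>
        L x (vel h) + F x (m t) + p1 + p2 \<bullet> vel h \<le> e / C * (3 + norm (vel h) + 2 * (norm (vel h))\<^sup>2)"
      by (rule vel_subsolution[OF p]) (rule that)
    have "(\<lambda>i. L x (vel (h i)) + F x (m t) + p1 + p2 \<bullet> vel (h i)) \<longlonglongrightarrow> L x w + F x (m t) + p1 + p2 \<bullet> w"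
      by (intro tendsto_intros vlim continuous_on_tendsto_compose[OF continuous_L_v vlim]) auto
    moreover have "eventually (\<lambda>i. L x (vel (h i)) + F x (m t) + p1 + p2 \<bullet> vel (h i) \<le> e) sequentially"
      using small[OF h2(1)]
    proof eventually_elim
      case (elim i)
      have n: "norm (vel (h i)) \<le> B" using B(3) h by blast
      then have "(norm (vel (h i)))\<^sup>2 \<le> B\<^sup>2" by (intro power_mono) auto
      then have "e / C * (3 + norm (vel (h i)) + 2 * (norm (vel (h i)))\<^sup>2) \<le> e / C * C"
        using n \<open>e / C > 0\<close> by (intro mult_left_mono) (auto simp: C_def)
      then show ?case using h2(2)[OF h(1) elim] C by simp
    qed
    ultimately have "L x w + F x (m t) + p1 + p2 \<bullet> w \<le> e" by (rule tendsto_upperbound) simp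
    then show "L x w + F x (m t) + p1 + p2 \<bullet> w \<le> 0 + e" by simp
  qed
  with tang that show ?thesis by blast
qed

lemma inward_supersolution:
  assumes p: "(p1, p2) \<in> superdiff \<Omega> T u t x" and w: "gr x \<bullet> w < 0"
  shows "0 \<le> L x w + F x (m t) + p1 + p2 \<bullet> w"
proof (rule field_le_epsilon)
  fix e :: real assume "e > 0"
  \<comment> \<open>One \<epsilon> is spent on the running cost and \<open>1 + norm w\<close> of
    them on the superdifferential, whose increment is h in time and h times \<open>norm w\<close> in
    space.\<close>
  define \<epsilon> where "\<epsilon> = e / (2 + norm w)"
  have nw: "2 + norm w > 0" by (simp add: add_pos_nonneg)
  have \<epsilon>: "\<epsilon> > 0" "\<epsilon> * (2 + norm w) = e" using \<open>e > 0\<close> nw by (auto simp: \<epsilon>_def)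
  obtain d where d: "d > 0" "\<And>s. 0 \<le> s \<Longrightarrow> s < d \<Longrightarrow> x + s *\<^sub>R w \<in> closure \<Omega>"
    by (rule inward_segment[OF w]) (rule that)
  obtain \<delta> where \<delta>: "\<delta> > 0" "\<And>s y. s \<in> {0<..<T} \<Longrightarrow> y \<in> closure \<Omega> \<Longrightarrow> \<bar>s - t\<bar> + norm (y - x) < \<delta> \<Longrightarrow>
      u s y - u t x - p1 * (s - t) - p2 \<bullet> (y - x) \<le> \<epsilon> * (\<bar>s - t\<bar> + norm (y - x))"
    using p \<epsilon>(1) unfolding superdiff_def by auto
  define q where "q s = x + (s - t) *\<^sub>R w" for s
  have qd: "(q has_vector_derivative w) (at s)" for s
    unfolding q_def by (auto intro!: derivative_eq_intros)
  define b where "b = min (t + d / 2) ((t + T) / 2)"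
  have b: "t < b" "b \<le> t + d / 2" "b < T" using d(1) t by (auto simp: b_def min_def)
  have qcl: "q s \<in> closure \<Omega>" if "s \<in> {t..b}" for s
    unfolding q_def using that b d(1) by (intro d(2)) auto
  let ?f = "\<lambda>s. L (q s) w + F (q s) (m s)"
  have qc: "continuous_on S q" for S unfolding q_def by (intro continuous_intros)
  have "continuous_on {t..b} ((\<lambda>(y, v). L y v) \<circ> (\<lambda>s. (q s, w)))"
    using qcl U(2) by (intro continuous_on_compose continuous_on_subset[OF continuous_L] continuous_intros qc) auto
  then have "continuous_on {t..b} ?f"
    using qcl b t by (intro continuous_intros continuous_on_F_curve qc) (auto simp: o_def)
  then obtain \<delta>2 where \<delta>2: "\<delta>2 > 0" "\<And>s. s \<in> {t..b} \<Longrightarrow> dist s t < \<delta>2 \<Longrightarrow> dist (?f s) (?f t) < \<epsilon>"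
    using b(1) \<epsilon>(1) unfolding continuous_on_iff by fastforce
  define h where "h = min (b - t) (min (\<delta> / (2 + norm w)) \<delta>2) / 2"
  have "min (b - t) (min (\<delta> / (2 + norm w)) \<delta>2) > 0" using b \<delta>(1) \<delta>2(1) nw by simp
  moreover have "min (b - t) (min (\<delta> / (2 + norm w)) \<delta>2) \<le> b - t" "min (b - t) (min (\<delta> / (2 + norm w)) \<delta>2) \<le> \<delta> / (2 + norm w)"
    "min (b - t) (min (\<delta> / (2 + norm w)) \<delta>2) \<le> \<delta>2"
    by (meson min.cobounded1 min.cobounded2 order_trans)+
  ultimately have h: "h > 0" "t + h \<le> b" "h < \<delta> / (2 + norm w)" "h < \<delta>2"
    unfolding h_def by linarith+
  have ab: "0 \<le> t" "t < t + h" "t + h \<le> T" using h b t by auto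
  have hd: "h * (2 + norm w) < \<delta>" using h(3) nw by (simp add: field_simps)
  have cl: "q s \<in> closure \<Omega>" if "s \<in> {t..t + h}" for s using qcl that h(2) by auto
  have "u t (q t) \<le> integral {t..t + h} ?f + u (t + h) (q (t + h))"
    by (rule value_le_curve[OF ab qd _ cl]) auto
  moreover have "integral {t..t + h} ?f \<le> h * (L x w + F x (m t) + \<epsilon>)"
  proof -
    obtain c where fi: "?f integrable_on {t..t + h}"
      by (rule smooth_curve[OF ab qd _ cl]) auto
    have "integral {t..t + h} ?f \<le> integral {t..t + h} (\<lambda>s. L x w + F x (m t) + \<epsilon>)"
    proof (rule integral_le[OF fi integrable_const_ivl])
      fix s assume s: "s \<in> {t..t + h}"
      have "dist (?f s) (?f t) < \<epsilon>" using s h by (intro \<delta>2(2)) (auto simp: dist_real_def)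
      then show "?f s \<le> L x w + F x (m t) + \<epsilon>" by (simp add: q_def dist_real_def)
    qed
    then show ?thesis using h(1) by simp
  qed
  moreover have "u (t + h) (q (t + h)) - u t x \<le> h * (p1 + p2 \<bullet> w + \<epsilon> * (1 + norm w))"
  proof -
    have qh: "q (t + h) - x = h *\<^sub>R w" by (simp add: q_def)
    have "h + h * norm w < \<delta>" using hd h(1) by (simp add: algebra_simps)
    then have "u (t + h) (q (t + h)) - u t x - p1 * (t + h - t) - p2 \<bullet> (q (t + h) - x)
        \<le> \<epsilon> * (\<bar>t + h - t\<bar> + norm (q (t + h) - x))"
      using h b t cl by (intro \<delta>(2)) (auto simp: qh)
    then show ?thesis unfolding qh using h(1) by (simp add: algebra_simps)
  qed
  ultimately have "0 \<le> h * (L x w + F x (m t) + p1 + p2 \<bullet> w + \<epsilon> * (2 + norm w))"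
    by (simp add: q_def algebra_simps)
  then have "0 \<le> L x w + F x (m t) + p1 + p2 \<bullet> w + \<epsilon> * (2 + norm w)"
    using h(1) by (simp add: zero_le_mult_iff)
  then show "0 \<le> L x w + F x (m t) + p1 + p2 \<bullet> w + e" using \<epsilon>(2) by simp
qed

lemma tangential_supersolution:
  assumes p: "(p1, p2) \<in> superdiff \<Omega> T u t x" and w: "gr x \<bullet> w = 0"
  shows "0 \<le> L x w + F x (m t) + p1 + p2 \<bullet> w"
proof -
  define W where "W k = w - (1 / real (Suc k)) *\<^sub>R gr x" for k
  have "(\<lambda>k. 1 / real (Suc k)) \<longlonglongrightarrow> 0" using LIMSEQ_inverse_real_of_nat by (simp add: inverse_eq_divide)
  then have "W \<longlonglongrightarrow> w - 0 *\<^sub>R gr x" unfolding W_def by (intro tendsto_intros)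
  then have lim: "W \<longlonglongrightarrow> w" by simp
  have "gr x \<bullet> W k < 0" for k
    using w g_nz[OF x_ball] by (simp add: W_def inner_diff_right)
  then have ge: "0 \<le> L x (W k) + F x (m t) + p1 + p2 \<bullet> W k" for k using inward_supersolution[OF p] by blast
  have "(\<lambda>k. L x (W k) + F x (m t) + p1 + p2 \<bullet> W k) \<longlonglongrightarrow> L x w + F x (m t) + p1 + p2 \<bullet> w"
    by (intro tendsto_intros lim continuous_on_tendsto_compose[OF continuous_L_v lim]) auto
  then show ?thesis by (rule tendsto_lowerbound) (use ge in auto)
qed

text \<open>Nonnegativity on the hyperplane bounds the supremum from above, and the velocity w found
  along the optimal curve attains the bound. The two facts also supply the nonemptiness and
  boundedness that a conditional supremum requires.\<close>

lemma tangential_equation: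
  assumes p: "(p1, p2) \<in> superdiff \<Omega> T u t x" and \<nu>: "outward_normal \<Omega> x = gr x /\<^sub>R norm (gr x)"
  shows "- p1 + tangential_Hamiltonian \<Omega> L x p2 = F x (m t)"
proof -
  have tan: "v \<bullet> outward_normal \<Omega> x = 0 \<longleftrightarrow> gr x \<bullet> v = 0" for v
    using g_nz[OF x_ball] by (simp add: \<nu> inner_commute)
  obtain w where w: "gr x \<bullet> w = 0" "L x w + F x (m t) + p1 + p2 \<bullet> w \<le> 0"
    by (rule tangential_velocity_exists[OF p]) (rule that)
  have ub: "- (p2 \<bullet> v) - L x v \<le> p1 + F x (m t)" if "v \<in> {v. v \<bullet> outward_normal \<Omega> x = 0}" for v
    using tangential_supersolution[OF p, of v] that tan by simp
  have "tangential_Hamiltonian \<Omega> L x p2 \<le> p1 + F x (m t)"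
    unfolding tangential_Hamiltonian_def by (rule cSUP_least) (use w tan ub in auto)
  moreover have "- (p2 \<bullet> w) - L x w \<le> tangential_Hamiltonian \<Omega> L x p2"
    unfolding tangential_Hamiltonian_def
    by (rule cSUP_upper) (use w tan ub in \<open>auto intro!: bdd_aboveI2\<close>)
  ultimately show ?thesis using w(2) by linarith
qed

end

theorem theorem4p12:
  fixes \<Omega> U :: "'a::euclidean_space set"
    and T kappa M c_mu :: real
    and L :: "'a \<Rightarrow> 'a \<Rightarrow> real"
    and Lx Lv :: "'a \<Rightarrow> 'a \<Rightarrow> 'a"
    and Lvx Lvv :: "'a \<Rightarrow> 'a \<Rightarrow> 'a \<Rightarrow> 'a"
    and F G :: "'a \<Rightarrow> 'a measure \<Rightarrow> real"
    and u :: "real \<Rightarrow> 'a \<Rightarrow> real"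
    and m :: "real \<Rightarrow> 'a measure"
    and t :: real and x :: 'a
  assumes T_pos: "T > 0"
    and Omega: "bounded \<Omega>" "open \<Omega>" "C2_boundary \<Omega>"
    and U: "open U" "closure \<Omega> \<subseteq> U"
    \<comment> \<open>(D1)\<close>
    and D1: "\<forall>y\<in>U. \<forall>m1\<in>Prob_on (closure \<Omega>). \<forall>m2\<in>Prob_on (closure \<Omega>).
               \<bar>F y m1 - F y m2\<bar> + \<bar>G y m1 - G y m2\<bar> \<le> kappa * KR_dist m1 m2"
    \<comment> \<open>(D2)\<close>
    and D2: "\<forall>\<mu>\<in>Prob_on (closure \<Omega>). \<exists>DF DG.
               (\<forall>y\<in>U. ((\<lambda>z. F z \<mu>) has_derivative (\<lambda>h. DF y \<bullet> h)) (at y)) \<and>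
               (\<forall>y\<in>U. ((\<lambda>z. G z \<mu>) has_derivative (\<lambda>h. DG y \<bullet> h)) (at y)) \<and>
               continuous_on U DF \<and> continuous_on U DG \<and>
               bounded ((\<lambda>z. F z \<mu>) ` U) \<and> bounded ((\<lambda>z. G z \<mu>) ` U) \<and>
               (\<forall>y\<in>U. norm (DF y) + norm (DG y) \<le> kappa)"
    \<comment> \<open>(D3)\<close>
    and D3: "\<exists>C. \<forall>\<mu>\<in>Prob_on (closure \<Omega>). semiconcave_lin U C (\<lambda>z. F z \<mu>)"
    \<comment> \<open>(L0)\<close>
    and L0_C1: "\<forall>y\<in>U. \<forall>v. ((\<lambda>(z, w). L z w) has_derivative
                   (\<lambda>(h, k). Lx y v \<bullet> h + Lv y v \<bullet> k)) (at (y, v))"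
    and L0_cont: "continuous_on (U \<times> UNIV) (\<lambda>(z, w). Lx z w)"
                 "continuous_on (U \<times> UNIV) (\<lambda>(z, w). Lv z w)"
    and L0_bound: "\<forall>y\<in>U. \<bar>L y 0\<bar> + norm (Lx y 0) + norm (Lv y 0) \<le> M"
    \<comment> \<open>(L1)\<close>
    and L1_diff: "\<forall>y\<in>U. \<forall>v. ((\<lambda>(z, w). Lv z w) has_derivative
                   (\<lambda>(h, k). Lvx y v h + Lvv y v k)) (at (y, v))"
    and L1_mu: "c_mu > 0"
    and L1_vv: "\<forall>y\<in>U. \<forall>v k. (norm k)\<^sup>2 / c_mu \<le> Lvv y v k \<bullet> k \<and> Lvv y v k \<bullet> k \<le> c_mu * (norm k)\<^sup>2"
    and L1_vx: "\<forall>y\<in>U. \<forall>v h. norm (Lvx y v h) \<le> c_mu * (1 + norm v) * norm h"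
    \<comment> \<open>(L2)\<close>
    and L2: "\<forall>R. \<exists>C. \<forall>y\<in>U. \<forall>v\<in>cball 0 R. \<forall>w\<in>cball 0 R. norm (Lx y v - Lx y w) \<le> C * norm (v - w)"
    \<comment> \<open>(L3)\<close>
    and L3: "\<forall>R. \<exists>C. \<forall>v\<in>cball 0 R. semiconcave_lin U C (\<lambda>z. L z v)"
    \<comment> \<open>mild solution and boundary point\<close>
    and mild: "mild_solution \<Omega> T L F G u m"
    and tx: "(t, x) \<in> boundary_Q \<Omega> T m"
  shows "\<forall>(p1, p2)\<in>superdiff \<Omega> T u t x.
           - p1 + tangential_Hamiltonian \<Omega> L x p2 = F x (m t)"
proof clarify
  fix p1 p2 assume p: "(p1, p2) \<in> superdiff \<Omega> T u t x"
  have t: "0 < t" "t < T" and xf: "x \<in> frontier \<Omega>" and xm: "x \<in> msupport (m t)"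
    using tx by (auto simp: boundary_Q_def)
  obtain \<eta> where \<eta>: "constrained_equilibrium \<Omega> T L F G (m 0) \<eta>" "\<And>s. s \<in> {0..T} \<Longrightarrow> m s = eval_flow \<eta> s"
    "\<And>s y. s \<in> {0..T} \<Longrightarrow> y \<in> closure \<Omega> \<Longrightarrow> ereal (u s y) = (INF \<gamma>\<in>Gamma_at \<Omega> T s y. cost L F G T m s \<gamma>)"
    using mild unfolding mild_solution_def by blast
  interpret mfg_value \<Omega> U T kappa M c_mu L Lx Lv Lvx Lvv F G m u
  proof unfold_locales
    show "\<forall>s\<in>{0..T}. m s \<in> Prob_on (closure \<Omega>)"
      "\<forall>s\<in>{0..T}. \<forall>\<epsilon>>0. \<exists>\<delta>>0. \<forall>r\<in>{0..T}. \<bar>r - s\<bar> < \<delta> \<longrightarrow> KR_dist (m r) (m s) < \<epsilon>"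
      using mild unfolding mild_solution_def by blast+
  qed (fact assms \<eta>(3))+
  have tT: "t \<in> {0..T}" using t by simp
  obtain \<gamma> where \<gamma>: "optimal \<gamma>" "apply_bcontfun \<gamma> t = x"
    by (rule optimal_curve_through[OF \<eta>(1,2) tT xm]) (assumption, rule that)
  obtain dens where dens:
    "\<And>a b. a \<le> b \<Longrightarrow> (dens has_integral (apply_bcontfun \<gamma> b - apply_bcontfun \<gamma> a)) {a..b}"
    "(\<lambda>s. (norm (dens s))\<^sup>2) integrable_on {0..T}"
    "(\<lambda>s. L (apply_bcontfun \<gamma> s) (dens s) + F (apply_bcontfun \<gamma> s) (m s)) integrable_on {0..T}"
    "\<And>a b. integral {a..b} (lag \<gamma>) =
       integral {a..b} (\<lambda>s. L (apply_bcontfun \<gamma> s) (dens s) + F (apply_bcontfun \<gamma> s) (m s))"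
    by (rule optimal_density[OF \<gamma>(1)]) (rule that)
  \<comment> \<open>The chart is taken from the very choice that defines
    \<open>outward_normal\<close>, so its normalised gradient is the outward normal and no two
    charts have to be compared.\<close>
  have "\<exists>\<nu> r \<psi> g. local_defining_fn \<Omega> x r \<psi> g \<and> \<nu> = g x /\<^sub>R norm (g x)"
    using Omega(3) xf unfolding C2_boundary_def by blast
  from someI_ex[OF this] obtain r \<psi> g where chart: "local_defining_fn \<Omega> x r \<psi> g"
    and \<nu>: "outward_normal \<Omega> x = g x /\<^sub>R norm (g x)"
    unfolding outward_normal_def by blast
  interpret mfg_contact \<Omega> U T kappa M c_mu L Lx Lv Lvx Lvv F G m u x r \<psi> g \<gamma> t dens
    by unfold_locales (fact chart Omega(2) xf \<gamma> t dens)+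
  show "- p1 + tangential_Hamiltonian \<Omega> L x p2 = F x (m t)"
    by (rule tangential_equation[OF p \<nu>])
qed

end
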